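(* Let $k\ge2$ and $0<\alpha<1$. Among all $k$-uniform linear unicyclic hypergraphs with $m$ hyperedges and girth $g$ ($3\le g\le m$), $C_g^{(k)}\odot S_{m-g}^{(k)}$ has the largest $2$-nd order $\mathcal{A}_\alpha$-spectral moment. Among all $k$-uniform linear unicyclic hypergraphs with $m$ hyperedges, $C_3^{(k)}\odot S_{m-3}^{(k)}$ has the largest $2$-nd order $\mathcal{A}_\alpha$-spectral moment, and $C^{(k)}_{3;m-4,1,0}$ has the second largest $2$-nd order $\mathcal{A}_\alpha$-spectral moment.
   Context: Hypergraphs are finite; $k$-uniform means every hyperedge has exactly $k$ vertices; linear means any two distinct hyperedges share at most one vertex; unicyclic means connected with exactly one cycle; the girth is the minimum length of a cycle. A cored vertex is a vertex of degree one. "Adding a pendant hyperedge to a vertex $v$" means adding a new hyperedge consisting of $v$ and $k-1$ new vertices. The hypercycle $C_g^{(k)}$ is obtained from the cycle graph $C_g$ by inserting $k-2$ new (cored) vertices into each edge. $C_g^{(k)}\odot S_{m-g}^{(k)}$ is obtained from $C_g^{(k)}$ by adding $m-g$ pendant hyperedges to a non-cored vertex of $C_g^{(k)}$. $C^{(k)}_{3;n_1,n_2,n_3}$ is obtained from $C_3^{(k)}$ by adding $n_1,n_2,n_3$ pendant hyperedges to the three non-cored vertices of $C_3^{(k)}$, respectively. For a $k$-uniform hypergraph $\mathcal{H}$ on $[n]$, $\mathcal{A}(\mathcal{H})$ is the $k$-order $n$-dimensional tensor with entry $\frac1{(k-1)!}$ at $(i_1,\dots,i_k)$ if $\{i_1,\dots,i_k\}\in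 E(\mathcal{H})$ and $0$ otherwise; $\mathcal{D}(\mathcal{H})$ is the diagonal tensor of vertex degrees; $\mathcal{A}_\alpha(\mathcal{H})=\alpha\mathcal{D}(\mathcal{H})+(1-\alpha)\mathcal{A}(\mathcal{H})$. The $d$-th order $\mathcal{A}_\alpha$-spectral moment of $\mathcal{H}$ is the sum of the $d$-th powers of all $n(k-1)^{n-1}$ eigenvalues of $\mathcal{A}_\alpha(\mathcal{H})$; it equals the $d$-th order trace $\mathrm{Tr}_d(\mathcal{A}_\alpha(\mathcal{H}))$, where for a $k$-order $n$-dimensional tensor $\mathcal{T}$ and $d\ge1$, $$\mathrm{Tr}_{d}(\mathcal{T})=(k-1)^{n-1}\sum_{d_1+\cdots+d_n=d}\ \prod_{i=1}^{n}\frac{1}{(d_i(k-1))!}\Big(\sum_{\gamma\in[n]^{k-1}}(\mathcal{T})_{i\gamma}\frac{\partial}{\partial a_{i\gamma}}\Big)^{d_i}\mathrm{tr}\big(A^{d(k-1)}\big),$$ with $A=(a_{ij})$ an $n\times n$ matrix of indeterminates, $d_i\ge0$ integers, $\frac{\partial}{\partial a_{i\gamma}}=\frac{\partial}{\partial a_{i i_2}}\cdots\frac{\partial}{\partial a_{i i_k}}$ for $\gamma=i_2\cdots i_k$. *)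

theory Defs
  imports "HOL-Library.Poly_Mapping" "HOL-Library.Multiset"
    "HOL-Computational_Algebra.Fundamental_Theorem_Algebra"
    "Jordan_Normal_Form.Determinant"
begin

section \<open>Hypergraphs\<close>

text \<open>\<open>Hypergraph n E\<close> is the hypergraph with vertex set \<open>{0..<n}\<close> and set of hyperedges \<open>E\<close>.\<close>

datatype hypergraph = Hypergraph (nverts: nat) (hedges: "nat set set")

definition verts :: "hypergraph \<Rightarrow> nat set" where
  "verts H = {0..<nverts H}"

definition uniform :: "nat \<Rightarrow> hypergraph \<Rightarrow> bool" where
  "uniform k H \<longleftrightarrow> (\<forall>e\<in>hedges H. e \<subseteq> verts H \<and> card e = k)"

definition linear_hg :: "hypergraph \<Rightarrow> bool" where
  "linear_hg H \<longleftrightarrow> (\<forall>e\<in>hedges H. \<forall>f\<in>hedges H. e \<noteq> f \<longrightarrow> card (e \<inter> f) \<le> 1)"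

definition hdegree :: "hypergraph \<Rightarrow> nat \<Rightarrow> nat" where
  "hdegree H v = card {e \<in> hedges H. v \<in> e}"

definition connected_hg :: "hypergraph \<Rightarrow> bool" where
  "connected_hg H \<longleftrightarrow> (\<forall>u\<in>verts H. \<forall>v\<in>verts H.
     (u, v) \<in> {(x, y). \<exists>e\<in>hedges H. x \<in> e \<and> y \<in> e}\<^sup>*)"

text \<open>A cycle of length \<open>l \<ge> 2\<close> is a cyclic alternating sequence
  \<open>v\<^sub>0, e\<^sub>0, v\<^sub>1, e\<^sub>1, \<dots>, v\<^bsub>l-1\<^esub>, e\<^bsub>l-1\<^esub>, v\<^sub>0\<close> of distinct vertices and distinct hyperedges, each
  hyperedge containing its two neighbours in the sequence.\<close>

definition is_cycle :: "hypergraph \<Rightarrow> nat list \<Rightarrow> nat set list \<Rightarrow> bool" where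
  "is_cycle H vs es \<longleftrightarrow>
     length vs = length es \<and> 2 \<le> length vs \<and> distinct vs \<and> distinct es \<and> set es \<subseteq> hedges H \<and>
     (\<forall>i<length vs. vs ! i \<in> es ! i \<and> vs ! (Suc i mod length vs) \<in> es ! i)"

text \<open>The incidences traversed by a cyclic sequence. They determine the sequence up to rotation and
  reversal, so cycles are counted by counting these sets.\<close>

definition cycle_flags :: "nat list \<Rightarrow> nat set list \<Rightarrow> (nat \<times> nat set) set" where
  "cycle_flags vs es =
     (\<Union>i<length vs. {(vs ! i, es ! i), (vs ! (Suc i mod length vs), es ! i)})"

definition unicyclic :: "hypergraph \<Rightarrow> bool" where
  "unicyclic H \<longleftrightarrow> connected_hg H \<and> (\<exists>!F. \<exists>vs es. is_cycle H vs es \<and> F = cycle_flags vs es)"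

definition girth :: "hypergraph \<Rightarrow> nat" where
  "girth H = (LEAST l. \<exists>vs es. is_cycle H vs es \<and> length vs = l)"

definition linear_unicyclic :: "nat \<Rightarrow> nat \<Rightarrow> hypergraph set" where
  "linear_unicyclic k m =
     {H. uniform k H \<and> linear_hg H \<and> unicyclic H \<and> card (hedges H) = m}"

definition isomorphic_hg :: "hypergraph \<Rightarrow> hypergraph \<Rightarrow> bool" (infix "\<cong>\<^sub>h" 50) where
  "H \<cong>\<^sub>h K \<longleftrightarrow> (\<exists>f. bij_betw f (verts H) (verts K) \<and> (`) f ` hedges H = hedges K)"

definition add_pendant :: "nat \<Rightarrow> nat \<Rightarrow> hypergraph \<Rightarrow> hypergraph" where
  "add_pendant k v H =
     Hypergraph (nverts H + (k - 1))
       (insert (insert v {nverts H..<nverts H + (k - 1)}) (hedges H))"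

text \<open>Vertices \<open>0, \<dots>, g - 1\<close> of the hypercycle are those of the cycle graph, hence the non-cored ones;
  the \<open>k - 2\<close> vertices inserted into the \<open>i\<close>-th edge are numbered from \<open>g + i * (k - 2)\<close>.\<close>

definition hypercycle :: "nat \<Rightarrow> nat \<Rightarrow> hypergraph" where
  "hypercycle k g =
     Hypergraph (g + g * (k - 2))
       ((\<lambda>i. {i, Suc i mod g} \<union> {g + i * (k - 2)..<g + Suc i * (k - 2)}) ` {..<g})"

definition cycle_star :: "nat \<Rightarrow> nat \<Rightarrow> nat \<Rightarrow> hypergraph" where
  "cycle_star k g p = (add_pendant k 0 ^^ p) (hypercycle k g)"

definition triangle_pendants :: "nat \<Rightarrow> nat \<Rightarrow> nat \<Rightarrow> nat \<Rightarrow> hypergraph" where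
  "triangle_pendants k n1 n2 n3 =
     (add_pendant k 2 ^^ n3) ((add_pendant k 1 ^^ n2) ((add_pendant k 0 ^^ n1) (hypercycle k 3)))"

text \<open>Ranking is by isomorphism class: every member of the class not isomorphic to \<open>X\<close> has a strictly
  smaller value.\<close>

definition has_largest :: "(hypergraph \<Rightarrow> real) \<Rightarrow> hypergraph set \<Rightarrow> hypergraph \<Rightarrow> bool" where
  "has_largest \<mu> \<G> X \<longleftrightarrow> X \<in> \<G> \<and> (\<forall>H\<in>\<G>. \<not> H \<cong>\<^sub>h X \<longrightarrow> \<mu> H < \<mu> X)"


section \<open>Tensors of a hypergraph\<close>

text \<open>A \<open>k\<close>-order \<open>n\<close>-dimensional tensor is a function on index lists, used only at lists of length
  \<open>k\<close> with entries in \<open>{0..<n}\<close>.\<close>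

type_synonym tensor = "nat list \<Rightarrow> real"

definition adjacency_tensor :: "nat \<Rightarrow> hypergraph \<Rightarrow> tensor" where
  "adjacency_tensor k H is = (if set is \<in> hedges H then 1 / fact (k - 1) else 0)"

definition degree_tensor :: "hypergraph \<Rightarrow> tensor" where
  "degree_tensor H is = (if \<forall>j\<in>set is. j = hd is then real (hdegree H (hd is)) else 0)"

definition A_alpha :: "nat \<Rightarrow> real \<Rightarrow> hypergraph \<Rightarrow> tensor" where
  "A_alpha k \<alpha> H is = \<alpha> * degree_tensor H is + (1 - \<alpha>) * adjacency_tensor k H is"

definition indices :: "nat \<Rightarrow> nat \<Rightarrow> nat list set" where
  "indices n r = {\<gamma>. length \<gamma> = r \<and> set \<gamma> \<subseteq> {0..<n}}"


section \<open>Eigenvalues of a tensor\<close>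

text \<open>The eigenvalues of a \<open>k\<close>-order \<open>n\<close>-dimensional tensor \<open>T\<close> are the roots, with multiplicity, of its
  characteristic polynomial: the resultant, as a polynomial in \<open>\<lambda>\<close>, of the \<open>n\<close> forms
  \<open>f\<^sub>i = \<lambda> x\<^sub>i\<^bsup>k-1\<^esup> - (\<Sum>\<gamma>. T\<^bsub>i\<gamma>\<^esub> x\<^sup>\<gamma>)\<close> of degree \<open>k - 1\<close> in \<open>x\<^sub>0, \<dots>, x\<^bsub>n-1\<^esub>\<close>.
  The resultant is the one of Macaulay (1902). Put \<open>D = n (k - 2) + 1\<close>. Every
  monomial \<open>x\<^sup>a\<close> of degree \<open>D\<close> is divisible by some \<open>x\<^sub>i\<^bsup>k-1\<^esup>\<close>; let \<open>i(a)\<close> be the least such \<open>i\<close>. The Macaulay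
  matrix has as row \<open>a\<close> the coefficients of \<open>(x\<^sup>a / x\<^bsub>i(a)\<^esub>\<^bsup>k-1\<^esup>) f\<^bsub>i(a)\<^esub>\<close>. The resultant is its determinant divided
  by its minor on those monomials divisible by \<open>x\<^sub>i\<^bsup>k-1\<^esup>\<close> for at least two \<open>i\<close>. Both
  determinants are monic in \<open>\<lambda>\<close>, so the divisor is nonzero, and the division is exact
  by Macaulay's theorem. For \<open>k = 2\<close> this is the characteristic polynomial of a matrix.

  Monomials are multisets of variable indices.\<close>

definition char_form_coeff :: "nat \<Rightarrow> nat \<Rightarrow> tensor \<Rightarrow> nat \<Rightarrow> nat multiset \<Rightarrow> complex poly" where
  "char_form_coeff k n T i c =
     (if c = replicate_mset (k - 1) i then [:0, 1:] else 0)
     - [: complex_of_real (\<Sum>\<gamma> | \<gamma> \<in> indices n (k - 1) \<and> mset \<gamma> = c. T (i # \<gamma>)) :]"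

definition macaulay_index :: "nat \<Rightarrow> nat multiset \<Rightarrow> nat" where
  "macaulay_index k a = (LEAST i. k - 1 \<le> count a i)"

definition macaulay_entry :: "nat \<Rightarrow> nat \<Rightarrow> tensor \<Rightarrow> nat multiset \<Rightarrow> nat multiset \<Rightarrow> complex poly" where
  "macaulay_entry k n T a b =
     (let i = macaulay_index k a; q = a - replicate_mset (k - 1) i in
      if q \<subseteq># b then char_form_coeff k n T i (b - q) else 0)"

definition macaulay_det :: "nat \<Rightarrow> nat \<Rightarrow> tensor \<Rightarrow> nat multiset list \<Rightarrow> complex poly" where
  "macaulay_det k n T ms =
     det (mat (length ms) (length ms) (\<lambda>(r, c). macaulay_entry k n T (ms ! r) (ms ! c)))"

text \<open>A list without repetition of all monomials of degree \<open>D\<close> in \<open>n\<close> variables. Its order is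
  immaterial.\<close>

definition monomials :: "nat \<Rightarrow> nat \<Rightarrow> nat multiset list" where
  "monomials n D = map mset (filter sorted (List.n_lists D [0..<n]))"

definition nonreduced :: "nat \<Rightarrow> nat multiset \<Rightarrow> bool" where
  "nonreduced k a \<longleftrightarrow> (\<exists>i j. i \<noteq> j \<and> k - 1 \<le> count a i \<and> k - 1 \<le> count a j)"

definition tensor_char_poly :: "nat \<Rightarrow> nat \<Rightarrow> tensor \<Rightarrow> complex poly" where
  "tensor_char_poly k n T =
     (let ms = monomials n (n * (k - 2) + 1) in
      macaulay_det k n T ms div macaulay_det k n T (filter (nonreduced k) ms))"

definition tensor_eigenvalues :: "nat \<Rightarrow> nat \<Rightarrow> tensor \<Rightarrow> complex multiset" where
  "tensor_eigenvalues k n T = proots (tensor_char_poly k n T)"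

definition tensor_moment :: "nat \<Rightarrow> nat \<Rightarrow> nat \<Rightarrow> tensor \<Rightarrow> complex" where
  "tensor_moment k n d T = (\<Sum>z\<in>#tensor_eigenvalues k n T. z ^ d)"

text \<open>The eigenvalues of a real tensor are closed under conjugation, so their power sums are real and
  \<open>Re\<close> is only a change of type.\<close>

definition spectral_moment :: "nat \<Rightarrow> real \<Rightarrow> nat \<Rightarrow> hypergraph \<Rightarrow> real" where
  "spectral_moment k \<alpha> d H = Re (tensor_moment k (nverts H) d (A_alpha k \<alpha> H))"


section \<open>Traces of a tensor\<close>

text \<open>Polynomials in the indeterminates \<open>a\<^bsub>ij\<^esub>\<close>, as finitely supported functions from exponent vectors
  to coefficients.\<close>

type_synonym ipoly = "((nat \<times> nat) \<Rightarrow>\<^sub>0 nat) \<Rightarrow>\<^sub>0 real"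

definition indet :: "nat \<Rightarrow> nat \<Rightarrow> ipoly" where
  "indet i j = Poly_Mapping.single (Poly_Mapping.single (i, j) 1) 1"

definition const_ipoly :: "real \<Rightarrow> ipoly" where
  "const_ipoly c = Poly_Mapping.single 0 c"

definition pdiff :: "nat \<times> nat \<Rightarrow> ipoly \<Rightarrow> ipoly" where
  "pdiff v p = (\<Sum>s\<in>Poly_Mapping.keys p.
     Poly_Mapping.single (s - Poly_Mapping.single v 1)
       (real (Poly_Mapping.lookup s v) * Poly_Mapping.lookup p s))"

definition pdiff_list :: "nat \<Rightarrow> nat list \<Rightarrow> ipoly \<Rightarrow> ipoly" where
  "pdiff_list i \<gamma> p = foldr (\<lambda>j. pdiff (i, j)) \<gamma> p"

definition tensor_op :: "nat \<Rightarrow> nat \<Rightarrow> tensor \<Rightarrow> nat \<Rightarrow> ipoly \<Rightarrow> ipoly" where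
  "tensor_op k n T i p = (\<Sum>\<gamma>\<in>indices n (k - 1). const_ipoly (T (i # \<gamma>)) * pdiff_list i \<gamma> p)"

definition power_trace :: "nat \<Rightarrow> nat \<Rightarrow> ipoly" where
  "power_trace n N = (\<Sum>i<n. (mat n n (\<lambda>(i, j). indet i j) ^\<^sub>m N) $$ (i, i))"

text \<open>Differentiating the form \<open>tr(A\<^bsup>d(k-1)\<^esup>)\<close> exactly \<open>d(k-1)\<close> times leaves a constant polynomial;
  \<open>lookup _ 0\<close> reads off its value. The product over \<open>i\<close> is a composition of commuting operators.\<close>

definition tensor_trace :: "nat \<Rightarrow> nat \<Rightarrow> nat \<Rightarrow> tensor \<Rightarrow> real" where
  "tensor_trace k n d T = real (k - 1) ^ (n - 1) *
     (\<Sum>ds | length ds = n \<and> sum_list ds = d.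
        Poly_Mapping.lookup
          (foldr (\<lambda>i p. const_ipoly (1 / fact (ds ! i * (k - 1))) * (tensor_op k n T i ^^ (ds ! i)) p)
             [0..<n] (power_trace n (d * (k - 1)))) 0)"

end

theory Submission
  imports Defs "Jordan_Normal_Form.Schur_Decomposition"
begin

text \<open>The second power sum of the roots of a monic polynomial depends only on its three leading
  coefficients. These are the same for the polynomial quotient of the two Macaulay determinants as for their
  quotient as a power series in \<open>1 / \<lambda>\<close>, whether or not the division is exact; so the second moment is a
  difference of traces of squares of the two Macaulay matrices. For the tensor of a hypergraph only the
  diagonal entries of the reduced rows survive, plus the edges themselves if \<open>k = 2\<close>, and the
  moment is \<open>(k - 1)\<^bsup>n - 1\<^esup> \<alpha>\<^sup>2 \<Sum>d\<^sub>v\<^sup>2\<close>, plus \<open>2 m (1 - \<alpha>)\<^sup>2\<close> if \<open>k = 2\<close>. The walks counted by the trace give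
  the same value. A linear unicyclic hypergraph has \<open>n = m (k - 1)\<close> vertices, so only \<open>\<Sum>d\<^sub>v\<^sup>2\<close> is to be
  compared. Writing \<open>d\<^sub>v = 2 + y\<^sub>v\<close> on a cycle of length \<open>g\<close> and \<open>d\<^sub>v = 1 + y\<^sub>v\<close> elsewhere, the excesses \<open>y\<^sub>v\<close>
  have sum \<open>m - g\<close>, and \<open>\<Sum>d\<^sub>v\<^sup>2\<close> is largest if all the excess sits at one vertex of the cycle, second
  largest if a single unit of it moves to another vertex of the cycle. Once all excess lies on the cycle, the
  hypergraph is the cycle with pendant hyperedges, determined by the degrees of its cycle vertices.\<close>

section \<open>Power sums of the roots of a quotient of characteristic polynomials\<close>

text \<open>In the difference of the two traces only reduced monomials remain, those divisible by
  x_i^(k-1) for exactly one i. For fixed i the other n - 1 exponents range freely over 0, ..., k -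
  2, and the diagonal entry of such a row is \<alpha> d_i; hence the factor (k-1)^(n-1) and the sum
  of squared degrees. Reading off three leading coefficients asks for a quotient of degree at least
  2, which two vertices guarantee.

  The vertex count is Euler's relation for the incidence graph: m k incidences on n + m nodes with a
  single cycle. The number of vertices and the sum of the degrees are then fixed, and a unit of
  excess is worth more on the cycle because (2+y)^2 grows faster than (1+y)^2. Across girths, the
  best value for a girth above 3 already lies below the second best value for girth 3. Second place
  starts at m = 5: for m = 4 both named hypergraphs are a triangle with one pendant
  hyperedge.\<close>

lemma reflect_linear: "reflect_poly [:- a, 1:] = [:1, - a :: 'a::idom:]"
  by (rule poly_eqI) (auto simp: coeff_reflect_poly coeff_pCons split: nat.splits)

text \<open>Reflection turns the product of the x - a into the product of the 1 - a x. Its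
  coefficients are the signed elementary symmetric functions, and the last claim is Newton's
  identity 2 e_2 = p_1^2 - p_2.\<close>

lemma top_coeffs_prod_list:
  fixes as :: "'a::idom list"
  defines "R \<equiv> reflect_poly (\<Prod>a\<leftarrow>as. [:- a, 1:])"
  shows "coeff R 0 = 1" "coeff R 1 = - sum_list as"
    "2 * coeff R 2 = (sum_list as)\<^sup>2 - (\<Sum>a\<leftarrow>as. a\<^sup>2)"
proof -
  have R: "R = (\<Prod>a\<leftarrow>as. [:1, - a:])"
    unfolding R_def reflect_poly_prod_list by (simp add: o_def reflect_linear)
  have "coeff R 0 = 1 \<and> coeff R 1 = - sum_list as
      \<and> 2 * coeff R 2 = (sum_list as)\<^sup>2 - (\<Sum>a\<leftarrow>as. a\<^sup>2)"
    unfolding R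
    by (induction as) (auto simp: numeral_2_eq_2 algebra_simps power2_eq_square)
  then show "coeff R 0 = 1" "coeff R 1 = - sum_list as"
    "2 * coeff R 2 = (sum_list as)\<^sup>2 - (\<Sum>a\<leftarrow>as. a\<^sup>2)" by auto
qed

lemma degree_prod_linear: "degree (\<Prod>a\<leftarrow>as. [:- a, 1 :: 'a::idom:]) = length as"
proof (induction as)
  case (Cons a as)
  then have "(\<Prod>a\<leftarrow>as. [:- a, 1 :: 'a:]) \<noteq> 0" by (auto simp: prod_list_zero_iff)
  with Cons show ?case by (simp add: degree_mult_eq del: mult_pCons_left)
qed simp

lemma monic_prod_linear: "lead_coeff (\<Prod>a\<leftarrow>as. [:- a, 1 :: 'a::idom:]) = 1"
  by (induction as) (simp_all add: lead_coeff_mult del: mult_pCons_left)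

text \<open>Dropping the remainder of the division changes no coefficient in degree at least \<open>degree Q\<close>, in
  particular none of the top three.\<close>

lemma power_sum_poly_div:
  fixes as bs :: "complex list"
  defines "P \<equiv> \<Prod>a\<leftarrow>as. [:- a, 1:]" and "Q \<equiv> \<Prod>b\<leftarrow>bs. [:- b, 1:]"
  assumes len: "length bs + 2 \<le> length as"
  shows "(\<Sum>z\<in>#proots (P div Q). z\<^sup>2) = (\<Sum>a\<leftarrow>as. a\<^sup>2) - (\<Sum>b\<leftarrow>bs. b\<^sup>2)"
proof -
  let ?S = "P div Q" and ?R = "P mod Q"
  have degs: "degree P = length as" "degree Q = length bs"
    unfolding P_def Q_def by (rule degree_prod_linear)+
  have lc: "lead_coeff P = 1" "lead_coeff Q = 1"
    unfolding P_def Q_def by (rule monic_prod_linear)+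
  then have nz: "P \<noteq> 0" "Q \<noteq> 0" by auto
  have R: "?R = 0 \<or> degree ?R < degree Q" using degree_mod_less[of Q P] nz by auto
  have eq: "P = Q * ?S + ?R" by simp
  have top: "coeff P i = coeff (Q * ?S) i" if "length bs \<le> i" for i
  proof -
    have "coeff ?R i = 0" using R that degs by (auto intro: coeff_eq_0)
    then show ?thesis using eq by (metis add.right_neutral coeff_add)
  qed
  have degQS: "degree (Q * ?S) = degree P"
  proof (rule antisym)
    show "degree (Q * ?S) \<le> degree P"
    proof (rule degree_le, intro allI impI)
      fix i assume "degree P < i"
      then show "coeff (Q * ?S) i = 0" using top[of i] degs len by (simp add: coeff_eq_0)
    qed
    show "degree P \<le> degree (Q * ?S)"
      using top[of "degree P"] degs len lc by (intro le_degree) auto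
  qed
  have lS: "lead_coeff ?S = 1"
    using top[of "degree P"] degs len lc degQS lead_coeff_mult[of Q ?S] by simp
  obtain cs where cs: "proots ?S = mset cs" by (metis ex_mset)
  have S: "?S = (\<Prod>c\<leftarrow>cs. [:- c, 1:])"
    using complex_poly_decompose_multiset[of ?S] lS cs
    by (simp del: mset_map add: mset_map[symmetric] prod_mset_prod_list)
  have QS: "Q * ?S = (\<Prod>c\<leftarrow>bs @ cs. [:- c, 1:])" by (subst S) (simp add: Q_def)
  \<comment> \<open>The hypothesis \<open>len\<close> keeps the three indices
    \<open>degree P - i\<close> inside the range of \<open>top\<close>, and the equal degrees align
    the two reflected polynomials.\<close>
  have same: "coeff (reflect_poly P) i = coeff (reflect_poly (Q * ?S)) i" if "i \<le> 2" for i
    using top[of "degree P - i"] that len degs degQS by (simp add: coeff_reflect_poly)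
  have "- sum_list as = - sum_list (bs @ cs)"
    using same[of 1] top_coeffs_prod_list(2)[of as] top_coeffs_prod_list(2)[of "bs @ cs"]
    unfolding QS unfolding P_def by simp
  then have s1: "sum_list as = sum_list (bs @ cs)" by (simp only: neg_equal_iff_equal)
  have "(sum_list as)\<^sup>2 - (\<Sum>a\<leftarrow>as. a\<^sup>2) = (sum_list (bs @ cs))\<^sup>2 - (\<Sum>a\<leftarrow>bs @ cs. a\<^sup>2)"
    using same[of 2] top_coeffs_prod_list(3)[of as] top_coeffs_prod_list(3)[of "bs @ cs"]
    unfolding QS unfolding P_def by simp
  then have "(\<Sum>a\<leftarrow>as. a\<^sup>2) = (\<Sum>a\<leftarrow>bs @ cs. a\<^sup>2)"
    unfolding s1 by (simp only: diff_conv_add_uminus add_left_cancel neg_equal_iff_equal)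
  then show ?thesis unfolding cs
    by (simp add: sum_mset_sum_list[symmetric] del: mset_map flip: mset_map)
qed

section \<open>Power sums of eigenvalues as traces of squares\<close>

definition mat_trace :: "'a::comm_monoid_add mat \<Rightarrow> 'a" where
  "mat_trace A = (\<Sum>i<dim_row A. A $$ (i, i))"

lemma mat_trace_mult:
  assumes "A \<in> carrier_mat n m" "B \<in> carrier_mat m n"
  shows "mat_trace (A * B) = (\<Sum>i<n. \<Sum>j<m. A $$ (i, j) * B $$ (j, i))"
  using assms unfolding mat_trace_def
  by (auto simp: scalar_prod_def lessThan_atLeast0 intro!: sum.cong)

lemma mat_trace_comm:
  fixes A :: "'a::comm_semiring_0 mat"
  assumes "A \<in> carrier_mat n m" "B \<in> carrier_mat m n"
  shows "mat_trace (A * B) = mat_trace (B * A)"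
  unfolding mat_trace_mult[OF assms] mat_trace_mult[OF assms(2,1)]
  by (subst sum.swap) (simp add: mult.commute)

text \<open>Schur triangularisation makes \<open>A\<close> similar to an upper triangular
  \<open>B\<close> with diagonal \<open>as\<close>. The trace is invariant under cyclic exchange,
  and in the trace of \<open>B * B\<close> a product of two opposite off-diagonal entries has a zero
  factor.\<close>

lemma power_sum_char_poly:
  fixes A :: "complex mat"
  assumes A: "A \<in> carrier_mat n n" and as: "char_poly A = (\<Prod>a\<leftarrow>as. [:- a, 1:])"
  shows "(\<Sum>a\<leftarrow>as. a\<^sup>2) = mat_trace (A * A)"
proof -
  obtain B P Q where "schur_decomposition A as = (B, P, Q)"
    by (cases "schur_decomposition A as")
  from schur_decomposition[OF A as this]
  have w: "similar_mat_wit A B P Q" and ut: "upper_triangular B" and dg: "diag_mat B = as" by auto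
  from w A have c: "B \<in> carrier_mat n n" "P \<in> carrier_mat n n" "Q \<in> carrier_mat n n"
    and QP: "Q * P = 1\<^sub>m n" and AB: "A = P * B * Q"
    unfolding similar_mat_wit_def Let_def by auto
  have "A * A = P * (B * (Q * P) * (B * Q))"
    unfolding AB using c by (simp add: assoc_mult_mat[of _ n n _ n _ n])
  also have "\<dots> = P * (B * B * Q)"
    unfolding QP using c by (simp add: assoc_mult_mat[of _ n n _ n _ n])
  finally have "mat_trace (A * A) = mat_trace (B * B * Q * P)"
    using c by (simp add: mat_trace_comm[of P n n])
  also have "\<dots> = mat_trace (B * B)"
    using c QP by (simp add: assoc_mult_mat[of _ n n _ n _ n])
  also have "\<dots> = (\<Sum>i<n. \<Sum>j<n. if j = i then (B $$ (i, i))\<^sup>2 else 0)"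
    unfolding mat_trace_mult[OF c(1,1)]
  proof (intro sum.cong refl)
    fix i j assume "i \<in> {..<n}" "j \<in> {..<n}"
    then show "B $$ (i, j) * B $$ (j, i) = (if j = i then (B $$ (i, i))\<^sup>2 else 0)"
      using upper_triangularD[OF ut, of i j] upper_triangularD[OF ut, of j i] c(1)
      by (cases i j rule: linorder_cases) (auto simp: power2_eq_square)
  qed
  also have "\<dots> = (\<Sum>i<n. (B $$ (i, i))\<^sup>2)" by simp
  also have "\<dots> = (\<Sum>a\<leftarrow>as. a\<^sup>2)"
    unfolding dg[symmetric] diag_mat_def using c(1)
    by (simp add: sum_list_sum_nth o_def lessThan_atLeast0)
  finally show ?thesis by simp
qed

text \<open>The \<lambda>-free part of the Macaulay matrix, with opposite sign: the Macaulay matrix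
  is \<lambda> times the identity minus this matrix, so its determinants are characteristic
  polynomials.\<close>

definition macaulay_coeff :: "nat \<Rightarrow> nat \<Rightarrow> tensor \<Rightarrow> nat multiset \<Rightarrow> nat multiset \<Rightarrow> real" where
  "macaulay_coeff k n T a b =
     (let i = macaulay_index k a; q = a - replicate_mset (k - 1) i in
      if q \<subseteq># b then \<Sum>\<gamma> | \<gamma> \<in> indices n (k - 1) \<and> mset \<gamma> = b - q. T (i # \<gamma>) else 0)"

definition monomial_set :: "nat \<Rightarrow> nat \<Rightarrow> nat multiset set" where
  "monomial_set n D = {a. size a = D \<and> set_mset a \<subseteq> {0..<n}}"

lemma set_monomials: "set (monomials n D) = monomial_set n D"
proof -
  have "a \<in> mset ` {xs. (length xs = D \<and> set xs \<subseteq> {0..<n}) \<and> sorted xs}"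
    if "size a = D" "set_mset a \<subseteq> {0..<n}" for a
    using that by (intro image_eqI[of _ _ "sorted_list_of_multiset a"])
      (auto simp: size_mset[symmetric] simp del: size_mset)
  then show ?thesis
    unfolding monomials_def monomial_set_def by (auto simp: set_n_lists)
qed

lemma distinct_monomials: "distinct (monomials n D)"
proof -
  have "inj_on mset {xs :: nat list. sorted xs}"
    by (intro inj_onI) (metis mem_Collect_eq properties_for_sort sorted_sort_id)
  then show ?thesis
    unfolding monomials_def distinct_map by (auto simp: distinct_n_lists intro: inj_on_subset)
qed

lemma finite_monomial_set: "finite (monomial_set n D)"
  using set_monomials[of n D] by (metis List.finite_set)

text \<open>Pigeonhole: if all exponents were at most k - 2, the degree would be at most n (k - 2),
  one less than it is. Thus the \<open>LEAST\<close> in \<open>macaulay_index\<close> is taken over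
  a nonempty set.\<close>

lemma macaulay_index_count:
  assumes "a \<in> monomial_set n (n * (k - 2) + 1)" "2 \<le> k"
  shows "k - 1 \<le> count a (macaulay_index k a)"
proof -
  have "\<exists>i. k - 1 \<le> count a i"
  proof (rule ccontr)
    assume "\<nexists>i. k - 1 \<le> count a i"
    then have "\<not> k - 1 \<le> count a i" for i by blast
    then have "count a i \<le> k - 2" for i
    proof -
      have "\<not> k - 1 \<le> count a i" by fact
      then show ?thesis by linarith
    qed
    then have "size a \<le> card (set_mset a) * (k - 2)"
      unfolding size_multiset_overloaded_eq using sum_bounded_above[of "set_mset a" "count a" "k - 2"] by simp
    moreover have "card (set_mset a) \<le> n"
      using assms(1) card_mono[of "{0..<n}" "set_mset a"] by (simp add: monomial_set_def)
    ultimately have "size a \<le> n * (k - 2)" by (meson le_trans mult_le_mono1)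
    then show False using assms(1) by (simp add: monomial_set_def)
  qed
  then show ?thesis unfolding macaulay_index_def by (rule LeastI_ex)
qed

text \<open>Row \<open>a\<close> holds the coefficients of the product of x^q with f_i, where x^a is
  x^q times x_i^(k-1). The only term with \<lambda> is x^q times x_i^(k-1), that is x^a itself, so
  \<lambda> appears exactly on the diagonal.\<close>

lemma macaulay_entry_eq:
  assumes "k - 1 \<le> count a (macaulay_index k a)"
  shows "macaulay_entry k n T a b =
    (if a = b then [:0, 1:] else 0) - [: complex_of_real (macaulay_coeff k n T a b) :]"
proof -
  define i where "i = macaulay_index k a"
  define q where "q = a - replicate_mset (k - 1) i"
  have le: "replicate_mset (k - 1) i \<subseteq># a"
    using assms by (simp add: i_def count_le_replicate_mset_subset_eq)
  then have qa: "a = q + replicate_mset (k - 1) i" by (simp add: q_def)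
  have defs: "macaulay_entry k n T a b = (if q \<subseteq># b then char_form_coeff k n T i (b - q) else 0)"
    "macaulay_coeff k n T a b =
      (if q \<subseteq># b then \<Sum>\<gamma> | \<gamma> \<in> indices n (k - 1) \<and> mset \<gamma> = b - q. T (i # \<gamma>) else 0)"
    by (simp_all only: macaulay_entry_def macaulay_coeff_def Let_def i_def q_def)
  show ?thesis
  proof (cases "q \<subseteq># b")
    case True
    then obtain c where b: "b = q + c" by (metis mset_subset_eq_exists_conv)
    then have "b - q = replicate_mset (k - 1) i \<longleftrightarrow> a = b" using qa by auto
    then show ?thesis using True
      by (simp add: defs char_form_coeff_def)
  next
    case False
    then have "a \<noteq> b" using qa by auto
    then show ?thesis using False
      by (simp add: defs)
  qed
qed

lemma macaulay_det_char_poly: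
  assumes "distinct ms" "\<And>a. a \<in> set ms \<Longrightarrow> k - 1 \<le> count a (macaulay_index k a)"
  shows "macaulay_det k n T ms = char_poly (mat (length ms) (length ms)
    (\<lambda>(r, c). complex_of_real (macaulay_coeff k n T (ms ! r) (ms ! c))))"
  unfolding macaulay_det_def char_poly_defs
  by (rule arg_cong[of _ _ det], rule eq_matI)
    (use assms in \<open>auto simp: macaulay_entry_eq nth_eq_iff_index_eq\<close>)

lemma sum_nth_distinct:
  assumes "distinct xs"
  shows "(\<Sum>i<length xs. f (xs ! i)) = sum f (set xs)"
  using sum.reindex_bij_betw[OF bij_betw_nth[OF assms refl refl], of f] by simp

lemma power_sum_macaulay_det:
  fixes ms k n T
  assumes "distinct ms" "\<And>a. a \<in> set ms \<Longrightarrow> k - 1 \<le> count a (macaulay_index k a)"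
  obtains as where "macaulay_det k n T ms = (\<Prod>a\<leftarrow>as. [:- a, 1:])" "length as = length ms"
    "(\<Sum>a\<leftarrow>as. a\<^sup>2) = complex_of_real
      (\<Sum>a\<in>set ms. \<Sum>b\<in>set ms. macaulay_coeff k n T a b * macaulay_coeff k n T b a)"
proof -
  let ?f = "\<lambda>a b. complex_of_real (macaulay_coeff k n T a b)"
  let ?A = "mat (length ms) (length ms) (\<lambda>(r, c). ?f (ms ! r) (ms ! c))"
  have A: "?A \<in> carrier_mat (length ms) (length ms)" by simp
  obtain as where as: "char_poly ?A = (\<Prod>a\<leftarrow>as. [:- a, 1:])" "length as = length ms"
    using char_poly_factorized[OF A] by auto
  have "(\<Sum>a\<leftarrow>as. a\<^sup>2) = (\<Sum>i<length ms. \<Sum>j<length ms. ?f (ms ! i) (ms ! j) * ?f (ms ! j) (ms ! i))"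
    unfolding power_sum_char_poly[OF A as(1)] mat_trace_mult[OF A A]
    by (intro sum.cong refl) auto
  also have "\<dots> = (\<Sum>a\<in>set ms. \<Sum>b\<in>set ms. ?f a b * ?f b a)"
    using sum_nth_distinct[OF assms(1), of "\<lambda>b. ?f _ b * ?f b _"]
      sum_nth_distinct[OF assms(1), of "\<lambda>a. \<Sum>b\<in>set ms. ?f a b * ?f b a"] by simp
  finally show ?thesis
    using that[of as] as macaulay_det_char_poly[OF assms, of n T] by simp
qed

text \<open>By the pigeonhole bound some x_i^(k-1) always divides, so these monomials have exactly
  one such i. They index the rows absent from the divisor in Macaulay's quotient.\<close>

definition reduced_set :: "nat \<Rightarrow> nat \<Rightarrow> nat multiset set" where
  "reduced_set k n = {a \<in> monomial_set n (n * (k - 2) + 1). \<not> nonreduced k a}"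

lemma pure_power_reduced:
  assumes "2 \<le> k" "i < n"
  shows "replicate_mset (n * (k - 2) + 1) i \<in> reduced_set k n"
  using assms unfolding reduced_set_def monomial_set_def nonreduced_def
  by (auto simp: set_mset_replicate_mset_subset)

lemma tensor_moment_2_macaulay:
  fixes k n T
  assumes "2 \<le> k" "2 \<le> n"
  defines "M \<equiv> monomial_set n (n * (k - 2) + 1)"
  defines "c \<equiv> \<lambda>a b. macaulay_coeff k n T a b * macaulay_coeff k n T b a"
  shows "tensor_moment k n 2 T =
    complex_of_real ((\<Sum>a\<in>M. \<Sum>b\<in>M. c a b)
      - (\<Sum>a\<in>M - reduced_set k n. \<Sum>b\<in>M - reduced_set k n. c a b))"
proof -
  let ?ms = "monomials n (n * (k - 2) + 1)"
  let ?ms' = "filter (nonreduced k) ?ms"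
  have idx: "k - 1 \<le> count a (macaulay_index k a)" if "a \<in> set ?ms" for a
    using macaulay_index_count[of a n k] that assms(1) by (simp add: set_monomials)
  then have idx': "k - 1 \<le> count a (macaulay_index k a)" if "a \<in> set ?ms'" for a
    using that by simp
  have sets: "set ?ms = M" "set ?ms' = M - reduced_set k n"
    by (auto simp: set_monomials M_def reduced_set_def)
  obtain as where as: "macaulay_det k n T ?ms = (\<Prod>a\<leftarrow>as. [:- a, 1:])" "length as = length ?ms"
    "(\<Sum>a\<leftarrow>as. a\<^sup>2) = complex_of_real (\<Sum>a\<in>M. \<Sum>b\<in>M. c a b)"
    using power_sum_macaulay_det[where ms = ?ms and k = k and n = n and T = T, OF distinct_monomials idx]
      unfolding sets c_def by blast
  obtain bs where bs: "macaulay_det k n T ?ms' = (\<Prod>a\<leftarrow>bs. [:- a, 1:])" "length bs = length ?ms'"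
    "(\<Sum>a\<leftarrow>bs. a\<^sup>2) = complex_of_real
      (\<Sum>a\<in>M - reduced_set k n. \<Sum>b\<in>M - reduced_set k n. c a b)"
    using power_sum_macaulay_det[where ms = ?ms' and k = k and n = n and T = T,
        OF distinct_filter[OF distinct_monomials] idx']
      unfolding sets c_def by blast
  \<comment> \<open>Two pure powers are two reduced rows; this is the gap of 2 between the degrees
    that \<open>power_sum_poly_div\<close> asks for, and it comes from
    \<open>2 \<le> n\<close>.\<close>
  have "{replicate_mset (n * (k - 2) + 1) 0, replicate_mset (n * (k - 2) + 1) 1} \<subseteq> reduced_set k n"
    using pure_power_reduced[of k 0 n] pure_power_reduced[of k 1 n] assms(1,2) by auto
  moreover have "replicate_mset (n * (k - 2) + 1) 0 \<noteq> replicate_mset (n * (k - 2) + 1) (1::nat)"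
    by (simp add: multiset_eq_iff) metis
  moreover have fin: "finite M" unfolding M_def by (rule finite_monomial_set)
  moreover have sub: "reduced_set k n \<subseteq> M" unfolding M_def reduced_set_def by blast
  ultimately have "2 \<le> card (reduced_set k n)"
    by (metis card_2_iff card_mono finite_subset)
  moreover have "length ?ms = card M" "length ?ms' = card (M - reduced_set k n)"
    using distinct_card[OF distinct_monomials, of n "n * (k - 2) + 1"]
      distinct_card[OF distinct_filter[OF distinct_monomials], of "nonreduced k" n "n * (k - 2) + 1"]
    unfolding sets by simp_all
  moreover have "card (M - reduced_set k n) + card (reduced_set k n) = card M"
    using fin sub by (metis add.commute card_Diff_subset card_mono finite_subset le_add_diff_inverse)
  ultimately have "length bs + 2 \<le> length as" using as(2) bs(2) by simp
  from power_sum_poly_div[OF this] show ?thesis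
    unfolding tensor_moment_def tensor_eigenvalues_def tensor_char_poly_def Let_def as(1) bs(1)
    by (simp add: as(3) bs(3))
qed

section \<open>The Macaulay matrix of a hypergraph\<close>

lemma finite_hedges: "uniform k H \<Longrightarrow> finite (hedges H)"
  by (rule finite_subset[of _ "Pow (verts H)"]) (auto simp: uniform_def verts_def)

lemma hdegree_eq_sum: "finite (hedges H) \<Longrightarrow> hdegree H v = (\<Sum>e\<in>hedges H. if v \<in> e then 1 else 0)"
  unfolding hdegree_def by (simp add: sum.If_cases Int_def)

lemma sum_hdegree:
  assumes "finite (hedges H)" "finite A"
  shows "(\<Sum>v\<in>A. hdegree H v) = (\<Sum>e\<in>hedges H. card (e \<inter> A))"
proof -
  have "(\<Sum>v\<in>A. hdegree H v) = (\<Sum>e\<in>hedges H. \<Sum>v\<in>A. if v \<in> e then 1 else 0)"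
    by (subst sum.swap) (simp add: hdegree_eq_sum assms)
  then show ?thesis using assms(2) by (simp add: sum.If_cases Int_commute)
qed

lemma handshake:
  assumes "uniform k H"
  shows "(\<Sum>v\<in>verts H. hdegree H v) = card (hedges H) * k"
proof -
  have "card (e \<inter> verts H) = k" if "e \<in> hedges H" for e
    using assms that by (metis Int_absorb2 uniform_def)
  then show ?thesis
    using sum_hdegree[OF finite_hedges[OF assms], of "verts H"] by (simp add: verts_def)
qed

lemma hdegree_graph:
  assumes "uniform 2 H"
  shows "hdegree H i = card {j. j < nverts H \<and> j \<noteq> i \<and> {i, j} \<in> hedges H}"
proof -
  let ?J = "{j. j < nverts H \<and> j \<noteq> i \<and> {i, j} \<in> hedges H}"
  have "{e \<in> hedges H. i \<in> e} = (\<lambda>j. {i, j}) ` {j. j < nverts H \<and> j \<noteq> i \<and> {i, j} \<in> hedges H}"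
  proof (intro Set.set_eqI iffI)
    fix e assume "e \<in> {e \<in> hedges H. i \<in> e}"
    then have e: "e \<in> hedges H" "i \<in> e" "card e = 2" "e \<subseteq> verts H"
      using assms by (auto simp: uniform_def)
    then obtain j where "e = {i, j}" "j \<noteq> i"
      by (auto simp: card_2_iff)
    then show "e \<in> (\<lambda>j. {i, j}) ` {j. j < nverts H \<and> j \<noteq> i \<and> {i, j} \<in> hedges H}"
      using e by (auto simp: verts_def)
  qed auto
  moreover have "inj_on (\<lambda>j. {i, j}) A" for A by (auto simp: inj_on_def doubleton_eq_iff)
  ultimately show ?thesis unfolding hdegree_def by (simp add: card_image)
qed

lemma A_alpha_diag:
  assumes "uniform k H" "2 \<le> k"
  shows "A_alpha k \<alpha> H (i # replicate (k - 1) i) = \<alpha> * real (hdegree H i)"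
proof -
  have "{i} \<notin> hedges H" using assms by (auto simp: uniform_def)
  moreover have "set (i # replicate (k - 1) i) = {i}" by auto
  ultimately show ?thesis
    unfolding A_alpha_def degree_tensor_def adjacency_tensor_def
    by (simp del: list.set replicate_Suc)
qed

text \<open>A nonzero entry is either on the diagonal or comes from a hyperedge. In the second case
  the k entries of the list form a set of size k, so none is repeated.\<close>

lemma A_alpha_support:
  assumes "uniform k H" "2 \<le> k" "length \<gamma> = k - 1" "A_alpha k \<alpha> H (i # \<gamma>) \<noteq> 0"
  shows "\<gamma> = replicate (k - 1) i \<or> insert i (set \<gamma>) \<in> hedges H \<and> distinct (i # \<gamma>)"
proof (cases "\<forall>j\<in>set \<gamma>. j = i")
  case True
  then show ?thesis using assms(3) by (metis replicate_eqI)
next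
  case False
  then have "insert i (set \<gamma>) \<in> hedges H"
    using assms(4) by (auto simp: A_alpha_def degree_tensor_def adjacency_tensor_def split: if_splits)
  moreover from this have "card (set (i # \<gamma>)) = length (i # \<gamma>)"
    using assms by (auto simp: uniform_def)
  ultimately show ?thesis using card_distinct by blast
qed

lemma A_alpha_graph_offdiag:
  assumes "i \<noteq> j"
  shows "A_alpha 2 \<alpha> H [i, j] = (if {i, j} \<in> hedges H then 1 - \<alpha> else 0)"
  using assms by (auto simp: A_alpha_def degree_tensor_def adjacency_tensor_def)

text \<open>Each edge is met once from either end. The sum occurs for k = 2 both in the trace of the
  squared Macaulay matrix and in the count of closed walks.\<close>

lemma sum_graph_offdiag:
  assumes "uniform 2 H"
  shows "(\<Sum>i<nverts H. \<Sum>j\<in>{..<nverts H} - {i}. A_alpha 2 \<alpha> H [i, j] * A_alpha 2 \<alpha> H [j, i])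
    = 2 * real (card (hedges H)) * (1 - \<alpha>)\<^sup>2"
proof -
  have "(\<Sum>j\<in>{..<nverts H} - {i}. A_alpha 2 \<alpha> H [i, j] * A_alpha 2 \<alpha> H [j, i])
      = real (hdegree H i) * (1 - \<alpha>)\<^sup>2" for i
  proof -
    have "(\<Sum>j\<in>{..<nverts H} - {i}. A_alpha 2 \<alpha> H [i, j] * A_alpha 2 \<alpha> H [j, i])
        = (\<Sum>j\<in>{..<nverts H} - {i}. if {i, j} \<in> hedges H then (1 - \<alpha>)\<^sup>2 else 0)"
      by (intro sum.cong refl) (auto simp: A_alpha_graph_offdiag insert_commute power2_eq_square)
    also have "\<dots> = real (card (({..<nverts H} - {i}) \<inter> {j. {i, j} \<in> hedges H})) * (1 - \<alpha>)\<^sup>2"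
      by (simp add: sum.If_cases)
    also have "({..<nverts H} - {i}) \<inter> {j. {i, j} \<in> hedges H}
        = {j. j < nverts H \<and> j \<noteq> i \<and> {i, j} \<in> hedges H}" by auto
    finally show ?thesis by (simp add: hdegree_graph[OF assms])
  qed
  then have "(\<Sum>i<nverts H. \<Sum>j\<in>{..<nverts H} - {i}. A_alpha 2 \<alpha> H [i, j] * A_alpha 2 \<alpha> H [j, i])
      = real (\<Sum>i\<in>verts H. hdegree H i) * (1 - \<alpha>)\<^sup>2"
    by (simp add: sum_distrib_right verts_def lessThan_atLeast0)
  then show ?thesis by (simp add: handshake[OF assms])
qed

section \<open>Counting reduced monomials by their index\<close>

lemma size_eq_sum_count:
  assumes "set_mset a \<subseteq> A" "finite A"
  shows "size a = sum (count a) A"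
  unfolding size_multiset_overloaded_eq
  by (rule sum.mono_neutral_left) (use assms in \<open>auto simp: count_eq_zero_iff\<close>)

text \<open>Being reduced excludes a second index with exponent at least k - 1, so the least one is
  the only one. This removes \<open>LEAST\<close> and leaves conditions on exponents that can be
  counted.\<close>

lemma reduced_index_iff:
  assumes "2 \<le> k"
  shows "a \<in> reduced_set k n \<and> macaulay_index k a = i \<longleftrightarrow>
    a \<in> monomial_set n (n * (k - 2) + 1) \<and> k - 1 \<le> count a i \<and> (\<forall>j. j \<noteq> i \<longrightarrow> count a j < k - 1)"
    (is "?L \<longleftrightarrow> ?R")
proof
  assume ?L
  then show ?R using macaulay_index_count[of a n k] assms
    unfolding reduced_set_def nonreduced_def by (metis (mono_tags, lifting) mem_Collect_eq not_le)
next
  assume R: ?R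
  then have "macaulay_index k a = i"
    unfolding macaulay_index_def by (intro Least_equality) (auto simp flip: not_less)
  moreover have "\<not> nonreduced k a"
  proof
    assume "nonreduced k a"
    then obtain j l where "j \<noteq> l" "k - 1 \<le> count a j" "k - 1 \<le> count a l"
      unfolding nonreduced_def by blast
    moreover from this obtain j' where "j' \<noteq> i" "k - 1 \<le> count a j'" by metis
    ultimately show False using R by (meson not_less)
  qed
  ultimately show ?L using R by (simp add: reduced_set_def)
qed

text \<open>The exponents away from \<open>i\<close> are arbitrary below k - 1, and the degree then
  determines the exponent of \<open>i\<close>. It is automatically large enough, since n (k - 2) + 1
  = (n - 1) (k - 2) + (k - 1).\<close>

lemma card_reduced_index:
  assumes "2 \<le> k" "i < n"
  shows "card {a \<in> reduced_set k n. macaulay_index k a = i} = (k - 1) ^ (n - 1)"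
proof -
  let ?D = "n * (k - 2) + 1" and ?J = "{0..<n} - {i}"
  let ?R = "{a \<in> reduced_set k n. macaulay_index k a = i}"
  let ?P = "PiE ?J (\<lambda>_. {..<k - 1})"
  have R: "a \<in> ?R \<longleftrightarrow> size a = ?D \<and> set_mset a \<subseteq> {0..<n} \<and> k - 1 \<le> count a i
      \<and> (\<forall>j. j \<noteq> i \<longrightarrow> count a j < k - 1)" for a
    using reduced_index_iff[OF assms(1), of a n i] by (auto simp: monomial_set_def)
  have "bij_betw (\<lambda>a. restrict (count a) ?J) ?R ?P"
    unfolding bij_betw_def
  proof
    show "inj_on (\<lambda>a. restrict (count a) ?J) ?R"
    proof
      fix a b assume a: "a \<in> ?R" and b: "b \<in> ?R" and eq: "restrict (count a) ?J = restrict (count b) ?J"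
      have off: "count a j = count b j" if "j \<in> ?J" for j using eq that by (metis restrict_apply')
      have "count a i + sum (count a) ?J = count b i + sum (count b) ?J"
        using a b assms(2) size_eq_sum_count[of a "{0..<n}"] size_eq_sum_count[of b "{0..<n}"]
        unfolding R by (simp add: sum.remove[of "{0..<n}" i])
      then have "count a i = count b i" using sum.cong[of ?J ?J "count a" "count b"] off by simp
      moreover have "count a j = count b j" if "j \<notin> {0..<n}" for j
        using a b that unfolding R by (metis count_eq_zero_iff subsetD)
      ultimately show "a = b" using off by (intro multiset_eqI) (metis Diff_iff singletonD)
    qed
    show "(\<lambda>a. restrict (count a) ?J) ` ?R = ?P"
    proof
      show "(\<lambda>a. restrict (count a) ?J) ` ?R \<subseteq> ?P"
      proof
        fix f assume "f \<in> (\<lambda>a. restrict (count a) ?J) ` ?R"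
        then obtain a where a: "a \<in> ?R" and f: "f = restrict (count a) ?J" by blast
        from a have "count a j < k - 1" if "j \<noteq> i" for j using that unfolding R by blast
        then show "f \<in> ?P" unfolding f by (auto simp: PiE_iff)
      qed
    next
      show "?P \<subseteq> (\<lambda>a. restrict (count a) ?J) ` ?R"
      proof
        fix f assume f: "f \<in> ?P"
        define a where "a = (\<Sum>j\<in>?J. replicate_mset (f j) j) + replicate_mset (?D - sum f ?J) i"
        have fle: "f j \<le> k - 2" if "j \<in> ?J" for j using f that assms by (force simp: PiE_iff)
        then have "sum f ?J \<le> (n - 1) * (k - 2)"
          using sum_bounded_above[of ?J f "k - 2"] assms(2) by simp
        moreover have "?D = (n - 1) * (k - 2) + (k - 1)"
        proof -
          obtain n' k' where "n = Suc n'" "k = k' + 2"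
            using assms by (metis add.commute le_Suc_ex less_imp_Suc_add)
          then show ?thesis by simp
        qed
        ultimately have le: "sum f ?J \<le> ?D" "k - 1 \<le> ?D - sum f ?J" by linarith+
        have ci: "count a i = ?D - sum f ?J"
          by (auto simp: a_def count_sum sum.neutral)
        have cj: "count a j = (if j \<in> ?J then f j else 0)" if "j \<noteq> i" for j
          using that by (auto simp: a_def count_sum if_distrib sum.delta cong: if_cong)
        have set: "set_mset a \<subseteq> {0..<n}"
          using cj assms(2) by (metis atLeastLessThan_iff count_eq_zero_iff DiffD1 subsetI zero_le)
        have "size a = count a i + sum (count a) ?J"
          using size_eq_sum_count[OF set] assms(2) by (simp add: sum.remove[of "{0..<n}" i])
        also have "sum (count a) ?J = sum f ?J" by (rule sum.cong) (auto simp: cj)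
        finally have "size a = ?D" using ci le by simp
        moreover have "count a j < k - 1" if "j \<noteq> i" for j
          using cj[OF that] fle[of j] assms(1) by (cases "j \<in> ?J") auto
        ultimately have "a \<in> ?R" unfolding R using set ci le by simp
        moreover have "f = restrict (count a) ?J"
          using f cj by (intro ext) (auto simp: PiE_iff extensional_def)
        ultimately show "f \<in> (\<lambda>a. restrict (count a) ?J) ` ?R" by blast
      qed
    qed
  qed
  then have "card ?R = card ?P" by (rule bij_betw_same_card)
  also have "\<dots> = (k - 1) ^ (n - 1)" using assms(2) by (subst card_PiE) auto
  finally show ?thesis .
qed

lemma mset_eq_replicate_iff: "mset xs = replicate_mset m x \<longleftrightarrow> xs = replicate m x"
  by (metis in_replicate_mset mset_replicate replicate_eqI set_mset_mset size_mset size_replicate_mset)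

text \<open>On the diagonal the monomial to be matched is x_i^(k-1), and the constant list is its
  only index list. Hence the entry is a diagonal entry of the tensor.\<close>

lemma macaulay_coeff_diag:
  assumes "uniform k H" "2 \<le> k" "a \<in> monomial_set (nverts H) (nverts H * (k - 2) + 1)"
  shows "macaulay_coeff k (nverts H) (A_alpha k \<alpha> H) a a = \<alpha> * real (hdegree H (macaulay_index k a))"
proof -
  let ?i = "macaulay_index k a"
  have c: "k - 1 \<le> count a ?i" using macaulay_index_count[OF assms(3,2)] .
  then have "?i \<in># a" using assms(2) by (metis count_eq_zero_iff diff_is_0_eq not_less_eq_eq numeral_2_eq_2 le_zero_eq One_nat_def)
  then have i: "?i < nverts H" using assms(3) by (auto simp: monomial_set_def)
  have le: "replicate_mset (k - 1) ?i \<subseteq># a" using c by (simp add: count_le_replicate_mset_subset_eq)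
  then have "a - (a - replicate_mset (k - 1) ?i) = replicate_mset (k - 1) ?i"
    by (metis add_diff_cancel_left' subset_mset.diff_add)
  moreover have "{\<gamma>. \<gamma> \<in> indices (nverts H) (k - 1) \<and> mset \<gamma> = replicate_mset (k - 1) ?i}
      = {replicate (k - 1) ?i}"
    using i by (auto simp: mset_eq_replicate_iff indices_def)
  ultimately show ?thesis
    using A_alpha_diag[OF assms(1,2)] by (simp add: macaulay_coeff_def Let_def)
qed

lemma sum_reduced_diag:
  fixes \<alpha> :: real
  assumes "uniform k H" "2 \<le> k"
  defines "n \<equiv> nverts H" and "c \<equiv> macaulay_coeff k (nverts H) (A_alpha k \<alpha> H)"
  shows "(\<Sum>a\<in>reduced_set k n. c a a * c a a)
    = real (k - 1) ^ (n - 1) * (\<alpha>\<^sup>2 * real (\<Sum>v\<in>verts H. (hdegree H v)\<^sup>2))"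
proof -
  let ?R = "reduced_set k n"
  have fin: "finite ?R" using finite_monomial_set by (auto simp: reduced_set_def)
  have idx: "macaulay_index k ` ?R \<subseteq> {..<n}"
  proof
    fix i assume "i \<in> macaulay_index k ` ?R"
    then obtain a where a: "a \<in> ?R" "i = macaulay_index k a" by auto
    then have "k - 1 \<le> count a i" "set_mset a \<subseteq> {0..<n}"
      using macaulay_index_count[of a n k] assms(2) by (auto simp: reduced_set_def monomial_set_def)
    then show "i \<in> {..<n}" using assms(2)
      by (metis atLeastLessThan_iff count_eq_zero_iff diff_is_0_eq le_zero_eq lessThan_iff not_less_eq_eq numeral_2_eq_2 One_nat_def subsetD)
  qed
  have "(\<Sum>a\<in>?R. c a a * c a a) = (\<Sum>a\<in>?R. (\<alpha> * real (hdegree H (macaulay_index k a)))\<^sup>2)"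
    unfolding c_def n_def reduced_set_def
    by (intro sum.cong refl) (auto simp: macaulay_coeff_diag[OF assms(1,2)] power2_eq_square)
  also have "\<dots> = (\<Sum>i<n. \<Sum>a\<in>{a \<in> ?R. macaulay_index k a = i}.
      (\<alpha> * real (hdegree H (macaulay_index k a)))\<^sup>2)"
    using sum.group[OF fin _ idx, of "\<lambda>a. (\<alpha> * real (hdegree H (macaulay_index k a)))\<^sup>2"] by simp
  also have "\<dots> = (\<Sum>i<n. real (k - 1) ^ (n - 1) * (\<alpha> * real (hdegree H i))\<^sup>2)"
    by (intro sum.cong refl) (simp add: card_reduced_index[OF assms(2)])
  finally show ?thesis
    by (simp add: sum_distrib_left power_mult_distrib verts_def n_def lessThan_atLeast0)
qed

text \<open>The closed form through which eigenvalues and traces are compared: each side is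
  evaluated to it separately.\<close>

definition moment_value :: "nat \<Rightarrow> real \<Rightarrow> hypergraph \<Rightarrow> real" where
  "moment_value k \<alpha> H = real (k - 1) ^ (nverts H - 1) * (\<alpha>\<^sup>2 * real (\<Sum>v\<in>verts H. (hdegree H v)\<^sup>2))
     + (if k = 2 then 2 * real (card (hedges H)) * (1 - \<alpha>)\<^sup>2 else 0)"

text \<open>States the condition on \<open>a\<close> and \<open>b\<close> multiplicatively, x^b
  times x_i^(k-1) equals x^a times x^\<gamma>, without multiset subtraction, so that the relations
  for two entries can be combined and cancelled.\<close>

lemma macaulay_coeff_nonzero:
  assumes "k - 1 \<le> count a (macaulay_index k a)" "macaulay_coeff k n T a b \<noteq> 0"
  obtains \<gamma> where "\<gamma> \<in> indices n (k - 1)" "T (macaulay_index k a # \<gamma>) \<noteq> 0"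
    "b + replicate_mset (k - 1) (macaulay_index k a) = a + mset \<gamma>"
proof -
  let ?i = "macaulay_index k a" and ?r = "replicate_mset (k - 1) (macaulay_index k a)"
  have q: "a - ?r \<subseteq># b" using assms(2) by (auto simp: macaulay_coeff_def Let_def split: if_splits)
  then have "(\<Sum>\<gamma> | \<gamma> \<in> indices n (k - 1) \<and> mset \<gamma> = b - (a - ?r). T (?i # \<gamma>)) \<noteq> 0"
    using assms(2) by (simp add: macaulay_coeff_def Let_def)
  then obtain \<gamma> where \<gamma>: "\<gamma> \<in> indices n (k - 1)" "mset \<gamma> = b - (a - ?r)" "T (?i # \<gamma>) \<noteq> 0"
    by (auto dest: sum.not_neutral_contains_not_neutral)
  have "?r \<subseteq># a" using assms(1) by (simp add: count_le_replicate_mset_subset_eq)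
  then have a: "a - ?r + ?r = a" by (rule subset_mset.diff_add)
  have b: "a - ?r + mset \<gamma> = b" unfolding \<gamma>(2) using q by (rule subset_mset.add_diff_inverse)
  have "b + ?r = a - ?r + ?r + mset \<gamma>" by (subst b[symmetric]) (simp only: ac_simps)
  then have "b + ?r = a + mset \<gamma>" unfolding a .
  then show thesis using that \<gamma> by blast
qed

text \<open>Two Macaulay rows that see each other exchange the powers of two vertices for the monomials of two
  hyperedges, which forces the hyperedges to have only two vertices.\<close>

lemma macaulay_coeff_offdiag:
  fixes \<alpha> :: real
  assumes H: "uniform k H" "2 \<le> k" and "a \<noteq> b"
    and a: "k - 1 \<le> count a (macaulay_index k a)" and b: "k - 1 \<le> count b (macaulay_index k b)"
    and nz: "macaulay_coeff k n (A_alpha k \<alpha> H) a b \<noteq> 0" "macaulay_coeff k n (A_alpha k \<alpha> H) b a \<noteq> 0"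
  shows "k = 2"
proof -
  let ?i = "macaulay_index k a" and ?j = "macaulay_index k b"
  obtain \<gamma> where g: "\<gamma> \<in> indices n (k - 1)" "A_alpha k \<alpha> H (?i # \<gamma>) \<noteq> 0"
    "b + replicate_mset (k - 1) ?i = a + mset \<gamma>"
    using macaulay_coeff_nonzero[OF a nz(1)] .
  obtain \<delta> where d: "\<delta> \<in> indices n (k - 1)"
    "a + replicate_mset (k - 1) ?j = b + mset \<delta>"
    using macaulay_coeff_nonzero[OF b nz(2)] .
  have "\<gamma> \<noteq> replicate (k - 1) ?i" using g(3) \<open>a \<noteq> b\<close> by auto
  then have dist: "distinct (?i # \<gamma>)"
    using A_alpha_support[OF H _ g(2)] g(1) by (auto simp: indices_def)
  \<comment> \<open>Adding \<open>g(3)\<close> and \<open>d(2)\<close> cancels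
    \<open>a + b\<close>.\<close>
  have "mset \<gamma> + mset \<delta> = replicate_mset (k - 1) ?i + replicate_mset (k - 1) ?j"
  proof (rule multiset_eqI)
    fix x
    show "count (mset \<gamma> + mset \<delta>) x = count (replicate_mset (k - 1) ?i + replicate_mset (k - 1) ?j) x"
      using arg_cong[OF g(3), of "\<lambda>c. count c x"] arg_cong[OF d(2), of "\<lambda>c. count c x"]
      unfolding count_union by linarith
  qed
  then have "set_mset (mset \<gamma>) \<subseteq> {?i, ?j}"
    using set_mset_union[of "mset \<gamma>" "mset \<delta>"] by (auto split: if_splits)
  \<comment> \<open>As \<open>?i # \<gamma>\<close> has no repetition, \<open>\<gamma>\<close>
    avoids \<open>?i\<close> and contains \<open>?j\<close> at most once; its length k - 1 is
    therefore at most 1.\<close>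
  then have "set \<gamma> \<subseteq> {?j}" using dist by auto
  then have "length \<gamma> \<le> 1"
    using dist card_mono[of "{?j}" "set \<gamma>"] by (simp add: distinct_card)
  then show ?thesis using g(1) H(2) by (simp add: indices_def)
qed

lemma tensor_moment_2_A_alpha:
  fixes \<alpha> :: real
  assumes H: "uniform k H" "2 \<le> k" and n: "2 \<le> nverts H"
  shows "tensor_moment k (nverts H) 2 (A_alpha k \<alpha> H) = complex_of_real (moment_value k \<alpha> H)"
proof -
  let ?n = "nverts H" and ?T = "A_alpha k \<alpha> H"
  let ?M = "monomial_set ?n (?n * (k - 2) + 1)" and ?R = "reduced_set k ?n"
  let ?m = "macaulay_coeff k ?n ?T"
  let ?c = "\<lambda>a b. ?m a b * ?m b a"
  have fin: "finite ?M" by (rule finite_monomial_set)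
  have R: "?R \<subseteq> ?M" by (auto simp: reduced_set_def)
  have "(\<Sum>a\<in>?M. \<Sum>b\<in>?M. ?c a b) - (\<Sum>a\<in>?M - ?R. \<Sum>b\<in>?M - ?R. ?c a b)
      = (\<Sum>a\<in>?R. ?c a a) + (if k = 2 then 2 * real (card (hedges H)) * (1 - \<alpha>)\<^sup>2 else 0)"
  proof (cases "k = 2")
    case False
    \<comment> \<open>A product of opposite off-diagonal entries vanishes for k > 2, so both double
      sums reduce to their diagonals, and the difference to the reduced rows.\<close>
    have zero: "?c a b = 0" if "a \<in> ?M" "b \<in> ?M" "b \<noteq> a" for a b
      using macaulay_coeff_offdiag[OF H, of b a ?n \<alpha>] that False macaulay_index_count[OF _ H(2)] by auto
    have diag: "(\<Sum>a\<in>A. \<Sum>b\<in>A. ?c a b) = (\<Sum>a\<in>A. ?c a a)" if "A \<subseteq> ?M" for A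
    proof (rule sum.cong[OF refl])
      fix a assume "a \<in> A"
      then have "sum (?c a) A = sum (?c a) {a}"
        using that zero fin by (intro sum.mono_neutral_right) (auto dest: finite_subset)
      then show "sum (?c a) A = ?c a a" by simp
    qed
    have "(\<Sum>a\<in>?M. \<Sum>b\<in>?M. ?c a b) - (\<Sum>a\<in>?M - ?R. \<Sum>b\<in>?M - ?R. ?c a b) = (\<Sum>a\<in>?R. ?c a a)"
      using diag[of ?M] diag[of "?M - ?R"] sum.subset_diff[OF R fin, of "\<lambda>a. ?c a a"] by auto
    then show ?thesis using False by simp
  next
    case True
    \<comment> \<open>For k = 2 the degree of the monomials is 1: they are the variables, all of
      them are reduced, and the Macaulay matrix is given by the entries of
      \<open>?T\<close>.\<close>
    have M: "?M = (\<lambda>i. {#i#}) ` {..<?n}"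
    proof (intro Set.set_eqI iffI)
      fix a assume "a \<in> ?M"
      then have a: "size a = 1" "set_mset a \<subseteq> {0..<?n}" by (auto simp: True monomial_set_def)
      then obtain i where "a = {#i#}" using size_1_singleton_mset by blast
      with a(2) show "a \<in> (\<lambda>i. {#i#}) ` {..<?n}" by auto
    qed (auto simp: True monomial_set_def)
    have RM: "?R = ?M"
    proof -
      have "\<not> nonreduced k a" if "a \<in> ?M" for a
        using that unfolding M by (auto simp: nonreduced_def True split: if_splits)
      then show ?thesis by (auto simp: reduced_set_def)
    qed
    have coeff: "?m {#i#} {#j#} = ?T [i, j]" if "j < ?n" for i j
    proof -
      have "macaulay_index 2 {#i#} = i" unfolding macaulay_index_def
        by (rule Least_equality) (auto split: if_splits)
      moreover have "{\<gamma>. \<gamma> \<in> indices ?n 1 \<and> mset \<gamma> = {#j#}} = {[j]}"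
        using that by (auto simp: indices_def)
      ultimately show ?thesis by (simp add: macaulay_coeff_def Let_def True)
    qed
    have "(\<Sum>a\<in>?M. \<Sum>b\<in>?M. ?c a b) = (\<Sum>a\<in>?M. ?c a a + (\<Sum>b\<in>?M - {a}. ?c a b))"
      using fin by (intro sum.cong refl) (simp add: sum.remove)
    moreover have "(\<Sum>a\<in>?M. \<Sum>b\<in>?M - {a}. ?c a b)
        = (\<Sum>i<?n. \<Sum>j\<in>{..<?n} - {i}. ?T [i, j] * ?T [j, i])"
    proof -
      have inj: "inj_on (\<lambda>i::nat. {#i#}) A" for A by (auto simp: inj_on_def)
      have "(\<lambda>i. {#i#}) ` {..<?n} - {{#i#}} = (\<lambda>i. {#i#}) ` ({..<?n} - {i})" for i by auto
      then have "(\<Sum>a\<in>?M. \<Sum>b\<in>?M - {a}. ?c a b)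
          = (\<Sum>i<?n. \<Sum>j\<in>{..<?n} - {i}. ?m {#i#} {#j#} * ?m {#j#} {#i#})"
        unfolding M by (simp add: sum.reindex[OF inj])
      also have "\<dots> = (\<Sum>i<?n. \<Sum>j\<in>{..<?n} - {i}. ?T [i, j] * ?T [j, i])"
        by (intro sum.cong refl) (simp add: coeff)
      finally show ?thesis .
    qed
    ultimately show ?thesis
      using sum_graph_offdiag[of H \<alpha>] H(1) unfolding RM by (simp add: True sum.distrib)
  qed
  then show ?thesis
    unfolding tensor_moment_2_macaulay[OF H(2) n] moment_value_def
    by (simp only: sum_reduced_diag[OF H])
qed

lemma spectral_moment_2:
  assumes "uniform k H" "2 \<le> k" "2 \<le> nverts H"
  shows "spectral_moment k \<alpha> 2 H = moment_value k \<alpha> H"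
  unfolding spectral_moment_def by (simp add: tensor_moment_2_A_alpha[OF assms])

section \<open>Traces and closed walks\<close>

lemma lookup_const_mult: "Poly_Mapping.lookup (const_ipoly c * p) t = c * Poly_Mapping.lookup p t"
proof -
  have "Poly_Mapping.lookup (const_ipoly c * p) t = Sum_any (\<lambda>l. Poly_Mapping.lookup (const_ipoly c) l * Sum_any (\<lambda>q. Poly_Mapping.lookup p q when t = l + q))"
    by (simp add: lookup_mult)
  also have "\<dots> = Sum_any (\<lambda>l :: (nat \<times> nat) \<Rightarrow>\<^sub>0 nat. c * Poly_Mapping.lookup p t when l = 0)"
    by (rule arg_cong[of _ _ Sum_any], rule ext) (simp add: const_ipoly_def lookup_single when_def)
  finally show ?thesis by simp
qed

text \<open>Only the exponent vector \<open>t + single v 1\<close> contributes. Truncated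
  subtraction can also send some \<open>s\<close> without \<open>v\<close> to \<open>t\<close>, but
  its term carries the factor \<open>lookup s v\<close>, which is 0.\<close>

lemma lookup_pdiff:
  "Poly_Mapping.lookup (pdiff v p) t = (real (Poly_Mapping.lookup t v) + 1) * Poly_Mapping.lookup p (t + Poly_Mapping.single v 1)"
proof -
  let ?u = "Poly_Mapping.single v (1::nat)"
  have "Poly_Mapping.lookup (pdiff v p) t
      = (\<Sum>s\<in>Poly_Mapping.keys p. if s - ?u = t then real (Poly_Mapping.lookup s v) * Poly_Mapping.lookup p s else 0)"
    by (simp add: pdiff_def lookup_sum lookup_single when_def)
  also have "\<dots> = (\<Sum>s\<in>Poly_Mapping.keys p. if s = t + ?u then (real (Poly_Mapping.lookup t v) + 1) * Poly_Mapping.lookup p s else 0)"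
  proof (intro sum.cong refl)
    fix s
    show "(if s - ?u = t then real (Poly_Mapping.lookup s v) * Poly_Mapping.lookup p s else 0)
        = (if s = t + ?u then (real (Poly_Mapping.lookup t v) + 1) * Poly_Mapping.lookup p s else 0)"
    proof (cases "Poly_Mapping.lookup s v = 0")
      case True
      then have "s \<noteq> t + ?u" by (auto simp: lookup_add)
      then show ?thesis using True by simp
    next
      case False
      then have "(s - ?u) + ?u = s"
        by (intro poly_mapping_eqI) (auto simp: lookup_add lookup_minus lookup_single when_def)
      then have "s - ?u = t \<longleftrightarrow> s = t + ?u" by (metis add_diff_cancel_right')
      then show ?thesis by (auto simp: lookup_add)
    qed
  qed
  also have "\<dots> = (real (Poly_Mapping.lookup t v) + 1) * Poly_Mapping.lookup p (t + ?u)"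
    by (simp add: in_keys_iff)
  finally show ?thesis .
qed

definition exps :: "(nat \<times> nat) list \<Rightarrow> (nat \<times> nat) \<Rightarrow>\<^sub>0 nat" where
  "exps vs = (\<Sum>v\<leftarrow>vs. Poly_Mapping.single v 1)"

lemma exps_simps [simp]: "exps [] = 0" "exps (v # vs) = Poly_Mapping.single v 1 + exps vs"
  "exps (us @ vs) = exps us + exps vs"
  by (simp_all add: exps_def)

lemma lookup_exps: "Poly_Mapping.lookup (exps vs) v = count (mset vs) v"
  by (induction vs) (auto simp: lookup_add lookup_single when_def)

lemma exps_eq_iff: "exps us = exps vs \<longleftrightarrow> mset us = mset vs"
  by (metis lookup_exps multiset_eqI poly_mapping_eqI)

text \<open>The scalar gained on differentiating by the variables in \<open>vs\<close> and reading
  the coefficient at \<open>t\<close>. For one variable repeated m times it is the rising factorial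
  (t_v + 1) ... (t_v + m).\<close>

primrec diff_factor :: "(nat \<times> nat) list \<Rightarrow> ((nat \<times> nat) \<Rightarrow>\<^sub>0 nat) \<Rightarrow> real" where
  "diff_factor [] t = 1"
| "diff_factor (v # vs) t = (real (Poly_Mapping.lookup t v) + 1) * diff_factor vs (t + Poly_Mapping.single v 1)"

lemma lookup_pdiff_list:
  "Poly_Mapping.lookup (pdiff_list i \<gamma> p) t = diff_factor (map (Pair i) \<gamma>) t * Poly_Mapping.lookup p (t + exps (map (Pair i) \<gamma>))"
  unfolding pdiff_list_def
  by (induction \<gamma> arbitrary: t) (simp_all add: lookup_pdiff add.assoc)

lemma diff_factor_replicate:
  "diff_factor (replicate m v) t * fact (Poly_Mapping.lookup t v) = fact (Poly_Mapping.lookup t v + m)"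
proof (induction m arbitrary: t)
  case (Suc m)
  have "diff_factor (replicate (Suc m) v) t * fact (Poly_Mapping.lookup t v)
      = diff_factor (replicate m v) (t + Poly_Mapping.single v 1)
        * fact (Poly_Mapping.lookup (t + Poly_Mapping.single v 1) v)"
    by (simp add: lookup_add algebra_simps)
  then show ?case by (simp only: Suc.IH) (simp add: lookup_add)
qed simp

lemma finite_indices: "finite (indices n r)"
  unfolding indices_def using finite_lists_length_eq[of "{0..<n}" r] by (simp add: conj_commute)

lemma lookup_tensor_op:
  "Poly_Mapping.lookup (tensor_op k n T i p) t =
    (\<Sum>\<gamma>\<in>indices n (k - 1). T (i # \<gamma>) *
      (diff_factor (map (Pair i) \<gamma>) t * Poly_Mapping.lookup p (t + exps (map (Pair i) \<gamma>))))"
  by (simp add: tensor_op_def lookup_sum lookup_const_mult lookup_pdiff_list)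

lemma lookup_tensor_op_twice:
  "Poly_Mapping.lookup (tensor_op k n T i (tensor_op k n T j p)) 0 =
    (\<Sum>\<gamma>\<in>indices n (k - 1). \<Sum>\<delta>\<in>indices n (k - 1). T (i # \<gamma>) * T (j # \<delta>) *
      (diff_factor (map (Pair i) \<gamma>) 0 * diff_factor (map (Pair j) \<delta>) (exps (map (Pair i) \<gamma>)) *
       Poly_Mapping.lookup p (exps (map (Pair i) \<gamma> @ map (Pair j) \<delta>))))"
  by (simp add: lookup_tensor_op sum_distrib_left mult_ac)

text \<open>\<open>zip w (rotate1 w)\<close> lists the steps of the closed walk through
  \<open>w\<close>, the last one leading back to its first vertex.\<close>

definition closed_walk_exps :: "nat list \<Rightarrow> (nat \<times> nat) \<Rightarrow>\<^sub>0 nat" where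
  "closed_walk_exps w = exps (zip w (rotate1 w))"

lemma indices_Suc: "indices n (Suc r) = (\<lambda>(w, c). w @ [c]) ` (indices n r \<times> {..<n})"
proof (intro Set.set_eqI iffI)
  fix w assume "w \<in> indices n (Suc r)"
  then show "w \<in> (\<lambda>(w, c). w @ [c]) ` (indices n r \<times> {..<n})"
    by (cases w rule: rev_cases) (auto simp: indices_def)
qed (auto simp: indices_def)

lemma sum_indices_Suc: "(\<Sum>w\<in>indices n (Suc r). f w) = (\<Sum>w\<in>indices n r. \<Sum>c<n. f (w @ [c]))"
proof -
  have "inj_on (\<lambda>(w, c). w @ [c]) (indices n r \<times> {..<n})" by (auto simp: inj_on_def)
  then show ?thesis unfolding indices_Suc
    by (simp add: sum.reindex sum.cartesian_product case_prod_unfold)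
qed

lemma sum_indices_Suc': "(\<Sum>w\<in>indices n (Suc r). f w) = (\<Sum>c<n. \<Sum>w\<in>indices n r. f (c # w))"
proof -
  have "indices n (Suc r) = (\<lambda>(c, w). c # w) ` ({..<n} \<times> indices n r)"
  proof (intro Set.set_eqI iffI)
    fix w assume "w \<in> indices n (Suc r)"
    then show "w \<in> (\<lambda>(c, w). c # w) ` ({..<n} \<times> indices n r)"
      by (cases w) (auto simp: indices_def)
  qed (auto simp: indices_def)
  moreover have "inj_on (\<lambda>(c, w). c # w) ({..<n} \<times> indices n r)" by (auto simp: inj_on_def)
  ultimately show ?thesis
    by (simp add: sum.reindex sum.cartesian_product case_prod_unfold)
qed

text \<open>The usual expansion over walks from \<open>a\<close> to \<open>b\<close>;
  \<open>w\<close> lists the inner vertices, of which a walk with \<open>Suc N\<close> steps has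
  \<open>N\<close>.\<close>

lemma indet_matrix_power:
  assumes "a < n" "b < n"
  shows "(mat n n (\<lambda>(i, j). indet i j) ^\<^sub>m Suc N) $$ (a, b)
    = (\<Sum>w\<in>indices n N. Poly_Mapping.single (exps (zip (a # w) (w @ [b]))) 1)"
  using assms
proof (induction N arbitrary: b)
  case 0
  have "indices n 0 = {[]}" by (auto simp: indices_def)
  with 0 show ?case by (simp add: indet_def)
next
  case (Suc N)
  let ?M = "mat n n (\<lambda>(i, j). indet i j)"
  have carr: "?M ^\<^sub>m Suc N \<in> carrier_mat n n" by (rule pow_carrier_mat) simp
  have "(?M ^\<^sub>m Suc (Suc N)) $$ (a, b) = (?M ^\<^sub>m Suc N * ?M) $$ (a, b)" by simp
  also have "\<dots> = (\<Sum>c<n. (?M ^\<^sub>m Suc N) $$ (a, c) * indet c b)"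
    using carr Suc.prems by (simp add: scalar_prod_def lessThan_atLeast0 del: pow_mat.simps)
  also have "\<dots> = (\<Sum>c<n. \<Sum>w\<in>indices n N. Poly_Mapping.single (exps (zip (a # w) (w @ [c]))) 1 * indet c b)"
    using Suc by (simp add: sum_distrib_right del: pow_mat.simps)
  also have "\<dots> = (\<Sum>w\<in>indices n N. \<Sum>c<n. Poly_Mapping.single (exps (zip (a # w) (w @ [c]))) 1 * indet c b)"
    by (rule sum.swap)
  also have "\<dots> = (\<Sum>w\<in>indices n N. \<Sum>c<n. Poly_Mapping.single (exps (zip (a # w @ [c]) ((w @ [c]) @ [b]))) 1)"
  proof (intro sum.cong refl)
    fix w c
    have "zip (a # w @ [c]) ((w @ [c]) @ [b]) = zip (a # w) (w @ [c]) @ [(c, b)]"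
      using zip_append[of "a # w" "w @ [c]" "[c]" "[b]"] by simp
    then show "Poly_Mapping.single (exps (zip (a # w) (w @ [c]))) 1 * indet c b
      = Poly_Mapping.single (exps (zip (a # w @ [c]) ((w @ [c]) @ [b]))) 1"
      by (simp only: exps_simps) (simp add: indet_def mult_single)
  qed
  finally show ?case by (simp only: sum_indices_Suc append_Cons)
qed

lemma power_trace_eq_sum:
  "power_trace n (Suc N) = (\<Sum>w\<in>indices n (Suc N). Poly_Mapping.single (closed_walk_exps w) 1)"
  unfolding sum_indices_Suc' power_trace_def closed_walk_exps_def
  by (intro sum.cong refl) (simp add: indet_matrix_power del: pow_mat.simps)

lemma lookup_power_trace:
  assumes "0 < N"
  shows "Poly_Mapping.lookup (power_trace n N) (exps vs)
    = real (card {w \<in> indices n N. mset (zip w (rotate1 w)) = mset vs})"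
proof -
  obtain N' where N: "N = Suc N'" using assms by (cases N) auto
  have "Poly_Mapping.lookup (power_trace n N) (exps vs)
      = (\<Sum>w\<in>indices n N. if mset (zip w (rotate1 w)) = mset vs then 1 else 0)"
    unfolding N power_trace_eq_sum
    by (simp add: lookup_sum lookup_single when_def closed_walk_exps_def exps_eq_iff)
  then show ?thesis by (simp add: sum.If_cases finite_indices Int_def)
qed

text \<open>A closed walk leaves and enters a vertex equally often, namely once per occurrence in
  \<open>w\<close>. So the first and the second components of its steps both recover the vertices of
  the walk.\<close>

lemma closed_walk_mset:
  fixes w :: "nat list"
  assumes "mset (zip w (rotate1 w)) = mset vs"
  shows "mset w = mset (map fst vs)" "mset w = mset (map snd vs)"
proof -
  have "mset (map f (zip w (rotate1 w))) = mset (map f vs)" for f :: "nat \<times> nat \<Rightarrow> nat"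
    using assms by simp
  moreover have "mset (rotate1 w) = mset w" by (cases w) simp_all
  ultimately show "mset w = mset (map fst vs)" "mset w = mset (map snd vs)"
    by (metis length_rotate1 map_fst_zip, metis length_rotate1 map_snd_zip)
qed

text \<open>All steps start at \<open>i\<close>, so a contributing walk never leaves
  \<open>i\<close> and both index lists are constant. There is one such walk, and differentiating
  a_ii^(2(k-1)) completely gives the factorial.\<close>

lemma tensor_op_twice_same:
  fixes \<alpha> :: real
  assumes H: "uniform k H" "2 \<le> k" and i: "i < nverts H"
  defines "T \<equiv> A_alpha k \<alpha> H" and "n \<equiv> nverts H"
  shows "Poly_Mapping.lookup (tensor_op k n T i (tensor_op k n T i (power_trace n (2 * (k - 1))))) 0
    = fact (2 * (k - 1)) * (\<alpha> * real (hdegree H i))\<^sup>2"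
proof -
  let ?N = "2 * (k - 1)" and ?r = "replicate (k - 1) i"
  let ?P = "power_trace n ?N"
  let ?f = "\<lambda>\<gamma> \<delta>. T (i # \<gamma>) * T (i # \<delta>) *
      (diff_factor (map (Pair i) \<gamma>) 0 * diff_factor (map (Pair i) \<delta>) (exps (map (Pair i) \<gamma>)) *
       Poly_Mapping.lookup ?P (exps (map (Pair i) \<gamma> @ map (Pair i) \<delta>)))"
  have N: "0 < ?N" using H(2) by simp
  have r: "?r \<in> indices n (k - 1)" using i by (auto simp: indices_def n_def)
  have walk: "w = replicate ?N i \<and> \<gamma> = ?r \<and> \<delta> = ?r"
    if w: "mset (zip w (rotate1 w)) = mset (map (Pair i) \<gamma> @ map (Pair i) \<delta>)"
      and len: "length \<gamma> = k - 1" "length \<delta> = k - 1" for w \<gamma> \<delta>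
  proof -
    have "map fst (map (Pair i) \<gamma> @ map (Pair i) \<delta>) = replicate ?N i"
      by (rule replicate_eqI) (use len in auto)
    then have mw: "mset w = replicate_mset ?N i" using closed_walk_mset(1)[OF w] by simp
    then have w': "w = replicate ?N i" by (simp only: mset_eq_replicate_iff)
    then have "set w \<subseteq> {i}" by auto
    moreover have "set \<gamma> \<union> set \<delta> \<subseteq> set w"
      using closed_walk_mset(2)[OF w] set_mset_mset[of w] by (simp add: o_def)
    ultimately have "set \<gamma> \<subseteq> {i}" "set \<delta> \<subseteq> {i}" by auto
    then have "\<gamma> = ?r" "\<delta> = ?r" by (auto intro!: replicate_eqI simp: len)
    with w' show ?thesis by blast
  qed
  have zero: "?f \<gamma> \<delta> = 0" if "\<gamma> \<in> indices n (k - 1)" "\<delta> \<in> indices n (k - 1)" "\<not> (\<gamma> = ?r \<and> \<delta> = ?r)" for \<gamma> \<delta>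
  proof -
    have none: "{w \<in> indices n ?N. mset (zip w (rotate1 w)) = mset (map (Pair i) \<gamma> @ map (Pair i) \<delta>)} = {}"
      using walk[of _ \<gamma> \<delta>] that unfolding indices_def by blast
    show ?thesis unfolding lookup_power_trace[OF N] none by simp
  qed
  have "{w \<in> indices n ?N. mset (zip w (rotate1 w)) = mset (map (Pair i) ?r @ map (Pair i) ?r)}
      = {replicate ?N i}"
  proof -
    have "rotate1 (replicate ?N i) = replicate ?N i"
      by (rule replicate_eqI) auto
    then have "mset (zip (replicate ?N i) (rotate1 (replicate ?N i)))
        = mset (map (Pair i) ?r @ map (Pair i) ?r)"
      by (intro multiset_eqI) simp
    moreover have "replicate ?N i \<in> indices n ?N" using i by (auto simp: indices_def n_def)
    ultimately show ?thesis using walk[of _ ?r ?r] by (blast intro: length_replicate)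
  qed
  then have one: "Poly_Mapping.lookup ?P (exps (map (Pair i) ?r @ map (Pair i) ?r)) = 1"
    unfolding lookup_power_trace[OF N] by simp
  have "exps (replicate m v) = Poly_Mapping.single v m" for m v
    by (intro poly_mapping_eqI) (simp add: lookup_exps lookup_single when_def)
  then have fac: "diff_factor (map (Pair i) ?r) 0 * diff_factor (map (Pair i) ?r) (exps (map (Pair i) ?r))
      = fact ?N"
    using diff_factor_replicate[of "k - 1" "(i, i)" 0]
      diff_factor_replicate[of "k - 1" "(i, i)" "Poly_Mapping.single (i, i) (k - 1)"]
    by (simp add: mult_2 mult.commute)
  have "Poly_Mapping.lookup (tensor_op k n T i (tensor_op k n T i ?P)) 0
      = (\<Sum>\<gamma>\<in>indices n (k - 1). \<Sum>\<delta>\<in>indices n (k - 1). ?f \<gamma> \<delta>)"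
    by (rule lookup_tensor_op_twice)
  also have "\<dots> = (\<Sum>\<gamma>\<in>{?r}. \<Sum>\<delta>\<in>indices n (k - 1). ?f \<gamma> \<delta>)"
    by (intro sum.mono_neutral_right finite_indices) (use r zero in \<open>auto intro!: sum.neutral\<close>)
  also have "\<dots> = (\<Sum>\<delta>\<in>indices n (k - 1). ?f ?r \<delta>)" by simp
  also have "\<dots> = (\<Sum>\<delta>\<in>{?r}. ?f ?r \<delta>)"
    by (intro sum.mono_neutral_right finite_indices) (use r zero[of ?r] in auto)
  also have "\<dots> = ?f ?r ?r" by simp
  also have "\<dots> = fact ?N * (\<alpha> * real (hdegree H i))\<^sup>2"
    unfolding one fac unfolding T_def A_alpha_diag[OF H] by (simp add: power2_eq_square)
  finally show ?thesis .
qed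

text \<open>All steps start at \<open>i\<close> or \<open>j\<close>, so the walk stays on these two
  vertices. For k > 2 a hyperedge does not fit into them; both index lists are then constant, every
  step is a loop, and no closed walk made of loops visits both vertices. For k = 2 the walks ij and
  ji remain.\<close>

lemma tensor_op_twice_distinct:
  fixes \<alpha> :: real
  assumes H: "uniform k H" "2 \<le> k" and ij: "i < nverts H" "j < nverts H" "i \<noteq> j"
  defines "T \<equiv> A_alpha k \<alpha> H" and "n \<equiv> nverts H"
  shows "Poly_Mapping.lookup (tensor_op k n T i (tensor_op k n T j (power_trace n (2 * (k - 1))))) 0
    = (if k = 2 then 2 * (T [i, j] * T [j, i]) else 0)"
proof -
  let ?N = "2 * (k - 1)"
  let ?P = "power_trace n ?N"
  let ?f = "\<lambda>\<gamma> \<delta>. T (i # \<gamma>) * T (j # \<delta>) *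
      (diff_factor (map (Pair i) \<gamma>) 0 * diff_factor (map (Pair j) \<delta>) (exps (map (Pair i) \<gamma>)) *
       Poly_Mapping.lookup ?P (exps (map (Pair i) \<gamma> @ map (Pair j) \<delta>)))"
  have N: "0 < ?N" using H(2) by simp
  have lk: "Poly_Mapping.lookup (tensor_op k n T i (tensor_op k n T j ?P)) 0
      = (\<Sum>\<gamma>\<in>indices n (k - 1). \<Sum>\<delta>\<in>indices n (k - 1). ?f \<gamma> \<delta>)"
    by (rule lookup_tensor_op_twice)
  show ?thesis
  proof (cases "k = 2")
    case False
    have "?f \<gamma> \<delta> = 0" if g: "\<gamma> \<in> indices n (k - 1)" and d: "\<delta> \<in> indices n (k - 1)" for \<gamma> \<delta>
    proof (rule ccontr)
      assume nz: "?f \<gamma> \<delta> \<noteq> 0"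
      have len: "length \<gamma> = k - 1" "length \<delta> = k - 1" using g d by (auto simp: indices_def)
      from nz have "card {w \<in> indices n ?N. mset (zip w (rotate1 w)) = mset (map (Pair i) \<gamma> @ map (Pair j) \<delta>)} \<noteq> 0"
        unfolding lookup_power_trace[OF N] by auto
      then obtain w where w: "mset (zip w (rotate1 w)) = mset (map (Pair i) \<gamma> @ map (Pair j) \<delta>)"
        by (metis (mono_tags, lifting) card.empty ex_in_conv mem_Collect_eq)
      have "set w = set (map fst (map (Pair i) \<gamma> @ map (Pair j) \<delta>))"
        using closed_walk_mset(1)[OF w] by (metis set_mset_mset)
      then have sw: "set w = {i, j}" using len H(2) by (cases \<gamma>; cases \<delta>) auto
      have "set w = set (map snd (map (Pair i) \<gamma> @ map (Pair j) \<delta>))"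
        using closed_walk_mset(2)[OF w] by (metis set_mset_mset)
      then have sub: "set \<gamma> \<subseteq> {i, j}" "set \<delta> \<subseteq> {i, j}" unfolding sw by auto
      have long: "\<not> distinct (v # \<epsilon>)"
        if "length \<epsilon> = k - 1" "set \<epsilon> \<subseteq> {i, j}" "v \<in> {i, j}" for v \<epsilon>
      proof
        assume "distinct (v # \<epsilon>)"
        then have "card (set (v # \<epsilon>)) = k" using that(1) H(2) distinct_card[of "v # \<epsilon>"] by simp
        moreover have "card (set (v # \<epsilon>)) \<le> card {i, j}" using that by (intro card_mono) auto
        ultimately show False using False H(2) ij(3) by simp
      qed
      have g': "\<gamma> = replicate (k - 1) i"
        using A_alpha_support[OF H len(1), of \<alpha> i] long[OF len(1) sub(1)] nz by (auto simp: T_def)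
      have d': "\<delta> = replicate (k - 1) j"
        using A_alpha_support[OF H len(2), of \<alpha> j] long[OF len(2) sub(2)] nz by (auto simp: T_def)
      have "set (zip w (rotate1 w)) = set (map (Pair i) \<gamma> @ map (Pair j) \<delta>)"
        using w by (metis set_mset_mset)
      then have diag: "x = y" if "(x, y) \<in> set (zip w (rotate1 w))" for x y
        using that unfolding g' d' by auto
      have "w ! l = rotate1 w ! l" if "l < length w" for l
        by (rule diag) (use that in \<open>auto simp: set_zip\<close>)
      then have "rotate1 w = w" by (intro nth_equalityI) (simp_all del: rotate1.simps)
      then show False using rotate1_fixpoint_card[of w] sw ij(3) by auto
    qed
    then show ?thesis unfolding lk using False by (simp add: sum.neutral)
  next
    case True
    have ind: "indices n (Suc 0) = (\<lambda>x. [x]) ` {..<n}"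
      by (auto simp: indices_def length_Suc_conv)
    have pair: "{#p, q#} = {#r, s#} \<longleftrightarrow> p = r \<and> q = s \<or> p = s \<and> q = r" for p q r s :: "nat \<times> nat"
      by (auto simp: add_eq_conv_diff)
    have sing: "{w \<in> indices n 2. mset (zip w (rotate1 w)) = mset [(i, x), (j, y)]}
        = (if x = j \<and> y = i then {[i, j], [j, i]} else {})" for x y
    proof -
      have "{w \<in> indices n 2. mset (zip w (rotate1 w)) = mset [(i, x), (j, y)]}
          = (\<lambda>(a, b). [a, b]) ` {(a, b). a < n \<and> b < n \<and> {#(a, b), (b, a)#} = {#(i, x), (j, y)#}}"
        by (auto simp: indices_def numeral_2_eq_2 length_Suc_conv image_iff)
      also have "{(a, b). a < n \<and> b < n \<and> {#(a, b), (b, a)#} = {#(i, x), (j, y)#}}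
          = (if x = j \<and> y = i then {(i, j), (j, i)} else {})"
        using ij unfolding pair by (auto simp: n_def)
      finally show ?thesis by simp
    qed
    have N2: "0 < (2::nat)" by simp
    have val: "?f [x] [y] = (if x = j \<and> y = i then 2 * (T [i, j] * T [j, i]) else 0)" for x y
    proof -
      have "Poly_Mapping.lookup ?P (exps (map (Pair i) [x] @ map (Pair j) [y])) = (if x = j \<and> y = i then 2 else 0)"
        using lookup_power_trace[OF N2, of n "[(i, x), (j, y)]"] ij unfolding sing True by auto
      moreover have "diff_factor (map (Pair i) [x]) 0 * diff_factor (map (Pair j) [y]) (exps (map (Pair i) [x])) = 1"
        using ij by (simp add: lookup_single when_def)
      ultimately show ?thesis by simp
    qed
    have "Poly_Mapping.lookup (tensor_op k n T i (tensor_op k n T j ?P)) 0 = (\<Sum>x<n. \<Sum>y<n. ?f [x] [y])"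
      unfolding lk by (simp add: True ind sum.reindex inj_on_def)
    also have "\<dots> = (\<Sum>x<n. if x = j then (\<Sum>y<n. if y = i then 2 * (T [i, j] * T [j, i]) else 0) else 0)"
      unfolding val by (intro sum.cong refl) auto
    also have "\<dots> = 2 * (T [i, j] * T [j, i])" using ij by (simp add: n_def)
    finally show ?thesis using True by simp
  qed
qed

text \<open>The vector e_i + e_j. The tuples (d_1, ..., d_n) with sum 2 are these vectors, each
  obtained once if i \<le> j is demanded.\<close>

definition unit_pair :: "nat \<Rightarrow> nat \<times> nat \<Rightarrow> nat list" where
  "unit_pair n = (\<lambda>(i, j). map (\<lambda>l. (if l = i then 1 else 0) + (if l = j then 1 else 0)) [0..<n])"

lemma nth_unit_pair: "l < n \<Longrightarrow> unit_pair n (i, j) ! l = (if l = i then 1 else 0) + (if l = j then 1 else 0)"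
  by (simp add: unit_pair_def)

lemma compositions_of_2:
  "{ds. length ds = n \<and> sum_list ds = 2} = unit_pair n ` {(i, j). i \<le> j \<and> j < n}"
proof (intro Set.set_eqI iffI)
  fix ds :: "nat list" assume "ds \<in> {ds. length ds = n \<and> sum_list ds = 2}"
  then have len: "length ds = n" and s: "(\<Sum>l<n. ds ! l) = 2"
    by (auto simp: sum_list_sum_nth lessThan_atLeast0)
  have "\<exists>i<n. ds ! i \<noteq> 0" using s by (metis lessThan_iff sum.neutral zero_neq_numeral)
  then obtain i where i: "i < n" "ds ! i \<noteq> 0" by blast
  have s': "ds ! i + (\<Sum>l\<in>{..<n} - {i}. ds ! l) = 2" using s i by (simp add: sum.remove)
  have "\<exists>j<n. \<forall>l<n. ds ! l = (if l = i then 1 else 0) + (if l = j then 1 else 0)"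
  proof (cases "ds ! i = 2")
    case True
    then have "\<forall>l\<in>{..<n} - {i}. ds ! l = 0" using s' by simp
    then show ?thesis using i True by (intro exI[of _ i]) auto
  next
    case False
    then have d1: "ds ! i = 1" and "(\<Sum>l\<in>{..<n} - {i}. ds ! l) = Suc 0" using s' i by linarith+
    then obtain j where "j \<in> {..<n} - {i}" "ds ! j = Suc 0"
      "\<forall>l\<in>{..<n} - {i}. j \<noteq> l \<longrightarrow> ds ! l = 0"
      using sum_eq_Suc0_iff[of "{..<n} - {i}" "(!) ds"] by auto
    then show ?thesis using d1 by (intro exI[of _ j]) auto
  qed
  then obtain j where j: "j < n" and "\<And>l. l < n \<Longrightarrow> ds ! l = unit_pair n (i, j) ! l"
    by (auto simp: nth_unit_pair)
  then have "ds = unit_pair n (i, j)" using len by (intro nth_equalityI) (auto simp: unit_pair_def)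
  moreover have "unit_pair n (i, j) = unit_pair n (j, i)" by (auto simp: unit_pair_def add.commute)
  ultimately have "ds = unit_pair n (min i j, max i j)" by (simp add: min_def max_def)
  then show "ds \<in> unit_pair n ` {(i, j). i \<le> j \<and> j < n}"
    using i j by auto
next
  fix ds assume "ds \<in> unit_pair n ` {(i, j). i \<le> j \<and> j < n}"
  then show "ds \<in> {ds. length ds = n \<and> sum_list ds = 2}"
    by (auto simp: unit_pair_def sum_list_addf sum_list_sum_nth)
qed

lemma inj_on_unit_pair: "inj_on (unit_pair n) {(i, j). i \<le> j \<and> j < n}"
proof (intro inj_onI, clarify)
  fix i j i' j' assume le: "i \<le> j" "j < n" "i' \<le> j'" "j' < n" and "unit_pair n (i, j) = unit_pair n (i', j')"
  then have eq: "(if l = i then 1 else 0) + (if l = j then 1 else 0)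
      = (if l = i' then 1 else 0) + (if l = j' then 1 else (0::nat))" if "l < n" for l
    using that by (metis nth_unit_pair)
  show "i = i' \<and> j = j'"
  proof -
    have "i = i' \<or> i = j'" using eq[of i] le by (auto split: if_splits)
    moreover have "j = i' \<or> j = j'" using eq[of j] le by (auto split: if_splits)
    moreover have "i' = i \<or> i' = j" using eq[of i'] le by (auto split: if_splits)
    moreover have "j' = i \<or> j' = j" using eq[of j'] le by (auto split: if_splits)
    ultimately show ?thesis using le by arith
  qed
qed

lemma foldr_id: "(\<And>x p. x \<in> set xs \<Longrightarrow> f x p = p) \<Longrightarrow> foldr f xs p = p"
  by (induction xs) auto

lemma upt_split: "l \<le> i \<Longrightarrow> i < n \<Longrightarrow> [l..<n] = [l..<i] @ i # [Suc i..<n]"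
  using upt_add_eq_append[of l i "n - i"] upt_conv_Cons[of i n] by simp

lemma tensor_op_const_mult:
  "tensor_op k n T i (const_ipoly c * p) = const_ipoly c * tensor_op k n T i p"
  by (intro poly_mapping_eqI) (simp add: lookup_tensor_op lookup_const_mult sum_distrib_left, simp add: mult_ac)

text \<open>At order 2 all but one or two of the d_i are 0, and the corresponding factors of the
  composition act as the identity; this lemma and \<open>foldr_two\<close> delete them.\<close>

lemma foldr_single_pair:
  assumes "i < n" and id: "\<And>x p. x \<noteq> i \<Longrightarrow> x < n \<Longrightarrow> f x p = p"
  shows "foldr f [0..<n] p = f i p"
  unfolding upt_split[OF le0 assms(1)] foldr_append foldr.simps o_apply
  using assms by (subst (1 2) foldr_id) auto

lemma foldr_two:
  assumes "i < j" "j < n" and id: "\<And>x p. x \<noteq> i \<Longrightarrow> x \<noteq> j \<Longrightarrow> x < n \<Longrightarrow> f x p = p"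
  shows "foldr f [0..<n] p = f i (f j p)"
proof -
  have "[0..<n] = [0..<i] @ i # [Suc i..<j] @ j # [Suc j..<n]"
    using upt_split[of 0 i n] upt_split[of "Suc i" j n] assms(1,2) by simp
  then show ?thesis
    by (simp only: foldr_append foldr.simps o_apply) (subst (1 2 3) foldr_id; use assms in auto)
qed

lemma const_ipoly_1: "const_ipoly 1 * p = p"
  by (intro poly_mapping_eqI) (simp add: lookup_const_mult)

lemma tensor_trace_2_A_alpha:
  fixes \<alpha> :: real
  assumes H: "uniform k H" "2 \<le> k"
  shows "tensor_trace k (nverts H) 2 (A_alpha k \<alpha> H) = moment_value k \<alpha> H"
proof -
  let ?n = "nverts H" and ?T = "A_alpha k \<alpha> H"
  let ?P = "power_trace ?n (2 * (k - 1))"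
  let ?step = "\<lambda>ds i p. const_ipoly (1 / fact (ds ! i * (k - 1))) * (tensor_op k ?n ?T i ^^ (ds ! i)) p"
  let ?G = "\<lambda>ds. Poly_Mapping.lookup (foldr (?step ds) [0..<?n] ?P) 0"
  let ?c = "if k = 2 then 1 else (0::real)"
  have same: "?G (unit_pair ?n (i, i)) = \<alpha>\<^sup>2 * real ((hdegree H i)\<^sup>2)" if "i < ?n" for i
  proof -
    let ?ds = "unit_pair ?n (i, i)"
    have "foldr (?step ?ds) [0..<?n] ?P = ?step ?ds i ?P"
      by (rule foldr_single_pair[OF that]) (simp add: nth_unit_pair const_ipoly_1)
    also have "\<dots> = const_ipoly (1 / fact (2 * (k - 1))) * tensor_op k ?n ?T i (tensor_op k ?n ?T i ?P)"
      using that by (simp add: nth_unit_pair numeral_2_eq_2)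
    finally show ?thesis using tensor_op_twice_same[OF H that, of \<alpha>]
      by (simp add: lookup_const_mult power_mult_distrib)
  qed
  \<comment> \<open>Two factors 1 / (k - 1)! occur here. They do not show in the result because the
    term is 0 for k > 2 and (k - 1)! is 1 for k = 2.\<close>
  have diff: "?G (unit_pair ?n (i, j)) = ?c * (2 * (?T [i, j] * ?T [j, i]))" if "i < j" "j < ?n" for i j
  proof -
    let ?ds = "unit_pair ?n (i, j)"
    have "foldr (?step ?ds) [0..<?n] ?P = ?step ?ds i (?step ?ds j ?P)"
      by (rule foldr_two[OF that]) (simp add: nth_unit_pair const_ipoly_1)
    also have "\<dots> = const_ipoly (1 / fact (k - 1)) * (const_ipoly (1 / fact (k - 1)) *
        tensor_op k ?n ?T i (tensor_op k ?n ?T j ?P))"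
      using that by (simp add: nth_unit_pair tensor_op_const_mult)
    finally show ?thesis
      using tensor_op_twice_distinct[OF H, of i j \<alpha>] that by (simp add: lookup_const_mult)
  qed
  have "(\<Sum>ds | length ds = ?n \<and> sum_list ds = 2. ?G ds)
      = (\<Sum>ij\<in>{(i, j). i \<le> j \<and> j < ?n}. ?G (unit_pair ?n ij))"
    unfolding compositions_of_2 by (simp add: sum.reindex[OF inj_on_unit_pair])
  also have "{(i, j). i \<le> j \<and> j < ?n} = (SIGMA j:{..<?n}. {..j})\<inverse>" by auto
  also have "(\<Sum>ij\<in>(SIGMA j:{..<?n}. {..j})\<inverse>. ?G (unit_pair ?n ij))
      = (\<Sum>(j, i)\<in>(SIGMA j:{..<?n}. {..j}). ?G (unit_pair ?n (i, j)))"
    by (rule sum.reindex_bij_witness[of _ prod.swap prod.swap]) auto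
  also have "\<dots> = (\<Sum>j<?n. \<Sum>i\<le>j. ?G (unit_pair ?n (i, j)))"
    by (subst sum.Sigma) auto
  also have "\<dots> = (\<Sum>j<?n. \<alpha>\<^sup>2 * real ((hdegree H j)\<^sup>2) + (\<Sum>i<j. ?c * (2 * (?T [i, j] * ?T [j, i]))))"
  proof (intro sum.cong refl)
    fix j assume "j \<in> {..<?n}"
    then show "(\<Sum>i\<le>j. ?G (unit_pair ?n (i, j)))
        = \<alpha>\<^sup>2 * real ((hdegree H j)\<^sup>2) + (\<Sum>i<j. ?c * (2 * (?T [i, j] * ?T [j, i])))"
      using same[of j] diff[of _ j] by (simp add: lessThan_Suc_atMost[symmetric] add.commute)
  qed
  also have "\<dots> = \<alpha>\<^sup>2 * real (\<Sum>v\<in>verts H. (hdegree H v)\<^sup>2)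
      + ?c * (\<Sum>j<?n. \<Sum>i<j. 2 * (?T [i, j] * ?T [j, i]))"
    by (simp add: sum.distrib sum_distrib_left verts_def lessThan_atLeast0)
  also have "?c * (\<Sum>j<?n. \<Sum>i<j. 2 * (?T [i, j] * ?T [j, i]))
      = (if k = 2 then 2 * real (card (hedges H)) * (1 - \<alpha>)\<^sup>2 else 0)"
  proof (cases "k = 2")
    case True
    let ?a = "\<lambda>i j. ?T [i, j] * ?T [j, i]"
    \<comment> \<open>\<open>?a\<close> is symmetric, so the off-diagonal sum is twice the sum over
      pairs i < j; splitting the inner sum at \<open>i\<close> shows this.\<close>
    have "(\<Sum>i<?n. \<Sum>j\<in>{..<?n} - {i}. ?a i j)
        = (\<Sum>i<?n. (\<Sum>j<i. ?a i j) + (\<Sum>j\<in>{i<..<?n}. ?a i j))"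
    proof (intro sum.cong refl)
      fix i assume "i \<in> {..<?n}"
      then have s: "{..<?n} - {i} = {..<i} \<union> {i<..<?n}" by auto
      have "{..<i} \<inter> {i<..<?n} = {}" by auto
      from sum.union_disjoint[OF finite_lessThan finite_greaterThanLessThan this, of "?a i"]
      show "(\<Sum>j\<in>{..<?n} - {i}. ?a i j) = (\<Sum>j<i. ?a i j) + (\<Sum>j\<in>{i<..<?n}. ?a i j)"
        unfolding s .
    qed
    also have "\<dots> = (\<Sum>i<?n. \<Sum>j<i. ?a i j) + (\<Sum>i<?n. \<Sum>j\<in>{i<..<?n}. ?a i j)"
      by (rule sum.distrib)
    also have "(\<Sum>i<?n. \<Sum>j\<in>{i<..<?n}. ?a i j) = (\<Sum>j<?n. \<Sum>i<j. ?a i j)"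
    proof -
      have "(\<Sum>i<?n. \<Sum>j\<in>{i<..<?n}. ?a i j) = (\<Sum>(i, j)\<in>(SIGMA i:{..<?n}. {i<..<?n}). ?a i j)"
        by (rule sum.Sigma) auto
      also have "\<dots> = (\<Sum>(j, i)\<in>(SIGMA j:{..<?n}. {..<j}). ?a i j)"
        by (rule sum.reindex_bij_witness[of _ prod.swap prod.swap]) auto
      also have "\<dots> = (\<Sum>j<?n. \<Sum>i<j. ?a i j)"
        by (rule sum.Sigma[symmetric]) auto
      finally show ?thesis .
    qed
    also have "(\<Sum>i<?n. \<Sum>j<i. ?a i j) = (\<Sum>j<?n. \<Sum>i<j. ?a i j)"
      by (simp add: mult.commute)
    finally show ?thesis
      using sum_graph_offdiag[of H \<alpha>] H(1) True by (simp add: sum_distrib_left)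
  qed simp
  finally show ?thesis
    unfolding tensor_trace_def moment_value_def using H(2)
    by (auto simp: algebra_simps)
qed

section \<open>Counting vertices of a unicyclic hypergraph\<close>

text \<open>Cycles of an arbitrary bipartite graph with edge set \<open>F\<close>. Here single
  incidences and nodes of either side can be deleted, which would lead outside uniform
  hypergraphs.\<close>

definition bip_cycle :: "('a \<times> 'b) set \<Rightarrow> 'a list \<Rightarrow> 'b list \<Rightarrow> bool" where
  "bip_cycle F vs es \<longleftrightarrow> length vs = length es \<and> 2 \<le> length vs \<and> distinct vs \<and> distinct es \<and>
     (\<forall>i<length vs. (vs ! i, es ! i) \<in> F \<and> (vs ! (Suc i mod length vs), es ! i) \<in> F)"

lemma distinct_map_shift:
  assumes "\<And>i d. 0 < d \<Longrightarrow> d < n \<Longrightarrow> f i \<noteq> f (i + d)"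
  shows "distinct (map f [i..<i + n])"
proof -
  have "inj_on f {i..<i + n}"
  proof (rule linorder_inj_onI')
    fix x y assume "x \<in> {i..<i + n}" "y \<in> {i..<i + n}" "x < y"
    then show "f x \<noteq> f y" using assms[of "y - x" x] by auto
  qed
  then show ?thesis by (simp add: distinct_map)
qed

text \<open>In a walk that never turns back, the closest repetition of a vertex or of an edge closes a cycle.\<close>

lemma bip_cycle_exists_min_degree_2:
  assumes "finite F" "F \<noteq> {}"
    and l: "\<And>v e. (v, e) \<in> F \<Longrightarrow> \<exists>e'. e' \<noteq> e \<and> (v, e') \<in> F"
    and r: "\<And>v e. (v, e) \<in> F \<Longrightarrow> \<exists>v'. v' \<noteq> v \<and> (v', e) \<in> F"
  shows "\<exists>vs es. bip_cycle F vs es"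
proof -
  have "\<exists>s. \<forall>n. s n \<in> F \<and> (fst (s (Suc n)) \<noteq> fst (s n) \<and> snd (s (Suc n)) \<noteq> snd (s n)
      \<and> (fst (s (Suc n)), snd (s n)) \<in> F)"
  proof (rule dependent_nat_choice)
    show "\<exists>x. x \<in> F" using assms(2) by blast
  next
    fix x n assume "x \<in> F"
    then obtain v' where v': "v' \<noteq> fst x" "(v', snd x) \<in> F" using r[of "fst x" "snd x"] by auto
    then obtain e' where "e' \<noteq> snd x" "(v', e') \<in> F" using l by blast
    with v' show "\<exists>y. y \<in> F \<and> fst y \<noteq> fst x \<and> snd y \<noteq> snd x \<and> (fst y, snd x) \<in> F" by force
  qed
  then obtain s where s: "\<And>n. s n \<in> F" "\<And>n. fst (s (Suc n)) \<noteq> fst (s n)"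
    "\<And>n. snd (s (Suc n)) \<noteq> snd (s n)" "\<And>n. (fst (s (Suc n)), snd (s n)) \<in> F" by blast
  define v e where "v = fst \<circ> s" and "e = snd \<circ> s"
  have ve: "(v n, e n) \<in> F" "(v (Suc n), e n) \<in> F" "v (Suc n) \<noteq> v n" "e (Suc n) \<noteq> e n" for n
    using s[of n] by (auto simp: v_def e_def)
  \<comment> \<open>\<open>R d\<close> says that some vertex or edge recurs after \<open>d\<close>
    steps. For the least such \<open>d\<close>, any \<open>d\<close> consecutive vertices are
    distinct, and so are any \<open>d\<close> consecutive edges.\<close>
  define R where "R d \<longleftrightarrow> 0 < d \<and> (\<exists>i. v i = v (i + d) \<or> e i = e (i + d))" for d
  have "\<not> inj v"
  proof
    assume "inj v"
    moreover have "range v \<subseteq> fst ` F" using ve(1) by force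
    ultimately show False using assms(1) by (meson finite_imageD finite_imageI finite_subset infinite_UNIV_nat)
  qed
  then obtain i j where "i < j" "v i = v j"
    by (metis linorder_inj_onI' )
  then have "R (j - i)" by (auto simp: R_def intro!: exI[of _ i])
  define d where "d = (LEAST d. R d)"
  have "R d" unfolding d_def using \<open>R (j - i)\<close> by (rule LeastI)
  have min: "v i \<noteq> v (i + d')" "e i \<noteq> e (i + d')" if "0 < d'" "d' < d" for i d'
    using not_less_Least[of d' R] that by (auto simp: d_def R_def)
  have d2: "2 \<le> d"
  proof (rule ccontr)
    assume "\<not> 2 \<le> d"
    then have "d = 1" using \<open>R d\<close> by (simp add: R_def)
    then show False using \<open>R d\<close> ve(3,4) by (auto simp: R_def) (metis)+
  qed
  have dist: "distinct (map v [i..<i + d])" "distinct (map e [i..<i + d])" for i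
    using min by (auto intro: distinct_map_shift)
  obtain i where "v i = v (i + d) \<or> e i = e (i + d)" using \<open>R d\<close> by (auto simp: R_def)
  then show ?thesis
  proof
    assume close: "v i = v (i + d)"
    have "(map v [i..<i + d] ! (Suc l mod d), map e [i..<i + d] ! l) \<in> F" if "l < d" for l
    proof (cases "Suc l = d")
      case True
      then show ?thesis using ve(2)[of "i + l"] close d2 by auto
    next
      case False
      then show ?thesis using ve(2)[of "i + l"] that by simp
    qed
    then have "bip_cycle F (map v [i..<i + d]) (map e [i..<i + d])"
      unfolding bip_cycle_def using dist d2 ve by auto
    then show ?thesis by blast
  next
    \<comment> \<open>If an edge recurs, the cycle begins with the vertex after its first
      occurrence, hence the shift to \<open>Suc i\<close>: the last edge \<open>e (i + d)\<close> is
      \<open>e i\<close>, which contains \<open>v (Suc i)\<close>.\<close>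
    assume close: "e i = e (i + d)"
    have "(map v [Suc i..<Suc i + d] ! (Suc l mod d), map e [Suc i..<Suc i + d] ! l) \<in> F" if "l < d" for l
    proof (cases "Suc l = d")
      case True
      then have "e (Suc i + l) = e i" using close by auto
      then show ?thesis using ve(2)[of i] True d2 by (simp del: upt_Suc)
    next
      case False
      then show ?thesis using ve(2)[of "Suc i + l"] that by (simp del: upt_Suc)
    qed
    then have "bip_cycle F (map v [Suc i..<Suc i + d]) (map e [Suc i..<Suc i + d])"
      unfolding bip_cycle_def using dist[of "Suc i"] d2 ve by (auto simp del: upt_Suc)
    then show ?thesis by blast
  qed
qed

lemma bip_cycle_mono: "bip_cycle F vs es \<Longrightarrow> F \<subseteq> G \<Longrightarrow> bip_cycle G vs es"
  by (auto simp: bip_cycle_def)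

text \<open>Deleting a node of degree at most 1 from either side costs one node and at most one
  incidence, so the inequality survives. Once no such node is left, every degree is at least 2 and
  \<open>bip_cycle_exists_min_degree_2\<close> applies.\<close>

lemma bip_cycle_exists_card:
  assumes "finite V" "finite E" "F \<subseteq> V \<times> E" "0 < card V + card E" "card V + card E \<le> card F"
  shows "\<exists>vs es. bip_cycle F vs es"
  using assms
proof (induction "card V + card E" arbitrary: V E F rule: less_induct)
  case less
  have finF: "finite F" using less.prems by (meson finite_SigmaI finite_subset)
  have notsingle: "0 < card V" "0 < card E"
  proof -
    have "F = {}" if "card V = 0 \<or> card E = 0" using that less.prems by auto
    then show "0 < card V" "0 < card E" using less.prems by (metis card.empty gr0I le_zero_eq)+
  qed
  consider (l) v where "v \<in> V" "card {e. (v, e) \<in> F} \<le> 1"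
    | (r) e where "e \<in> E" "card {v. (v, e) \<in> F} \<le> 1"
    | (two) "\<And>v. v \<in> V \<Longrightarrow> 2 \<le> card {e. (v, e) \<in> F}" "\<And>e. e \<in> E \<Longrightarrow> 2 \<le> card {v. (v, e) \<in> F}"
    by (metis Suc_1 not_less_eq_eq)
  then show ?case
  proof cases
    case l
    let ?S = "{v} \<times> {e. (v, e) \<in> F}"
    have sub: "?S \<subseteq> F" by auto
    have cS: "card ?S \<le> 1" using l by (simp add: card_cartesian_product)
    have cF: "card (F - ?S) + card ?S = card F"
      using finF sub by (metis card_Diff_subset card_mono finite_subset le_add_diff_inverse2)
    have cV: "card (V - {v}) + 1 = card V" using l less.prems notsingle by simp
    have "\<exists>vs es. bip_cycle (F - ?S) vs es"
      by (rule less.hyps[of "V - {v}" E]) (use less.prems cS cF cV notsingle in auto)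
    then show ?thesis using bip_cycle_mono by blast
  next
    case r
    let ?S = "{v. (v, e) \<in> F} \<times> {e}"
    have sub: "?S \<subseteq> F" by auto
    have cS: "card ?S \<le> 1" using r by (simp add: card_cartesian_product)
    have cF: "card (F - ?S) + card ?S = card F"
      using finF sub by (metis card_Diff_subset card_mono finite_subset le_add_diff_inverse2)
    have cE: "card (E - {e}) + 1 = card E" using r less.prems notsingle by simp
    have "\<exists>vs es. bip_cycle (F - ?S) vs es"
      by (rule less.hyps[of V "E - {e}"]) (use less.prems cS cF cE notsingle in auto)
    then show ?thesis using bip_cycle_mono by blast
  next
    case two
    have other: "\<exists>x'. x' \<noteq> x \<and> x' \<in> A" if "2 \<le> card A" for x :: 'x and A
    proof (rule ccontr)
      assume "\<nexists>x'. x' \<noteq> x \<and> x' \<in> A"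
      then have "A \<subseteq> {x}" by blast
      then have "card A \<le> 1" using card_mono[of "{x}" A] by simp
      then show False using that by simp
    qed
    show ?thesis
    proof (rule bip_cycle_exists_min_degree_2[OF finF])
      show "F \<noteq> {}" using less.prems notsingle by auto
    next
      fix v e assume "(v, e) \<in> F"
      then have "v \<in> V" "e \<in> E" using less.prems by auto
      then show "\<exists>e'. e' \<noteq> e \<and> (v, e') \<in> F" "\<exists>v'. v' \<noteq> v \<and> (v', e) \<in> F"
        using other[OF two(1), of v e] other[OF two(2), of e v] by auto
    qed
  qed
qed

section \<open>Euler's relation for the incidence graph\<close>

definition incidence :: "hypergraph \<Rightarrow> (nat \<times> nat set) set" where
  "incidence H = {(v, e). e \<in> hedges H \<and> v \<in> e}"

lemma is_cycle_iff_bip_cycle: "is_cycle H vs es \<longleftrightarrow> bip_cycle (incidence H) vs es"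
proof -
  have "set es \<subseteq> hedges H \<longleftrightarrow> (\<forall>i<length es. es ! i \<in> hedges H)"
    by (metis in_set_conv_nth nth_mem subset_iff)
  then show ?thesis unfolding is_cycle_def bip_cycle_def incidence_def by auto
qed

lemma is_cycleD:
  assumes "is_cycle H vs es"
  shows "length es = length vs" "2 \<le> length vs" "distinct vs" "distinct es" "set es \<subseteq> hedges H"
    and "\<And>i. i < length vs \<Longrightarrow> vs ! i \<in> es ! i"
    and "\<And>i. i < length vs \<Longrightarrow> vs ! (Suc i mod length vs) \<in> es ! i"
    and "\<And>i. i < length vs \<Longrightarrow> es ! i \<in> hedges H"
  using assms by (auto simp: is_cycle_def subset_iff)

lemma uniformD:
  assumes "uniform k H" "e \<in> hedges H"
  shows "finite e" "card e = k" "e \<subseteq> verts H"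
  using assms by (auto simp: uniform_def verts_def intro: finite_subset)

lemma Suc_mod_neq: "2 \<le> n \<Longrightarrow> j < n \<Longrightarrow> Suc j mod n \<noteq> j"
  by (cases "Suc j = n") auto

lemma card_incidence:
  assumes "uniform k H" "2 \<le> k"
  shows "card (incidence H) = card (hedges H) * k" "finite (incidence H)"
proof -
  have "incidence H = (\<lambda>(e, v). (v, e)) ` (SIGMA e:hedges H. e)"
    by (auto simp: incidence_def)
  moreover have "inj_on (\<lambda>(e, v). (v, e)) (SIGMA e:hedges H. e)" by (auto simp: inj_on_def)
  moreover have "\<And>e. e \<in> hedges H \<Longrightarrow> finite e" "\<And>e. e \<in> hedges H \<Longrightarrow> card e = k"
    using assms by (auto simp: uniform_def intro: card_ge_0_finite)
  ultimately show "card (incidence H) = card (hedges H) * k" "finite (incidence H)"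
    using finite_hedges[OF assms(1)] by (simp_all add: card_image)
qed

text \<open>With one incidence too many, an incidence of the given cycle can be deleted and the rest
  still has as many incidences as nodes. It contains a cycle avoiding the deleted incidence, hence a
  second cycle.\<close>

lemma unicyclic_incidence_bound:
  assumes "uniform k H" "2 \<le> k" "unicyclic H"
  shows "card (hedges H) * k \<le> nverts H + card (hedges H)"
proof (rule ccontr)
  assume more: "\<not> card (hedges H) * k \<le> nverts H + card (hedges H)"
  obtain vs es where c: "is_cycle H vs es" using assms(3) by (auto simp: unicyclic_def)
  let ?f = "(vs ! 0, es ! 0)"
  have len: "2 \<le> length vs" "length vs = length es" using c by (auto simp: is_cycle_def)
  have flag: "?f \<in> cycle_flags vs es" unfolding cycle_flags_def using len by force
  have "0 < length vs" using len by linarith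
  then have f: "?f \<in> incidence H" using is_cycleD(6,8)[OF c, of 0] by (simp add: incidence_def)
  have sub: "incidence H \<subseteq> verts H \<times> hedges H" using assms(1) by (auto simp: incidence_def uniform_def)
  have "card (verts H) + card (hedges H) \<le> card (incidence H - {?f})"
    using more card_incidence[OF assms(1,2)] f by (simp add: verts_def)
  moreover have "0 < card (verts H)" using f sub by (auto simp: card_gt_0_iff verts_def)
  ultimately obtain vs' es' where c': "bip_cycle (incidence H - {?f}) vs' es'"
    using bip_cycle_exists_card[of "verts H" "hedges H" "incidence H - {?f}"] sub finite_hedges[OF assms(1)]
    by (auto simp: verts_def)
  then have "is_cycle H vs' es'" unfolding is_cycle_iff_bip_cycle by (rule bip_cycle_mono) auto
  moreover have "?f \<notin> cycle_flags vs' es'"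
    using c' by (auto simp: cycle_flags_def bip_cycle_def)
  ultimately show False using assms(3) c flag unfolding unicyclic_def by metis
qed

lemma connected_closed_set:
  assumes "connected_hg H" "u \<in> A" "u \<in> verts H"
    and closed: "\<And>e x y. e \<in> hedges H \<Longrightarrow> x \<in> e \<Longrightarrow> y \<in> e \<Longrightarrow> x \<in> A \<Longrightarrow> y \<in> A"
  shows "verts H \<subseteq> A"
proof
  fix v assume "v \<in> verts H"
  then have "(u, v) \<in> {(x, y). \<exists>e\<in>hedges H. x \<in> e \<and> y \<in> e}\<^sup>*"
    using assms by (auto simp: connected_hg_def)
  then show "v \<in> A" by (induction rule: rtrancl_induct) (use assms in auto)
qed

text \<open>Drop from each cycle edge the vertex it passes on to the next edge. That vertex remains
  covered, as the next edge keeps it, so k - 1 vertices per edge cover everything.\<close>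

lemma cycle_Union_bound:
  assumes "is_cycle H vs es" "uniform k H"
  shows "card (\<Union> (set es)) \<le> card (set es) * (k - 1)"
proof -
  let ?n = "length vs"
  note c = is_cycleD[OF assms(1)]
  note e = uniformD[OF assms(2) c(8)]
  let ?A = "\<lambda>i. es ! i - {vs ! (Suc i mod ?n)}"
  have "\<Union> (set es) \<subseteq> (\<Union>i<?n. ?A i)"
  proof
    fix x assume "x \<in> \<Union> (set es)"
    then obtain i where i: "i < ?n" "x \<in> es ! i" using c(1) by (auto simp: in_set_conv_nth)
    show "x \<in> (\<Union>i<?n. ?A i)"
    proof (cases "x = vs ! (Suc i mod ?n)")
      case True
      let ?j = "Suc i mod ?n"
      have "0 < ?n" using i by linarith
      then have j: "?j < ?n" by simp
      moreover have "vs ! (Suc ?j mod ?n) \<noteq> vs ! ?j"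
        using Suc_mod_neq[OF c(2) j] nth_eq_iff_index_eq[OF c(3) mod_less_divisor[OF \<open>0 < ?n\<close>] j] by blast
      ultimately have "x \<in> ?A ?j" using True c(6)[OF j] by auto
      then show ?thesis using j by blast
    qed (use i in auto)
  qed
  then have "card (\<Union> (set es)) \<le> card (\<Union>i<?n. ?A i)"
    by (intro card_mono) (use e in auto)
  also have "\<dots> \<le> (\<Sum>i<?n. card (?A i))" by (rule card_UN_le) simp
  also have "\<dots> = (\<Sum>i<?n. k - 1)" using c(7) e by (intro sum.cong refl) simp
  finally show ?thesis using c(1,4) by (simp add: distinct_card)
qed

text \<open>A set of hyperedges covering at most k - 1 vertices per member exists, namely the edges
  of the cycle. A hyperedge that meets the covered set adds at most k - 1 new vertices, so a largest
  such set covers a set closed under adjacency, and by connectedness all vertices.\<close>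

lemma connected_cycle_nverts_bound:
  assumes "uniform k H" "2 \<le> k" "connected_hg H" "is_cycle H vs es"
  shows "nverts H \<le> card (hedges H) * (k - 1)"
proof -
  let ?P = "\<lambda>S. S \<subseteq> hedges H \<and> S \<noteq> {} \<and> card (\<Union> S) \<le> card S * (k - 1)"
  have finE: "finite (hedges H)" by (rule finite_hedges[OF assms(1)])
  have c: "set es \<subseteq> hedges H" "set es \<noteq> {}" using assms(4) by (auto simp: is_cycle_def)
  then have "?P (set es)" using cycle_Union_bound[OF assms(4,1)] by simp
  moreover have "\<forall>S. ?P S \<longrightarrow> card S < Suc (card (hedges H))" using finE by (auto intro: card_mono simp: less_Suc_eq_le)
  ultimately have "\<exists>S. ?P S \<and> (\<forall>S'. ?P S' \<longrightarrow> card S' \<le> card S)" by (rule ex_has_greatest_nat[of ?P _ card])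
  then obtain S where S: "?P S" and max: "\<And>S'. ?P S' \<Longrightarrow> card S' \<le> card S" by blast
  note ef = uniformD[OF assms(1)]
  have finS: "finite S" using S finE by (meson finite_subset)
  have finU: "finite (\<Union> S)" using S ef finE by (meson finite_Union finite_subset subsetD)
  obtain e0 where e0: "e0 \<in> S" using S by blast
  then obtain u where u: "u \<in> e0" using ef[of e0] S assms(2) by (metis card.empty ex_in_conv not_numeral_le_zero subsetD)
  have "verts H \<subseteq> \<Union> S"
  proof (rule connected_closed_set[OF assms(3)])
    show "u \<in> \<Union> S" "u \<in> verts H" using u e0 S ef by auto
    fix e x y assume e: "e \<in> hedges H" and xy: "x \<in> e" "y \<in> e" "x \<in> \<Union> S"
    show "y \<in> \<Union> S"
    proof (rule ccontr)
      assume "y \<notin> \<Union> S"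
      then have "e \<notin> S" using xy by blast
      have "\<Union> (insert e S) = \<Union> S \<union> (e - {x})" using xy by auto
      then have "card (\<Union> (insert e S)) \<le> card (\<Union> S) + card (e - {x})" by (simp add: card_Un_le)
      also have "\<dots> \<le> card S * (k - 1) + (k - 1)" using S ef[OF e] xy by simp
      also have "\<dots> = card (insert e S) * (k - 1)"
        using \<open>e \<notin> S\<close> finS by simp
      finally have "?P (insert e S)" using S e by simp
      then have "card (insert e S) \<le> card S" by (rule max)
      then show False using \<open>e \<notin> S\<close> finS by simp
    qed
  qed
  then have "nverts H \<le> card (\<Union> S)" using card_mono[OF finU, of "verts H"] by (simp add: verts_def)
  also have "\<dots> \<le> card S * (k - 1)" using S by simp
  also have "\<dots> \<le> card (hedges H) * (k - 1)" using S finE by (intro mult_right_mono card_mono) auto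
  finally show ?thesis .
qed

text \<open>The bound m k \<le> n + m from having one cycle only and the bound n \<le> m (k - 1)
  from being connected with a cycle meet.\<close>

lemma linear_unicyclic_nverts:
  assumes "H \<in> linear_unicyclic k m" "2 \<le> k"
  shows "nverts H = m * (k - 1)"
proof -
  have H: "uniform k H" "unicyclic H" "connected_hg H" "card (hedges H) = m"
    using assms by (auto simp: linear_unicyclic_def unicyclic_def)
  obtain vs es where "is_cycle H vs es" using H(2) by (auto simp: unicyclic_def)
  from connected_cycle_nverts_bound[OF H(1) assms(2) H(3) this]
  have "nverts H \<le> m * (k - 1)" using H(4) by simp
  moreover have "m * k \<le> nverts H + m"
    using unicyclic_incidence_bound[OF H(1) assms(2) H(2)] H(4) by simp
  ultimately show ?thesis by (simp add: diff_mult_distrib2)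
qed

section \<open>Hypergraphs whose non-cored vertices lie on a cycle\<close>

lemma Suc_mod_inj: "p < n \<Longrightarrow> q < n \<Longrightarrow> Suc p mod n = Suc q mod n \<Longrightarrow> p = q" for n :: nat
  by (cases "Suc p = n"; cases "Suc q = n") auto

lemma Suc_mod_pred:
  assumes "a < n" "2 \<le> n"
  obtains b where "b < n" "b \<noteq> a" "Suc b mod n = a"
proof (cases a)
  case 0
  then show thesis using that[of "n - 1"] assms by simp
next
  case (Suc b)
  then show thesis using that[of b] assms by simp
qed

text \<open>The hypothesis \<open>3 \<le> n\<close> matters: for n = 2 both pairs are {0,
  1}.\<close>

lemma cyclic_pair_inj:
  fixes n :: nat
  assumes "3 \<le> n" "i < n" "j < n" "{i, Suc i mod n} = {j, Suc j mod n}"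
  shows "i = j"
proof (rule ccontr)
  assume "i \<noteq> j"
  then have "i = Suc j mod n" "Suc i mod n = j" using assms(4) by (auto simp: doubleton_eq_iff)
  then show False using assms(1-3) by (cases "Suc j = n"; cases "Suc i = n") auto
qed

lemma cycle_pred_edge:
  assumes "is_cycle H vs es" "a < length vs"
  obtains b where "b < length vs" "b \<noteq> a" "Suc b mod length vs = a" "vs ! a \<in> es ! b" "es ! b \<noteq> es ! a"
proof -
  note c = is_cycleD[OF assms(1)]
  obtain b where b: "b < length vs" "b \<noteq> a" "Suc b mod length vs = a"
    using Suc_mod_pred[OF assms(2) c(2)] .
  moreover have "vs ! a \<in> es ! b" using c(7)[OF b(1)] b(3) by simp
  moreover have "es ! b \<noteq> es ! a" using nth_eq_iff_index_eq[OF c(4), of b a] b assms(2) c(1) by simp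
  ultimately show thesis by (rule that)
qed

lemma two_edges_degree:
  assumes "finite (hedges H)" "e \<in> hedges H" "f \<in> hedges H" "e \<noteq> f" "v \<in> e" "v \<in> f"
  shows "2 \<le> hdegree H v"
proof -
  have "card {e, f} \<le> hdegree H v"
    unfolding hdegree_def using assms by (intro card_mono) auto
  then show ?thesis using assms(4) by simp
qed

lemma cycle_degree:
  assumes "finite (hedges H)" "is_cycle H vs es" "v \<in> set vs"
  shows "2 \<le> hdegree H v"
proof -
  note c = is_cycleD[OF assms(2)]
  obtain a where a: "a < length vs" "v = vs ! a" using assms(3) by (metis in_set_conv_nth)
  obtain b where b: "b < length vs" "vs ! a \<in> es ! b" "es ! b \<noteq> es ! a"
    using cycle_pred_edge[OF assms(2) a(1)] .
  show ?thesis
    unfolding a(2) using two_edges_degree[OF assms(1) c(8)[OF b(1)] c(8)[OF a(1)] b(3,2) c(6)[OF a(1)]] .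
qed

text \<open>An intrinsic description of a cycle with pendant hyperedges at its vertices. It makes no
  reference to a numbering of the vertices, so it applies to the constructed hypergraphs and to
  arbitrary competitors alike.\<close>

definition core_cycle :: "nat \<Rightarrow> hypergraph \<Rightarrow> nat list \<Rightarrow> nat set list \<Rightarrow> bool" where
  "core_cycle k H vs es \<longleftrightarrow> uniform k H \<and> 2 \<le> k \<and> 3 \<le> length vs \<and> is_cycle H vs es \<and>
     (\<forall>e\<in>hedges H. card (e \<inter> set vs) = (if e \<in> set es then 2 else 1)) \<and>
     (\<forall>v\<in>verts H - set vs. hdegree H v = 1)"

text \<open>The positions on the cycle that a hyperedge touches. Positions rather than vertices are
  recorded so that hyperedges of two hypergraphs can be matched.\<close>

definition edge_label :: "'a list \<Rightarrow> 'a set \<Rightarrow> nat set" where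
  "edge_label vs e = {i. i < length vs \<and> vs ! i \<in> e}"

lemma finite_edge_label: "finite (edge_label vs e)"
  unfolding edge_label_def by simp

lemma image_edge_label: "(!) vs ` edge_label vs e = e \<inter> set vs"
  by (auto simp: edge_label_def in_set_conv_nth)

lemma card_edge_label: "distinct vs \<Longrightarrow> card (edge_label vs e) = card (e \<inter> set vs)"
  using card_image[of "(!) vs" "edge_label vs e"] image_edge_label[of vs e]
  by (simp add: inj_on_nth edge_label_def)

text \<open>Used twice for the isomorphism: to match hyperedges with the same label, then to match
  cored vertices lying in corresponding hyperedges.\<close>

lemma fibre_bij:
  assumes "finite A" "finite B" and fib: "\<And>L. card {a \<in> A. t a = L} = card {b \<in> B. t' b = L}"
  shows "\<exists>s. bij_betw s A B \<and> (\<forall>a\<in>A. t' (s a) = t a)"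
proof -
  have "\<forall>L. \<exists>h. bij_betw h {a \<in> A. t a = L} {b \<in> B. t' b = L}"
    using assms by (intro allI finite_same_card_bij) auto
  then obtain h where h: "\<And>L. bij_betw (h L) {a \<in> A. t a = L} {b \<in> B. t' b = L}" by metis
  define s where "s a = h (t a) a" for a
  have mem: "s a \<in> B \<and> t' (s a) = t a" if "a \<in> A" for a
    using bij_betwE[OF h[of "t a"]] that by (auto simp: s_def)
  have "bij_betw s A B"
    unfolding bij_betw_def
  proof
    show "inj_on s A"
    proof
      fix a a' assume a: "a \<in> A" "a' \<in> A" "s a = s a'"
      then have t: "t a = t a'" using mem[of a] mem[of a'] by simp
      show "a = a'"
        by (rule inj_onD[OF bij_betw_imp_inj_on[OF h[of "t a"]]]) (use a t in \<open>auto simp: s_def\<close>)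
    qed
    show "s ` A = B"
    proof
      show "s ` A \<subseteq> B" using mem by blast
      show "B \<subseteq> s ` A"
      proof
        fix b assume "b \<in> B"
        then have "b \<in> h (t' b) ` {a \<in> A. t a = t' b}"
          using bij_betw_imp_surj_on[OF h[of "t' b"]] by simp
        then obtain a where a: "a \<in> A" "t a = t' b" "b = h (t' b) a" by blast
        then have "b = s a" by (simp add: s_def)
        then show "b \<in> s ` A" using a(1) by blast
      qed
    qed
  qed
  then show ?thesis using mem by blast
qed

context
  fixes k H vs es
  assumes core: "core_cycle k H vs es"
begin

lemma core_uniform: "uniform k H" and core_k: "2 \<le> k" and core_length: "3 \<le> length vs"
  and core_is_cycle: "is_cycle H vs es"
  using core by (auto simp: core_cycle_def)

lemma core_inter: "e \<in> hedges H \<Longrightarrow> card (e \<inter> set vs) = (if e \<in> set es then 2 else 1)"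
  and core_degree: "v \<in> verts H \<Longrightarrow> v \<notin> set vs \<Longrightarrow> hdegree H v = 1"
  using core by (auto simp: core_cycle_def)

lemmas core_cycleD = is_cycleD[OF core_is_cycle]
lemmas core_uniformD = uniformD[OF core_uniform]

lemma core_subset_verts: "set vs \<subseteq> verts H"
proof
  fix v assume "v \<in> set vs"
  then obtain i where "i < length vs" "v = vs ! i" by (metis in_set_conv_nth)
  then show "v \<in> verts H" using core_cycleD(6,8) core_uniformD(3) by blast
qed

lemma edge_label_cycle:
  assumes "i < length vs"
  shows "edge_label vs (es ! i) = {i, Suc i mod length vs}"
proof -
  have i': "Suc i mod length vs < length vs" using assms by (intro mod_less_divisor) linarith
  have "es ! i \<in> set es" using assms core_cycleD(1) by simp
  then have "card (edge_label vs (es ! i)) = 2"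
    using core_inter core_cycleD(8)[OF assms] card_edge_label[OF core_cycleD(3)] by simp
  moreover have "{i, Suc i mod length vs} \<subseteq> edge_label vs (es ! i)"
    using core_cycleD(6,7)[OF assms] assms i' by (simp add: edge_label_def)
  moreover have "card {i, Suc i mod length vs} = 2"
    using Suc_mod_neq[OF core_cycleD(2) assms] by simp
  ultimately show ?thesis using card_seteq[OF finite_edge_label] by (metis order_refl)
qed

lemma edge_label_pair_iff:
  assumes "i < length vs" "e \<in> hedges H"
  shows "edge_label vs e = {i, Suc i mod length vs} \<longleftrightarrow> e = es ! i"
proof
  assume L: "edge_label vs e = {i, Suc i mod length vs}"
  then have "card (e \<inter> set vs) = 2"
    using Suc_mod_neq[OF core_cycleD(2) assms(1)] card_edge_label[OF core_cycleD(3), of e] by simp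
  then have "e \<in> set es" using core_inter[OF assms(2)] by (simp split: if_splits)
  then obtain j where j: "j < length vs" "e = es ! j" using core_cycleD(1) by (metis in_set_conv_nth)
  then have "{i, Suc i mod length vs} = {j, Suc j mod length vs}" using L edge_label_cycle[OF j(1)] by simp
  then show "e = es ! i" using cyclic_pair_inj[OF core_length assms(1) j(1)] j(2) by simp
qed (simp add: edge_label_cycle assms(1))

lemma edge_label_cases:
  assumes "e \<in> hedges H"
  obtains i where "i < length vs" "e = es ! i" "edge_label vs e = {i, Suc i mod length vs}"
  | i where "i < length vs" "e \<notin> set es" "edge_label vs e = {i}"
proof (cases "e \<in> set es")
  case True
  then obtain j where j: "j < length vs" "e = es ! j" using core_cycleD(1) by (metis in_set_conv_nth)
  then show thesis using that(1) edge_label_cycle[OF j(1)] by simp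
next
  case False
  then have "card (edge_label vs e) = 1"
    using core_inter[OF assms] card_edge_label[OF core_cycleD(3), of e] by simp
  then obtain i where i: "edge_label vs e = {i}" by (metis card_1_singletonE)
  then have "i \<in> edge_label vs e" by simp
  then have "i < length vs" by (simp add: edge_label_def)
  then show thesis using that(2) False i by blast
qed

lemma card_label_pair:
  assumes "i < length vs"
  shows "card {e \<in> hedges H. edge_label vs e = {i, Suc i mod length vs}} = 1"
proof -
  have "{e \<in> hedges H. edge_label vs e = {i, Suc i mod length vs}} = {es ! i}"
    using edge_label_pair_iff[OF assms] core_cycleD(8)[OF assms] by blast
  then show ?thesis by simp
qed

text \<open>The hyperedges through \<open>vs ! i\<close> are pendant ones and the cycle edges at
  that position. The number of the latter is left as an expression in \<open>i\<close> and
  \<open>length vs\<close>, which is the same for two hypergraphs under comparison.\<close>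

lemma card_label_single:
  assumes "i < length vs"
  shows "card {e \<in> hedges H. edge_label vs e = {i}}
    = hdegree H (vs ! i) - card {j. j < length vs \<and> (i = j \<or> i = Suc j mod length vs)}"
proof -
  let ?J = "{j. j < length vs \<and> (i = j \<or> i = Suc j mod length vs)}"
  let ?P = "{e \<in> hedges H. edge_label vs e = {i}}"
  have mem: "vs ! i \<in> e \<longleftrightarrow> i \<in> edge_label vs e" for e using assms by (simp add: edge_label_def)
  have "{e \<in> hedges H. vs ! i \<in> e} = ?P \<union> (!) es ` ?J"
  proof (intro Set.set_eqI iffI)
    fix e assume "e \<in> {e \<in> hedges H. vs ! i \<in> e}"
    then have e: "e \<in> hedges H" "i \<in> edge_label vs e" using mem by auto
    show "e \<in> ?P \<union> (!) es ` ?J"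
      by (rule edge_label_cases[OF e(1)]) (use e in auto)
  next
    fix e assume "e \<in> ?P \<union> (!) es ` ?J"
    then show "e \<in> {e \<in> hedges H. vs ! i \<in> e}"
    proof
      assume "e \<in> ?P"
      then show ?thesis using mem by auto
    next
      assume "e \<in> (!) es ` ?J"
      then obtain j where j: "j < length vs" "i = j \<or> i = Suc j mod length vs" "e = es ! j" by blast
      then show ?thesis using core_cycleD(6-8)[OF j(1)] by auto
    qed
  qed
  moreover have "?P \<inter> (!) es ` ?J = {}"
  proof -
    have "edge_label vs (es ! j) \<noteq> {i}" if "j < length vs" for j
    proof
      assume "edge_label vs (es ! j) = {i}"
      with edge_label_cycle[OF that] have "{j, Suc j mod length vs} = {i}" by (rule trans[OF sym])
      then have "Suc j mod length vs = j" by blast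
      then show False using Suc_mod_neq[OF core_cycleD(2) that] by blast
    qed
    then show ?thesis by auto
  qed
  moreover have "finite ?P" using finite_hedges[OF core_uniform] by simp
  moreover have "card ((!) es ` ?J) = card ?J"
    using core_cycleD(1,4) by (intro card_image inj_on_nth) auto
  ultimately have "hdegree H (vs ! i) = card ?P + card ?J"
    unfolding hdegree_def by (simp add: card_Un_disjoint)
  then show ?thesis by simp
qed

lemma label_none:
  assumes "\<And>i. i < length vs \<Longrightarrow> L \<noteq> {i, Suc i mod length vs}" "\<And>i. i < length vs \<Longrightarrow> L \<noteq> {i}"
  shows "{e \<in> hedges H. edge_label vs e = L} = {}"
proof -
  have "edge_label vs e \<noteq> L" if "e \<in> hedges H" for e
    by (rule edge_label_cases[OF that]) (use assms in auto)
  then show ?thesis by blast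
qed

definition cored_edge :: "nat \<Rightarrow> nat set" where
  "cored_edge v = the_elem {e \<in> hedges H. v \<in> e}"

lemma cored_edge:
  assumes "v \<in> verts H" "v \<notin> set vs"
  shows "{e \<in> hedges H. v \<in> e} = {cored_edge v}"
proof -
  have "card {e \<in> hedges H. v \<in> e} = 1" using core_degree[OF assms] by (simp add: hdegree_def)
  then obtain e where "{e \<in> hedges H. v \<in> e} = {e}" by (metis card_1_singletonE)
  then show ?thesis by (simp add: cored_edge_def)
qed

lemma cored_edge_iff:
  assumes "v \<in> verts H" "v \<notin> set vs" "e \<in> hedges H"
  shows "cored_edge v = e \<longleftrightarrow> v \<in> e"
  using cored_edge[OF assms(1,2)] assms(3) by auto

lemma card_cored_fibre:
  assumes "e \<in> hedges H"
  shows "card {v \<in> verts H - set vs. cored_edge v = e} = k - card (edge_label vs e)"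
proof -
  have "{v \<in> verts H - set vs. cored_edge v = e} = e - set vs"
    using cored_edge_iff assms core_uniformD(3)[OF assms] by auto
  moreover have "card (e - set vs) = card e - card (e \<inter> set vs)"
    using core_uniformD(1)[OF assms] by (intro card_Diff_subset_Int) simp
  ultimately show ?thesis
    using core_uniformD(2)[OF assms] card_edge_label[OF core_cycleD(3), of e] by simp
qed

text \<open>Shared vertices have degree at least 2 and lie on the cycle. Two hyperedges sharing two
  of them are cycle edges with the same label, and the label determines a cycle edge.\<close>

lemma core_linear: "linear_hg H"
  unfolding linear_hg_def
proof (intro ballI impI, rule ccontr)
  fix e f assume e: "e \<in> hedges H" and f: "f \<in> hedges H" and ne: "e \<noteq> f" and "\<not> card (e \<inter> f) \<le> 1"
  then have two: "2 \<le> card (e \<inter> f)" by simp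
  have fin: "finite e" "finite f" using core_uniformD(1) e f by auto
  have sub: "e \<inter> f \<subseteq> set vs"
  proof
    fix v assume "v \<in> e \<inter> f"
    then have v: "v \<in> e" "v \<in> f" by auto
    then have "2 \<le> hdegree H v" using two_edges_degree[OF finite_hedges[OF core_uniform] e f ne] by simp
    then show "v \<in> set vs" using core_degree[of v] core_uniformD(3)[OF e] v by fastforce
  qed
  have inter: "g \<inter> set vs = e \<inter> f \<and> g \<in> set es" if "g \<in> {e, f}" for g
  proof -
    have g: "g \<in> hedges H" "e \<inter> f \<subseteq> g \<inter> set vs" "finite (g \<inter> set vs)" using that e f sub fin by auto
    then have "2 \<le> card (g \<inter> set vs)" using card_mono[OF g(3,2)] two by simp
    then have ges: "g \<in> set es" "card (g \<inter> set vs) = 2" using core_inter[OF g(1)] by (auto split: if_splits)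
    then show ?thesis using card_seteq[OF g(3,2)] two by simp
  qed
  have lab: "edge_label vs g = {i. i < length vs \<and> vs ! i \<in> g \<inter> set vs}" for g
    by (auto simp: edge_label_def)
  have "edge_label vs e = edge_label vs f" unfolding lab using inter by auto
  moreover obtain i where i: "i < length vs" "e = es ! i"
    using inter[of e] core_cycleD(1) by (metis in_set_conv_nth insertI1)
  ultimately have "edge_label vs f = {i, Suc i mod length vs}" using edge_label_cycle by simp
  then have "f = es ! i" using edge_label_pair_iff[OF i(1) f] by simp
  then show False using ne i(2) by simp
qed

text \<open>Every hyperedge meets the cycle, so a vertex reaches the cycle in one step and then
  \<open>vs ! 0\<close> by going backwards along it.\<close>

lemma core_connected: "connected_hg H"
proof -
  let ?R = "{(x, y). \<exists>e\<in>hedges H. x \<in> e \<and> y \<in> e}"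
  have "sym ?R" by (auto simp: sym_def)
  then have symR: "sym (?R\<^sup>*)" by (rule sym_rtrancl)
  have "0 < length vs" using core_length by linarith
  have cyc: "(vs ! i, vs ! 0) \<in> ?R\<^sup>*" if "i < length vs" for i
    using that
  proof (induction i)
    case (Suc i)
    then have i: "i < length vs" by simp
    have "vs ! Suc i \<in> es ! i" using core_cycleD(7)[OF i] Suc.prems by simp
    then have "(vs ! Suc i, vs ! i) \<in> ?R" using core_cycleD(6,8)[OF i] by blast
    then show ?case using Suc.IH[OF i] by (rule converse_rtrancl_into_rtrancl)
  qed simp
  have all: "(v, vs ! 0) \<in> ?R\<^sup>*" if v: "v \<in> verts H" for v
  proof (cases "v \<in> set vs")
    case True
    then obtain i where "i < length vs" "v = vs ! i" by (metis in_set_conv_nth)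
    then show ?thesis using cyc[of i] by simp
  next
    case False
    then have e: "cored_edge v \<in> hedges H" "v \<in> cored_edge v" using cored_edge[OF v] by auto
    have "card (cored_edge v \<inter> set vs) \<noteq> 0" using core_inter[OF e(1)] by simp
    then have "cored_edge v \<inter> set vs \<noteq> {}" by (metis card.empty)
    then obtain u where u: "u \<in> cored_edge v" "u \<in> set vs" by blast
    then obtain i where i: "i < length vs" "u = vs ! i" by (metis in_set_conv_nth)
    have "(v, vs ! i) \<in> ?R" using e u i by blast
    then show ?thesis using cyc[OF i(1)] by (rule converse_rtrancl_into_rtrancl)
  qed
  show ?thesis unfolding connected_hg_def
  proof (intro ballI)
    fix u v assume "u \<in> verts H" "v \<in> verts H"
    then have "(u, vs ! 0) \<in> ?R\<^sup>*" "(vs ! 0, v) \<in> ?R\<^sup>*" using all symD[OF symR] by blast+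
    then show "(u, v) \<in> ?R\<^sup>*" by (rule rtrancl_trans)
  qed
qed

text \<open>Every cycle stays inside the core; as all core vertices have just two core edges, it cannot stop
  before it has used all of them.\<close>

lemma core_cycle_unique:
  assumes "is_cycle H us fs"
  shows "set us = set vs" "cycle_flags us fs = {(v, e). e \<in> set es \<and> v \<in> e \<and> v \<in> set vs}"
proof -
  note c = is_cycleD[OF assms]
  let ?g = "length vs" and ?l = "length us"
  have l0: "0 < ?l" "0 < ?g" using c(2) core_length by linarith+
  have nxt: "Suc a mod ?l < ?l" for a using l0 by simp
  have us_core: "us ! a \<in> set vs" if "a < ?l" for a
  proof (rule ccontr)
    assume "us ! a \<notin> set vs"
    moreover have "us ! a \<in> verts H" using core_uniformD(3)[OF c(8)[OF that]] c(6)[OF that] by blast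
    ultimately have "hdegree H (us ! a) = 1" using core_degree by blast
    then show False using cycle_degree[OF finite_hedges[OF core_uniform] assms, of "us ! a"] that by simp
  qed
  have fs_core: "fs ! a \<in> set es \<and> fs ! a \<inter> set vs = {us ! a, us ! (Suc a mod ?l)}" if a: "a < ?l" for a
  proof -
    have ne: "us ! a \<noteq> us ! (Suc a mod ?l)"
      using Suc_mod_neq[OF c(2) a] nth_eq_iff_index_eq[OF c(3) a nxt] by metis
    have sub: "{us ! a, us ! (Suc a mod ?l)} \<subseteq> fs ! a \<inter> set vs"
      using c(6,7)[OF a] us_core[OF a] us_core[OF nxt[of a]] by blast
    have fin: "finite (fs ! a \<inter> set vs)" by simp
    have "2 \<le> card (fs ! a \<inter> set vs)" using card_mono[OF fin sub] ne by simp
    then have *: "fs ! a \<in> set es" "card (fs ! a \<inter> set vs) = 2"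
      using core_inter[OF c(8)[OF a]] by (auto split: if_splits)
    then show ?thesis using card_seteq[OF fin sub] ne by simp
  qed
  have step: "es ! i \<in> set fs \<and> vs ! (Suc i mod ?g) \<in> set us" if i: "i < ?g" and "vs ! i \<in> set us" for i
  proof -
    obtain a where a: "a < ?l" "vs ! i = us ! a" using \<open>vs ! i \<in> set us\<close> by (metis in_set_conv_nth)
    obtain b where b: "b < ?l" "us ! a \<in> fs ! b" "fs ! b \<noteq> fs ! a"
      using cycle_pred_edge[OF assms a(1)] .
    obtain p where p: "p < ?g" "fs ! a = es ! p"
      using fs_core[OF a(1)] core_cycleD(1) by (metis in_set_conv_nth)
    obtain q where q: "q < ?g" "fs ! b = es ! q"
      using fs_core[OF b(1)] core_cycleD(1) by (metis in_set_conv_nth)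
    have "i \<in> edge_label vs (es ! p)" "i \<in> edge_label vs (es ! q)"
      using i a(2) b(2) c(6)[OF a(1)] p(2) q(2) by (simp_all add: edge_label_def)
    then have "i \<in> {p, Suc p mod ?g}" "i \<in> {q, Suc q mod ?g}"
      using edge_label_cycle[OF p(1)] edge_label_cycle[OF q(1)] by simp_all
    moreover have "p \<noteq> q" using b(3) p(2) q(2) by auto
    \<comment> \<open>The cycle edges at \<open>vs ! i\<close> are \<open>es ! i\<close> and its
      predecessor. The other cycle uses two distinct hyperedges there, so one of them is
      \<open>es ! i\<close>.\<close>
    ultimately have "i = p \<or> i = q" using Suc_mod_inj[OF p(1) q(1)] by auto
    then obtain d where d: "d < ?l" "es ! i = fs ! d" using p(2) q(2) a(1) b(1) by auto
    have "vs ! (Suc i mod ?g) \<in> es ! i \<inter> set vs" using core_cycleD(7)[OF i] l0 by simp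
    then have "vs ! (Suc i mod ?g) \<in> {us ! d, us ! (Suc d mod ?l)}" using fs_core[OF d(1)] d(2) by simp
    then have "vs ! (Suc i mod ?g) \<in> set us" using d(1) nxt[of d] by auto
    moreover have "es ! i \<in> set fs" using d c(1) by simp
    ultimately show ?thesis by blast
  qed
  obtain i0 where i0: "i0 < ?g" "us ! 0 = vs ! i0" using us_core[OF l0(1)] by (metis in_set_conv_nth)
  have walk: "vs ! ((i0 + t) mod ?g) \<in> set us" for t
  proof (induction t)
    case 0
    then show ?case using i0 l0(1) nth_mem[of 0 us] by simp
  next
    case (Suc t)
    have "(i0 + t) mod ?g < ?g" using l0 by simp
    from step[OF this Suc] show ?case by (simp add: mod_Suc_eq)
  qed
  have all: "vs ! i \<in> set us" if "i < ?g" for i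
  proof -
    have "(i0 + (?g - i0 + i)) mod ?g = i" using i0(1) that by simp
    then show ?thesis using walk[of "?g - i0 + i"] by simp
  qed
  show "set us = set vs"
  proof
    show "set us \<subseteq> set vs" using us_core by (auto simp: in_set_conv_nth)
    show "set vs \<subseteq> set us" using all by (auto simp: in_set_conv_nth)
  qed
  show "cycle_flags us fs = {(v, e). e \<in> set es \<and> v \<in> e \<and> v \<in> set vs}"
  proof
    show "cycle_flags us fs \<subseteq> {(v, e). e \<in> set es \<and> v \<in> e \<and> v \<in> set vs}"
    proof
      fix x assume "x \<in> cycle_flags us fs"
      then obtain a where a: "a < ?l" "x = (us ! a, fs ! a) \<or> x = (us ! (Suc a mod ?l), fs ! a)"
        by (auto simp: cycle_flags_def)
      then show "x \<in> {(v, e). e \<in> set es \<and> v \<in> e \<and> v \<in> set vs}"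
        using fs_core[OF a(1)] by blast
    qed
    show "{(v, e). e \<in> set es \<and> v \<in> e \<and> v \<in> set vs} \<subseteq> cycle_flags us fs"
    proof clarify
      fix v e assume e: "e \<in> set es" and v: "v \<in> e" "v \<in> set vs"
      obtain i where i: "i < ?g" "e = es ! i" using e core_cycleD(1) by (metis in_set_conv_nth)
      then have "e \<in> set fs" using step[OF i(1) all[OF i(1)]] by simp
      then obtain d where d: "d < ?l" "e = fs ! d" using c(1) by (metis in_set_conv_nth)
      then have "v = us ! d \<or> v = us ! (Suc d mod ?l)" using fs_core[OF d(1)] v by blast
      then show "(v, e) \<in> cycle_flags us fs" using d by (auto simp: cycle_flags_def)
    qed
  qed
qed

lemma core_unicyclic: "unicyclic H"
proof -
  let ?F = "{(v, e). e \<in> set es \<and> v \<in> e \<and> v \<in> set vs}"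
  have "\<exists>!F. \<exists>us fs. is_cycle H us fs \<and> F = cycle_flags us fs"
  proof (rule ex1I[of _ ?F])
    show "\<exists>us fs. is_cycle H us fs \<and> ?F = cycle_flags us fs"
      by (intro exI conjI) (rule core_is_cycle, rule core_cycle_unique(2)[OF core_is_cycle, symmetric])
    fix F assume "\<exists>us fs. is_cycle H us fs \<and> F = cycle_flags us fs"
    then obtain us fs where us: "is_cycle H us fs" "F = cycle_flags us fs" by (elim exE conjE)
    show "F = ?F" unfolding us(2) by (rule core_cycle_unique(2)[OF us(1)])
  qed
  then show ?thesis using core_connected by (simp add: unicyclic_def)
qed

lemma core_girth: "girth H = length vs"
  unfolding girth_def
proof (rule Least_equality)
  show "\<exists>us fs. is_cycle H us fs \<and> length us = length vs" using core_is_cycle by blast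
  fix l assume "\<exists>us fs. is_cycle H us fs \<and> length us = l"
  then obtain us fs where us: "is_cycle H us fs" "length us = l" by blast
  have "card (set us) = length us" "card (set vs) = length vs"
    using is_cycleD(3)[OF us(1)] core_cycleD(3) by (simp_all add: distinct_card)
  then show "length vs \<le> l" using core_cycle_unique(1)[OF us(1)] us(2) by simp
qed

end

text \<open>Cycle vertices are matched by position, hyperedges by label and cored vertices by their
  hyperedge. The degrees on the cycle fix how many pendant hyperedges sit at each position, so
  corresponding fibres have equal size.\<close>

lemma core_cycle_isomorphic:
  assumes H: "core_cycle k H vs es" and K: "core_cycle k K us fs" and len: "length us = length vs"
    and deg: "\<And>i. i < length vs \<Longrightarrow> hdegree H (vs ! i) = hdegree K (us ! i)"
  shows "H \<cong>\<^sub>h K"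
proof -
  let ?g = "length vs"
  have dvs: "distinct vs" and dus: "distinct us" using core_cycleD(3) H K by blast+
  have fibE: "card {e \<in> hedges H. edge_label vs e = L} = card {e \<in> hedges K. edge_label us e = L}" for L
  proof -
    show ?thesis
    proof (cases "\<exists>i<?g. L = {i, Suc i mod ?g}")
      case True
      then show ?thesis using card_label_pair[OF H] card_label_pair[OF K] len by auto
    next
      case notpair: False
      show ?thesis
      proof (cases "\<exists>i<?g. L = {i}")
        case True
        then show ?thesis using card_label_single[OF H] card_label_single[OF K] len deg by auto
      next
        case False
        have "{e \<in> hedges H. edge_label vs e = L} = {}"
          by (rule label_none[OF H]) (use notpair False in auto)
        moreover have "{e \<in> hedges K. edge_label us e = L} = {}"
          by (rule label_none[OF K]) (use notpair False len in auto)
        ultimately show ?thesis by (simp only:)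
      qed
    qed
  qed
  obtain s where s: "bij_betw s (hedges H) (hedges K)"
    and lab: "\<And>e. e \<in> hedges H \<Longrightarrow> edge_label us (s e) = edge_label vs e"
    using fibre_bij[OF finite_hedges[OF core_uniform[OF H]] finite_hedges[OF core_uniform[OF K]] fibE]
    by blast
  have sK: "s e \<in> hedges K" if "e \<in> hedges H" for e using bij_betwE[OF s] that by blast
  let ?cH = "cored_edge H" and ?cK = "cored_edge K"
  let ?A = "verts H - set vs" and ?B = "verts K - set us"
  have cH: "?cH v \<in> hedges H" "v \<in> ?cH v" if "v \<in> ?A" for v
    using cored_edge[OF H, of v] that by auto
  have cK: "?cK v \<in> hedges K" "v \<in> ?cK v" if "v \<in> ?B" for v
    using cored_edge[OF K, of v] that by auto
  have fibV: "card {v \<in> ?A. s (?cH v) = L} = card {v \<in> ?B. ?cK v = L}" for L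
  proof (cases "L \<in> hedges K")
    case True
    then have "L \<in> s ` hedges H" using bij_betw_imp_surj_on[OF s] by simp
    then obtain e where e: "e \<in> hedges H" "s e = L" by (elim imageE) simp
    have "{v \<in> ?A. s (?cH v) = L} = {v \<in> ?A. ?cH v = e}"
      using e cH(1) bij_betw_imp_inj_on[OF s] by (auto dest: inj_onD)
    then show ?thesis
      using card_cored_fibre[OF H e(1)] card_cored_fibre[OF K True] lab[OF e(1)] e(2) by simp
  next
    case False
    then have "{v \<in> ?A. s (?cH v) = L} = {}" "{v \<in> ?B. ?cK v = L} = {}" using sK cH cK by auto
    then show ?thesis by (simp only:)
  qed
  have finAB: "finite ?A" "finite ?B" by (simp_all add: verts_def)
  obtain f1 where f1: "bij_betw f1 ?A ?B" and f1c: "\<And>v. v \<in> ?A \<Longrightarrow> ?cK (f1 v) = s (?cH v)"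
    using fibre_bij[OF finAB fibV] by blast
  let ?ix = "the_inv_into {..<?g} ((!) vs)"
  let ?f0 = "(!) us \<circ> ?ix"
  have bvs: "bij_betw ((!) vs) {..<?g} (set vs)" using bij_betw_nth[OF dvs] by simp
  have bus: "bij_betw ((!) us) {..<?g} (set us)" using bij_betw_nth[OF dus] len by simp
  have f0: "bij_betw ?f0 (set vs) (set us)"
    using bij_betw_trans[OF bij_betw_the_inv_into[OF bvs] bus] .
  have f0i: "?f0 (vs ! i) = us ! i" if "i < ?g" for i
    using the_inv_into_f_f[OF bij_betw_imp_inj_on[OF bvs]] that by simp
  define f where "f v = (if v \<in> set vs then ?f0 v else f1 v)" for v
  have "bij_betw f (set vs) (set us)" using f0 by (rule bij_betw_cong[THEN iffD1, rotated]) (simp add: f_def)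
  moreover have "bij_betw f ?A ?B" using f1 by (rule bij_betw_cong[THEN iffD1, rotated]) (simp add: f_def)
  ultimately have "bij_betw f (set vs \<union> ?A) (set us \<union> ?B)" by (rule bij_betw_combine) auto
  moreover have "set vs \<union> ?A = verts H" "set us \<union> ?B = verts K"
    using core_subset_verts[OF H] core_subset_verts[OF K] by auto
  ultimately have f: "bij_betw f (verts H) (verts K)" by simp
  \<comment> \<open>Inclusion suffices, since both sides have k elements.\<close>
  have img: "f ` e = s e" if e: "e \<in> hedges H" for e
  proof (rule card_subset_eq)
    show "finite (s e)" using uniformD(1)[OF core_uniform[OF K] sK[OF e]] .
    show "f ` e \<subseteq> s e"
    proof
      fix y assume "y \<in> f ` e"
      then obtain v where v: "v \<in> e" "y = f v" by blast
      show "y \<in> s e"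
      proof (cases "v \<in> set vs")
        case True
        then obtain i where i: "i < ?g" "v = vs ! i" by (metis in_set_conv_nth)
        then have "i \<in> edge_label us (s e)" using lab[OF e] v(1) by (simp add: edge_label_def)
        then show ?thesis using v(2) True i f0i[OF i(1)] by (simp add: f_def edge_label_def)
      next
        case False
        then have vA: "v \<in> ?A" using v(1) uniformD(3)[OF core_uniform[OF H] e] by blast
        then have "f1 v \<in> ?B" using bij_betwE[OF f1] by blast
        then have "f1 v \<in> ?cK (f1 v)" by (rule cK(2))
        moreover have "?cH v = e" using cored_edge_iff[OF H _ _ e, of v] vA v(1) by blast
        ultimately show ?thesis using f1c[OF vA] v(2) False by (simp add: f_def)
      qed
    qed
    have "inj_on f e"
      using bij_betw_imp_inj_on[OF f] uniformD(3)[OF core_uniform[OF H] e] by (rule inj_on_subset)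
    then show "card (f ` e) = card (s e)"
      using uniformD(2)[OF core_uniform[OF H] e] uniformD(2)[OF core_uniform[OF K] sK[OF e]]
      by (simp add: card_image)
  qed
  have "(`) f ` hedges H = s ` hedges H" using img by (rule image_cong[OF refl])
  then show ?thesis
    unfolding isomorphic_hg_def using f bij_betw_imp_surj_on[OF s] by auto
qed

section \<open>Recognising a cycle with pendant hyperedges\<close>

lemma linear_cycle_length:
  assumes "uniform k H" "linear_hg H" "is_cycle H vs es"
  shows "3 \<le> length vs"
proof (rule ccontr)
  note c = is_cycleD[OF assms(3)]
  assume "\<not> 3 \<le> length vs"
  then have l: "length vs = 2" using c(2) by simp
  have ne: "es ! 0 \<noteq> es ! 1" "vs ! 0 \<noteq> vs ! 1"
    using nth_eq_iff_index_eq[OF c(4), of 0 1] nth_eq_iff_index_eq[OF c(3), of 0 1] c(1) l by simp_all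
  have "{vs ! 0, vs ! 1} \<subseteq> es ! 0 \<inter> es ! 1"
    using c(6)[of 0] c(7)[of 0] c(6)[of 1] c(7)[of 1] l by simp
  moreover have "finite (es ! 0 \<inter> es ! 1)"
    using uniformD(1)[OF assms(1) c(8)[of 0]] l by simp
  ultimately have "card {vs ! 0, vs ! 1} \<le> card (es ! 0 \<inter> es ! 1)" by (intro card_mono)
  moreover have "card (es ! 0 \<inter> es ! 1) \<le> 1"
    using assms(2) c(8)[of 0] c(8)[of 1] ne(1) l unfolding linear_hg_def by simp
  ultimately show False using ne(2) by simp
qed

lemma linear_unicyclicD:
  assumes "H \<in> linear_unicyclic k m"
  shows "uniform k H" "linear_hg H" "unicyclic H" "connected_hg H" "card (hedges H) = m"
  using assms by (auto simp: linear_unicyclic_def unicyclic_def)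

lemma cycle_subset_verts:
  assumes "uniform k H" "is_cycle H vs es"
  shows "set vs \<subseteq> verts H"
proof
  fix v assume "v \<in> set vs"
  then obtain i where "i < length vs" "v = vs ! i" by (metis in_set_conv_nth)
  then show "v \<in> verts H" using is_cycleD(6,8)[OF assms(2)] uniformD(3)[OF assms(1)] by blast
qed

lemma connected_cycle_degree_pos:
  assumes "uniform k H" "connected_hg H" "is_cycle H vs es" "v \<in> verts H"
  shows "0 < hdegree H v"
proof -
  note c = is_cycleD[OF assms(3)]
  have l: "0 < length vs" using c(2) by linarith
  have "verts H \<subseteq> \<Union> (hedges H)"
  proof (rule connected_closed_set[OF assms(2)])
    show "vs ! 0 \<in> \<Union> (hedges H)" using c(6,8)[OF l] by blast
    show "vs ! 0 \<in> verts H" using cycle_subset_verts[OF assms(1,3)] l by auto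
  qed blast
  then obtain e where "e \<in> hedges H" "v \<in> e" using assms(4) by blast
  then have "{e \<in> hedges H. v \<in> e} \<noteq> {}" by blast
  then show ?thesis using finite_hedges[OF assms(1)] by (simp add: hdegree_def card_gt_0_iff)
qed

text \<open>Double counting of the incidences on the cycle: every cycle edge meets the cycle in at least two
  vertices and every other edge in at least one, and the edge count leaves no room for more.\<close>

lemma core_cycleI:
  assumes H: "H \<in> linear_unicyclic k m" "2 \<le> k" and cyc: "is_cycle H vs es"
    and cored: "\<And>v. v \<in> verts H \<Longrightarrow> v \<notin> set vs \<Longrightarrow> hdegree H v = 1"
  shows "core_cycle k H vs es"
proof -
  note D = linear_unicyclicD[OF H(1)] and c = is_cycleD[OF cyc]
  have finE: "finite (hedges H)" by (rule finite_hedges[OF D(1)])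
  have finV: "finite (verts H)" by (simp add: verts_def)
  have sub: "set vs \<subseteq> verts H" by (rule cycle_subset_verts[OF D(1) cyc])
  let ?b = "\<lambda>e. if e \<in> set es then 2 else (1::nat)"
  \<comment> \<open>A hyperedge off the cycle would have only cored vertices, hence be a component
    of its own, although the cycle has further vertices.\<close>
  have meets: "e \<inter> set vs \<noteq> {}" if e: "e \<in> hedges H" for e
  proof
    assume none: "e \<inter> set vs = {}"
    have "e \<noteq> {}" using uniformD(2)[OF D(1) e] H(2) by auto
    then obtain u where u: "u \<in> e" by blast
    have "verts H \<subseteq> e"
    proof (rule connected_closed_set[OF D(4) u])
      show "u \<in> verts H" using uniformD(3)[OF D(1) e] u by blast
      fix f x y assume f: "f \<in> hedges H" and xy: "x \<in> f" "y \<in> f" "x \<in> e"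
      have "x \<in> verts H" "x \<notin> set vs" using uniformD(3)[OF D(1) e] xy(3) none by auto
      then have "hdegree H x = 1" by (rule cored)
      then have "f = e" using two_edges_degree[OF finE f e _ xy(1,3)] by fastforce
      then show "y \<in> e" using xy by simp
    qed
    moreover have "vs ! 0 \<in> set vs" using c(2) by (intro nth_mem) linarith
    ultimately show False using sub none by blast
  qed
  have le: "?b e \<le> card (e \<inter> set vs)" if e: "e \<in> hedges H" for e
  proof (cases "e \<in> set es")
    case True
    then obtain i where i: "i < length vs" "e = es ! i" using c(1) by (metis in_set_conv_nth)
    have i': "Suc i mod length vs < length vs" using i(1) by (intro mod_less_divisor) linarith
    have ne: "vs ! i \<noteq> vs ! (Suc i mod length vs)"
      using Suc_mod_neq[OF c(2) i(1)] nth_eq_iff_index_eq[OF c(3) i(1) i'] by simp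
    have "{vs ! i, vs ! (Suc i mod length vs)} \<subseteq> e \<inter> set vs"
      using c(6,7)[OF i(1)] i nth_mem[OF i'] by simp
    then have "card {vs ! i, vs ! (Suc i mod length vs)} \<le> card (e \<inter> set vs)"
      by (intro card_mono) simp_all
    then show ?thesis using True ne by simp
  next
    case False
    have "0 < card (e \<inter> set vs)" using meets[OF e] by (simp add: card_gt_0_iff)
    then show ?thesis using False by simp
  qed
  have "(\<Sum>v\<in>verts H. hdegree H v) = (\<Sum>v\<in>set vs. hdegree H v) + (\<Sum>v\<in>verts H - set vs. hdegree H v)"
    using sum.subset_diff[OF sub finV, of "hdegree H"] by simp
  moreover have "(\<Sum>v\<in>verts H - set vs. hdegree H v) = nverts H - length vs"
    using cored sub distinct_card[OF c(3)] by (simp add: card_Diff_subset verts_def)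
  moreover have "length vs \<le> nverts H"
    using card_mono[OF finV sub] distinct_card[OF c(3)] by (simp add: verts_def)
  moreover have "m * k = m * (k - 1) + m" using H(2) by (simp add: algebra_simps diff_mult_distrib2)
  ultimately have "(\<Sum>v\<in>set vs. hdegree H v) = m + length vs"
    using handshake[OF D(1), unfolded D(5)] linear_unicyclic_nverts[OF H] by linarith
  then have "(\<Sum>e\<in>hedges H. card (e \<inter> set vs)) = m + length vs"
    using sum_hdegree[OF finE, of "set vs"] by simp
  also have "\<dots> = sum ?b (hedges H)"
  proof -
    have "sum ?b (hedges H) = (\<Sum>e\<in>hedges H. 1 + (if e \<in> set es then 1 else 0))"
      by (rule sum.cong) auto
    also have "\<dots> = m + card (hedges H \<inter> set es)"
      unfolding sum.distrib using finE D(5) by (simp add: sum.If_cases)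
    also have "hedges H \<inter> set es = set es" using c(5) by blast
    finally show ?thesis using distinct_card[OF c(4)] c(1) by simp
  qed
  finally have eq: "sum ?b (hedges H) = (\<Sum>e\<in>hedges H. card (e \<inter> set vs))" ..
  have "card (e \<inter> set vs) = ?b e" if "e \<in> hedges H" for e
    using sum_mono_inv[OF eq le that finE] by simp
  then show ?thesis
    unfolding core_cycle_def
    using D H(2) linear_cycle_length[OF D(1,2) cyc] cyc cored by simp
qed

lemma core_cycle_linear_unicyclic:
  assumes "core_cycle k H vs es"
  shows "H \<in> linear_unicyclic k (card (hedges H))"
  using core_uniform[OF assms] core_linear[OF assms] core_unicyclic[OF assms]
  by (simp add: linear_unicyclic_def)

section \<open>The hypercycle and its extensions by pendant hyperedges\<close>

lemma card_cycle_neighbours: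
  assumes "i < n" "2 \<le> n"
  shows "card {j. j < n \<and> (i = j \<or> i = Suc j mod n)} = 2"
proof -
  obtain b where b: "b < n" "b \<noteq> i" "Suc b mod n = i" using Suc_mod_pred[OF assms] .
  have "{j. j < n \<and> (i = j \<or> i = Suc j mod n)} = {i, b}"
  proof
    show "{j. j < n \<and> (i = j \<or> i = Suc j mod n)} \<subseteq> {i, b}"
    proof
      fix j assume "j \<in> {j. j < n \<and> (i = j \<or> i = Suc j mod n)}"
      then have "j < n" "i = j \<or> Suc j mod n = Suc b mod n" using b(3) by auto
      then show "j \<in> {i, b}" using Suc_mod_inj[of j n b] b(1) by blast
    qed
    show "{i, b} \<subseteq> {j. j < n \<and> (i = j \<or> i = Suc j mod n)}" using assms(1) b by simp
  qed
  then show ?thesis using b(2) by simp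
qed

lemma image_unique_member:
  assumes "\<And>i. i \<in> I \<Longrightarrow> v \<in> F i \<longleftrightarrow> i = j" "j \<in> I"
  shows "{e \<in> F ` I. v \<in> e} = {F j}"
  using assms by auto

definition hypercycle_edges :: "nat \<Rightarrow> nat \<Rightarrow> nat set list" where
  "hypercycle_edges k g =
     map (\<lambda>i. {i, Suc i mod g} \<union> {g + i * (k - 2)..<g + Suc i * (k - 2)}) [0..<g]"

lemma core_cycle_hypercycle:
  assumes "2 \<le> k" "3 \<le> g"
  shows "core_cycle k (hypercycle k g) [0..<g] (hypercycle_edges k g)"
    and "card (hedges (hypercycle k g)) = g"
    and "\<And>i. i < g \<Longrightarrow> hdegree (hypercycle k g) i = 2"
proof -
  let ?ce = "\<lambda>i. {i, Suc i mod g} \<union> {g + i * (k - 2)..<g + Suc i * (k - 2)}"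
  let ?H = "hypercycle k g"
  have E: "hedges ?H = ?ce ` {..<g}" and V: "verts ?H = {0..<g + g * (k - 2)}"
    by (simp_all only: hypercycle_def hypergraph.sel verts_def)
  have md: "Suc i mod g < g" for i using assms(2) by (intro mod_less_divisor) linarith
  have g2: "2 \<le> g" using assms(2) by simp
  have core: "?ce i \<inter> {..<g} = {i, Suc i mod g}" if "i < g" for i
    using that md[of i] by auto
  have inj: "inj_on ?ce {..<g}"
  proof
    fix i j assume ij: "i \<in> {..<g}" "j \<in> {..<g}" "?ce i = ?ce j"
    then have "{i, Suc i mod g} = {j, Suc j mod g}" using core[of i] core[of j] by simp
    then show "i = j" using cyclic_pair_inj[OF assms(2)] ij by simp
  qed
  show cE: "card (hedges ?H) = g" unfolding E using card_image[OF inj] by simp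
  have mem: "i \<in> ?ce j \<longleftrightarrow> i = j \<or> i = Suc j mod g" if "i < g" for i j using that by auto
  show deg: "hdegree ?H i = 2" if "i < g" for i
  proof -
    have set: "{e \<in> hedges ?H. i \<in> e} = ?ce ` {j. j < g \<and> (i = j \<or> i = Suc j mod g)}"
      unfolding E using mem[OF that] by blast
    have "inj_on ?ce {j. j < g \<and> (i = j \<or> i = Suc j mod g)}"
      by (rule inj_on_subset[OF inj]) auto
    from card_image[OF this] show ?thesis
      unfolding hdegree_def set card_cycle_neighbours[OF that g2] .
  qed
  have disj: "{a, b} \<inter> {g + c..<d} = {}" if "a < g" "b < g" for a b c d :: nat using that by auto
  have cc: "card (?ce i) = k" "?ce i \<subseteq> verts ?H" if i: "i < g" for i
  proof -
    have "card (?ce i) = card {i, Suc i mod g} + card {g + i * (k - 2)..<g + Suc i * (k - 2)}"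
      by (rule card_Un_disjoint[OF _ _ disj[OF i md]]) simp_all
    then show "card (?ce i) = k" using Suc_mod_neq[OF g2 i] assms(1) by simp
    have "Suc i * (k - 2) \<le> g * (k - 2)" using i by (intro mult_le_mono1) simp
    moreover have "{i, Suc i mod g} \<subseteq> verts ?H"
      unfolding V using trans_less_add1[OF i, of "g * (k - 2)"] trans_less_add1[OF md[of i], of "g * (k - 2)"] by simp
    moreover have "{g + i * (k - 2)..<g + Suc i * (k - 2)} \<subseteq> {0..<g + g * (k - 2)}"
      using calculation(1) by (intro subsetI, unfold atLeastLessThan_iff) linarith
    ultimately show "?ce i \<subseteq> verts ?H" unfolding V by (intro Un_least) simp_all
  qed
  have unif: "uniform k ?H" unfolding uniform_def E using cc by blast
  have es: "length (hypercycle_edges k g) = g" "set (hypercycle_edges k g) = hedges ?H"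
    "distinct (hypercycle_edges k g)" "\<And>i. i < g \<Longrightarrow> hypercycle_edges k g ! i = ?ce i"
    unfolding hypercycle_edges_def E using inj by (auto simp: distinct_map lessThan_atLeast0 simp del: mult_Suc)
  have cyc: "is_cycle ?H [0..<g] (hypercycle_edges k g)"
    unfolding is_cycle_def using es g2 md by simp
  have inter: "card (e \<inter> set [0..<g]) = 2" if e: "e \<in> hedges ?H" for e
  proof -
    obtain i where i: "i < g" "e = ?ce i" using e unfolding E by blast
    have "e \<inter> set [0..<g] = {i, Suc i mod g}" using core[OF i(1)] i(2) by (simp add: lessThan_atLeast0)
    then show ?thesis using Suc_mod_neq[OF g2 i(1)] by simp
  qed
  have noncore: "hdegree ?H v = 1" if v: "v \<in> verts ?H" "v \<notin> set [0..<g]" for v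
  proof -
    have vg: "g \<le> v" "v < g + g * (k - 2)" using v unfolding V by auto
    \<comment> \<open>An inserted vertex exists, so k > 2 and division by the block length
      \<open>k - 2\<close> makes sense; the quotient \<open>?j\<close> is the number of the block
      containing \<open>v\<close>.\<close>
    then have k: "0 < k - 2" by (cases "k - 2") auto
    let ?j = "(v - g) div (k - 2)"
    have j: "?j < g" using vg k by (simp add: less_mult_imp_div_less)
    have memj: "v \<in> ?ce i \<longleftrightarrow> i = ?j" if "i \<in> {..<g}" for i
    proof
      assume "v \<in> ?ce i"
      then have "g + i * (k - 2) \<le> v" "v < g + Suc i * (k - 2)"
        using vg(1) that md[of i] by auto
      then have "(k - 2) * i \<le> v - g" "v - g < (k - 2) * Suc i" using vg(1) by (simp_all add: mult.commute)
      then show "i = ?j" by (intro div_nat_eqI[symmetric])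
    next
      assume i: "i = ?j"
      have "i * (k - 2) \<le> v - g" unfolding i by (rule div_times_less_eq_dividend)
      moreover have "v - g < Suc i * (k - 2)" unfolding i mult_Suc by (rule dividend_less_div_times[OF k])
      ultimately show "v \<in> ?ce i" using vg(1) by (auto simp del: mult_Suc)
    qed
    have "{e \<in> hedges ?H. v \<in> e} = {?ce ?j}"
      unfolding E using j by (intro image_unique_member memj) simp_all
    then show ?thesis unfolding hdegree_def by simp
  qed
  show "core_cycle k ?H [0..<g] (hypercycle_edges k g)"
    unfolding core_cycle_def using unif assms cyc inter noncore es(2) by simp
qed

lemma core_cycle_add_pendant:
  assumes H: "core_cycle k H vs es" and v: "v \<in> set vs"
  shows "core_cycle k (add_pendant k v H) vs es"
    and "card (hedges (add_pendant k v H)) = Suc (card (hedges H))"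
    and "\<And>u. u \<in> set vs \<Longrightarrow> hdegree (add_pendant k v H) u = hdegree H u + (if u = v then 1 else 0)"
proof -
  let ?n = "nverts H" and ?H = "add_pendant k v H"
  let ?N = "insert v {?n..<?n + (k - 1)}"
  have E: "hedges ?H = insert ?N (hedges H)" and V: "verts ?H = {0..<?n + (k - 1)}"
    by (simp_all add: add_pendant_def verts_def)
  have k: "2 \<le> k" by (rule core_k[OF H])
  have vn: "v < ?n" using core_subset_verts[OF H] v by (auto simp: verts_def)
  note U = uniformD[OF core_uniform[OF H]]
  have finE: "finite (hedges H)" by (rule finite_hedges[OF core_uniform[OF H]])
  have old: "u < ?n" if "e \<in> hedges H" "u \<in> e" for e u using U(3)[OF that(1)] that(2) by (auto simp: verts_def)
  have N: "?N \<notin> hedges H"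
  proof
    assume "?N \<in> hedges H"
    moreover have "?n \<in> ?N" using k by (intro insertI2, unfold atLeastLessThan_iff) linarith
    ultimately have "?n < ?n" by (rule old)
    then show False by simp
  qed
  show "card (hedges ?H) = Suc (card (hedges H))" unfolding E using N finE by simp
  have degold: "hdegree ?H u = hdegree H u + (if u = v then 1 else 0)" if u: "u < ?n" for u
  proof -
    have "{e \<in> hedges ?H. u \<in> e} = {e \<in> hedges H. u \<in> e} \<union> (if u = v then {?N} else {})"
      unfolding E using u by auto
    then show ?thesis unfolding hdegree_def using N finE by (auto simp: card_Un_disjoint)
  qed
  show "hdegree ?H u = hdegree H u + (if u = v then 1 else 0)" if "u \<in> set vs" for u
    using degold core_subset_verts[OF H] that by (auto simp: verts_def)
  have "card ?N = k" using vn k by simp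
  then have unif: "uniform k ?H"
    unfolding uniform_def E V using U(2) old vn by fastforce
  have "set es \<subseteq> hedges H" using core_cycleD(5)[OF H] .
  then have cyc: "is_cycle ?H vs es" and Nes: "?N \<notin> set es"
    using core_is_cycle[OF H] N unfolding is_cycle_def E by auto
  have "?N \<inter> set vs = {v}" using core_subset_verts[OF H] v by (auto simp: verts_def)
  then have inter: "card (e \<inter> set vs) = (if e \<in> set es then 2 else 1)" if "e \<in> hedges ?H" for e
    using that core_inter[OF H] Nes unfolding E by auto
  have noncore: "hdegree ?H u = 1" if u: "u \<in> verts ?H" "u \<notin> set vs" for u
  proof (cases "u < ?n")
    case True
    then show ?thesis using degold[OF True] core_degree[OF H, of u] u(2) v by (auto simp: verts_def)
  next
    case False
    then have "{e \<in> hedges ?H. u \<in> e} = {?N}" unfolding E using u(1) old unfolding V by auto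
    then show ?thesis by (simp add: hdegree_def)
  qed
  show "core_cycle k ?H vs es"
    unfolding core_cycle_def using unif k core_length[OF H] cyc inter noncore by simp
qed

lemma core_cycle_add_pendants:
  assumes H: "core_cycle k H vs es" and v: "v \<in> set vs"
  shows "core_cycle k ((add_pendant k v ^^ p) H) vs es"
    and "card (hedges ((add_pendant k v ^^ p) H)) = card (hedges H) + p"
    and "\<And>u. u \<in> set vs \<Longrightarrow> hdegree ((add_pendant k v ^^ p) H) u = hdegree H u + (if u = v then p else 0)"
proof -
  have "core_cycle k ((add_pendant k v ^^ p) H) vs es
      \<and> card (hedges ((add_pendant k v ^^ p) H)) = card (hedges H) + p
      \<and> (\<forall>u\<in>set vs. hdegree ((add_pendant k v ^^ p) H) u = hdegree H u + (if u = v then p else 0))"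
  proof (induction p)
    case (Suc p)
    then show ?case using core_cycle_add_pendant[of k "(add_pendant k v ^^ p) H" vs es v] v by simp
  qed (simp add: H)
  then show "core_cycle k ((add_pendant k v ^^ p) H) vs es"
    "card (hedges ((add_pendant k v ^^ p) H)) = card (hedges H) + p"
    "\<And>u. u \<in> set vs \<Longrightarrow> hdegree ((add_pendant k v ^^ p) H) u = hdegree H u + (if u = v then p else 0)"
    by simp_all
qed

lemma core_cycle_cycle_star:
  assumes "2 \<le> k" "3 \<le> g"
  shows "core_cycle k (cycle_star k g p) [0..<g] (hypercycle_edges k g)"
    and "card (hedges (cycle_star k g p)) = g + p"
    and "\<And>i. i < g \<Longrightarrow> hdegree (cycle_star k g p) i = 2 + (if i = 0 then p else 0)"
proof -
  have "0 \<in> set [0..<g]" using assms(2) by simp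
  note P = core_cycle_add_pendants[OF core_cycle_hypercycle(1)[OF assms] this, where p = p]
  show "core_cycle k (cycle_star k g p) [0..<g] (hypercycle_edges k g)"
    "card (hedges (cycle_star k g p)) = g + p"
    "\<And>i. i < g \<Longrightarrow> hdegree (cycle_star k g p) i = 2 + (if i = 0 then p else 0)"
    using P core_cycle_hypercycle(2,3)[OF assms] by (simp_all add: cycle_star_def)
qed

lemma core_cycle_triangle_pendants:
  assumes "2 \<le> k"
  shows "core_cycle k (triangle_pendants k n1 n2 n3) [0..<3] (hypercycle_edges k 3)"
    and "card (hedges (triangle_pendants k n1 n2 n3)) = 3 + n1 + n2 + n3"
    and "\<And>i. i < 3 \<Longrightarrow> hdegree (triangle_pendants k n1 n2 n3) i = 2 + (if i = 0 then n1 else if i = 1 then n2 else n3)"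
proof -
  have "(0::nat) \<in> set [0..<3]" "(1::nat) \<in> set [0..<3]" "(2::nat) \<in> set [0..<3]" by simp_all
  note v = this
  note H0 = core_cycle_hypercycle[OF assms, of 3, simplified]
  note H1 = core_cycle_add_pendants[OF H0(1) v(1), where p = n1]
  note H2 = core_cycle_add_pendants[OF H1(1) v(2), where p = n2]
  note H3 = core_cycle_add_pendants[OF H2(1) v(3), where p = n3]
  show "core_cycle k (triangle_pendants k n1 n2 n3) [0..<3] (hypercycle_edges k 3)"
    unfolding triangle_pendants_def by (rule H3(1))
  show "card (hedges (triangle_pendants k n1 n2 n3)) = 3 + n1 + n2 + n3"
    unfolding triangle_pendants_def using H3(2) H2(2) H1(2) H0(2) by simp
  fix i :: nat assume i: "i < 3"
  then have "i \<in> set [0..<3]" by simp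
  then show "hdegree (triangle_pendants k n1 n2 n3) i = 2 + (if i = 0 then n1 else if i = 1 then n2 else n3)"
    unfolding triangle_pendants_def using H3(3) H2(3) H1(3) H0(3)[OF i] i by auto
qed

section \<open>Sums of squared degrees\<close>

lemma nat_sum_all:
  fixes y :: "'a \<Rightarrow> nat"
  assumes "finite A" "v \<in> A" "y v = sum y A" "u \<in> A" "u \<noteq> v"
  shows "y u = 0"
proof -
  have "sum y A = y v + sum y (A - {v})" using assms(1,2) by (simp add: sum.remove)
  then have "sum y (A - {v}) = 0" using assms(3) by simp
  then show ?thesis using assms(1,4,5) by simp
qed

lemma sum_squares_le_max:
  fixes y :: "'a \<Rightarrow> nat"
  assumes "\<And>v. v \<in> A \<Longrightarrow> y v \<le> b"
  shows "(\<Sum>v\<in>A. (y v)\<^sup>2) \<le> b * sum y A"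
  unfolding sum_distrib_left power2_eq_square by (intro sum_mono mult_le_mono1 assms)

text \<open>\<open>A\<close> stands for the vertices, \<open>C\<close> for those on the cycle,
  \<open>y\<close> for the excess. The sum of squares is at most s^2 and the excess on
  \<open>C\<close> at most s. Equality in the first puts everything at one vertex, equality in the
  second puts that vertex into \<open>C\<close>.\<close>

lemma sum_squares_concentrated:
  fixes y :: "'a \<Rightarrow> nat"
  assumes fin: "finite A" and C: "C \<subseteq> A" "C \<noteq> {}" and s: "sum y A = s"
  shows "(\<Sum>v\<in>A. (y v)\<^sup>2) + 2 * sum y C \<le> s\<^sup>2 + 2 * s"
    and "s\<^sup>2 + 2 * s \<le> (\<Sum>v\<in>A. (y v)\<^sup>2) + 2 * sum y C \<Longrightarrow> \<exists>v\<in>C. y v = s"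
proof -
  have le: "y v \<le> s" if "v \<in> A" for v using member_le_sum[of v A y] that fin s by simp
  have sq: "(\<Sum>v\<in>A. (y v)\<^sup>2) \<le> s\<^sup>2" using sum_squares_le_max[of A y s] le s by (simp add: power2_eq_square)
  have sC: "sum y C \<le> s" using sum_mono2[OF fin C(1), of y] s by simp
  show "(\<Sum>v\<in>A. (y v)\<^sup>2) + 2 * sum y C \<le> s\<^sup>2 + 2 * s" using sq sC by simp
  assume "s\<^sup>2 + 2 * s \<le> (\<Sum>v\<in>A. (y v)\<^sup>2) + 2 * sum y C"
  then have eq: "s\<^sup>2 \<le> (\<Sum>v\<in>A. (y v)\<^sup>2)" "sum y C = s" using sq sC by linarith+
  show "\<exists>v\<in>C. y v = s"
  proof (cases "s = 0")
    case True
    then have "\<forall>v\<in>A. y v = 0" using s fin by simp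
    then show ?thesis using C True by blast
  next
    case False
    have "\<exists>v\<in>A. y v = s"
    proof (rule ccontr)
      assume none: "\<not> (\<exists>v\<in>A. y v = s)"
      have "y v \<le> s - 1" if "v \<in> A" for v
      proof -
        have "y v \<noteq> s" using none that by blast
        then show ?thesis using le[OF that] by linarith
      qed
      then have "(\<Sum>v\<in>A. (y v)\<^sup>2) \<le> (s - 1) * s" using sum_squares_le_max[of A y "s - 1"] s by simp
      also have "\<dots> < s\<^sup>2" using False by (simp add: power2_eq_square)
      finally show False using eq(1) by simp
    qed
    then obtain v where v: "v \<in> A" "y v = s" by blast
    have "v \<in> C"
    proof (rule ccontr)
      assume "v \<notin> C"
      have "y u = 0" if "u \<in> C" for u
        using nat_sum_all[of A v y u] fin v s that C(1) \<open>v \<notin> C\<close> by auto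
      then show False using eq(2) False by simp
    qed
    then show ?thesis using v(2) by blast
  qed
qed

text \<open>The largest excess decides. If it is s, it sits outside \<open>C\<close> and the term 2
  s is lost; if it is s - 1, a single unit is elsewhere, and equality forces both vertices into
  \<open>C\<close>; if it is at most s - 2, the squares sum to at most (s - 2) s, less than (s -
  1)^2 + 1.\<close>

lemma sum_squares_spread:
  fixes y :: "'a \<Rightarrow> nat"
  assumes fin: "finite A" and C: "C \<subseteq> A" "C \<noteq> {}" and s: "sum y A = s" "2 \<le> s"
    and none: "\<And>v. v \<in> C \<Longrightarrow> y v \<noteq> s"
  shows "(\<Sum>v\<in>A. (y v)\<^sup>2) + 2 * sum y C \<le> (s - 1)\<^sup>2 + 1 + 2 * s"
    and "(s - 1)\<^sup>2 + 1 + 2 * s \<le> (\<Sum>v\<in>A. (y v)\<^sup>2) + 2 * sum y C \<Longrightarrow>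
      \<exists>a\<in>C. \<exists>b\<in>C. a \<noteq> b \<and> y a = s - 1 \<and> y b = 1"
proof -
  obtain r where r: "s = r + 2" using s(2) by (metis add.commute le_Suc_ex)
  have le: "y v \<le> s" if "v \<in> A" for v using member_le_sum[of v A y] that fin s by simp
  have sC: "sum y C \<le> s" using sum_mono2[OF fin C(1), of y] s by simp
  let ?X = "(\<Sum>v\<in>A. (y v)\<^sup>2) + 2 * sum y C" and ?B = "(s - 1)\<^sup>2 + 1 + 2 * s"
  have goal: "?X < ?B \<or> ?X \<le> ?B \<and> (sum y C = s \<longrightarrow> (\<exists>a\<in>C. \<exists>b\<in>C. a \<noteq> b \<and> y a = s - 1 \<and> y b = 1))
      \<and> (sum y C < s \<longrightarrow> ?X < ?B)"
  proof (cases "\<exists>v\<in>A. y v = s")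
    case True
    then obtain v where v: "v \<in> A" "y v = s" by blast
    then have "v \<notin> C" using none by blast
    have "y u = 0" if "u \<in> C" for u
      using nat_sum_all[of A v y u] fin v s that C(1) \<open>v \<notin> C\<close> by auto
    then have "sum y C = 0" by simp
    moreover have "(\<Sum>v\<in>A. (y v)\<^sup>2) \<le> s * s" using sum_squares_le_max[of A y s] le s by simp
    moreover have "s * s < (s - 1)\<^sup>2 + 1 + 2 * s" unfolding r by (simp add: power2_eq_square)
    ultimately show ?thesis by linarith
  next
    case False
    have less: "y v \<le> s - 1" if "v \<in> A" for v
    proof -
      have "y v \<noteq> s" using False that by blast
      then show ?thesis using le[OF that] by linarith
    qed
    show ?thesis
    proof (cases "\<exists>a\<in>A. y a = s - 1")
      case True
      then obtain a where a: "a \<in> A" "y a = s - 1" by blast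
      have "sum y A = y a + sum y (A - {a})" using fin a(1) by (simp add: sum.remove)
      then have "sum y (A - {a}) = Suc 0" using a(2) s by linarith
      then obtain b where b: "b \<in> A - {a}" "y b = Suc 0" "\<And>u. u \<in> A - {a} \<Longrightarrow> b \<noteq> u \<Longrightarrow> y u = 0"
        using sum_eq_Suc0_iff[of "A - {a}" y] fin by auto
      have "(\<Sum>v\<in>A. (y v)\<^sup>2) = (y a)\<^sup>2 + (\<Sum>v\<in>A - {a}. (y v)\<^sup>2)" using fin a(1) by (simp add: sum.remove)
      also have "(\<Sum>v\<in>A - {a}. (y v)\<^sup>2) \<le> 1 * sum y (A - {a})"
      proof (rule sum_squares_le_max)
        fix v assume "v \<in> A - {a}"
        then show "y v \<le> 1" using b(2) b(3)[of v] by (cases "b = v") auto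
      qed
      finally have "(\<Sum>v\<in>A. (y v)\<^sup>2) \<le> (s - 1)\<^sup>2 + 1"
        using a(2) \<open>sum y (A - {a}) = Suc 0\<close> by simp
      moreover have "\<exists>a\<in>C. \<exists>b\<in>C. a \<noteq> b \<and> y a = s - 1 \<and> y b = 1" if "sum y C = s"
      proof -
        have "sum y A = sum y C + sum y (A - C)" using sum.subset_diff[OF C(1) fin, of y] by simp
        then have "sum y (A - C) = 0" using that s(1) by simp
        then have off: "y v = 0" if "v \<in> A" "v \<notin> C" for v using fin that by simp
        have "a \<in> C" using off[OF a(1)] a(2) s(2) by (cases "a \<in> C") auto
        moreover have "b \<in> C" using off[of b] b(1,2) by (cases "b \<in> C") auto
        ultimately show ?thesis using a(2) b(1,2) by (intro bexI[of _ a] bexI[of _ b]) auto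
      qed
      moreover have "?X < ?B" if "sum y C < s"
        using that \<open>(\<Sum>v\<in>A. (y v)\<^sup>2) \<le> (s - 1)\<^sup>2 + 1\<close> by linarith
      ultimately show ?thesis using sC by simp
    next
      case False
      have "y v \<le> s - 2" if "v \<in> A" for v
      proof -
        have "y v \<noteq> s - 1" using False that by blast
        then show ?thesis using less[OF that] by linarith
      qed
      then have "(\<Sum>v\<in>A. (y v)\<^sup>2) \<le> (s - 2) * s" using sum_squares_le_max[of A y "s - 2"] s by simp
      also have "\<dots> < (s - 1)\<^sup>2 + 1" unfolding r by (simp add: power2_eq_square)
      finally show ?thesis using sC by linarith
    qed
  qed
  then show "?X \<le> ?B" by linarith
  assume "?B \<le> ?X"
  then show "\<exists>a\<in>C. \<exists>b\<in>C. a \<noteq> b \<and> y a = s - 1 \<and> y b = 1"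
    using goal sC by linarith
qed

section \<open>Degrees as excess over a cycle\<close>

definition degree_square_sum :: "hypergraph \<Rightarrow> nat" where
  "degree_square_sum H = (\<Sum>v\<in>verts H. (hdegree H v)\<^sup>2)"

text \<open>The subtraction does not truncate at vertices of a linear unicyclic hypergraph when
  \<open>vs\<close> is a cycle: every degree is at least 1, and at least 2 on the cycle.\<close>

definition excess :: "hypergraph \<Rightarrow> nat list \<Rightarrow> nat \<Rightarrow> nat" where
  "excess H vs v = hdegree H v - (if v \<in> set vs then 2 else 1)"

lemma degree_excess:
  assumes H: "H \<in> linear_unicyclic k m" "2 \<le> k" and cyc: "is_cycle H vs es"
  shows "\<And>v. v \<in> verts H \<Longrightarrow> hdegree H v = (if v \<in> set vs then 2 else 1) + excess H vs v"
    and "length vs \<le> m"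
    and "sum (excess H vs) (verts H) = m - length vs"
    and "degree_square_sum H = m * (k - 1) + 3 * length vs + 2 * (m - length vs)
      + ((\<Sum>v\<in>verts H. (excess H vs v)\<^sup>2) + 2 * sum (excess H vs) (set vs))"
proof -
  note D = linear_unicyclicD[OF H(1)] and c = is_cycleD[OF cyc]
  let ?y = "excess H vs" and ?V = "verts H" and ?g = "length vs"
  let ?c = "\<lambda>v. if v \<in> set vs then 2 else (1::nat)"
  have finE: "finite (hedges H)" by (rule finite_hedges[OF D(1)])
  have finV: "finite ?V" by (simp add: verts_def)
  have sub: "set vs \<subseteq> ?V" by (rule cycle_subset_verts[OF D(1) cyc])
  show deg: "hdegree H v = ?c v + ?y v" if "v \<in> ?V" for v
    using connected_cycle_degree_pos[OF D(1,4) cyc that] cycle_degree[OF finE cyc, of v]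
    by (cases "v \<in> set vs") (simp_all add: excess_def)
  have "card (set es) \<le> m" using card_mono[OF finE c(5)] D(5) by simp
  then show gm: "?g \<le> m" using distinct_card[OF c(4)] c(1) by simp
  have ind: "(\<Sum>v\<in>?V. if v \<in> set vs then f v else (0::nat)) = sum f (set vs)" for f
  proof -
    have "?V \<inter> set vs = set vs" using sub by blast
    then show ?thesis using finV by (simp add: sum.If_cases)
  qed
  have cg: "card (set vs) = ?g" using distinct_card[OF c(3)] .
  have n: "card ?V = m * (k - 1)" using linear_unicyclic_nverts[OF H] by (simp add: verts_def)
  have mk: "m * k = m * (k - 1) + m" using H(2) by (simp add: algebra_simps diff_mult_distrib2)
  have "(\<Sum>v\<in>?V. hdegree H v) = (\<Sum>v\<in>?V. 1 + (if v \<in> set vs then 1 else 0) + ?y v)"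
    by (rule sum.cong) (auto simp: deg)
  also have "\<dots> = m * (k - 1) + ?g + sum ?y ?V"
    unfolding sum.distrib ind by (simp add: n cg)
  finally show sy: "sum ?y ?V = m - ?g" using handshake[OF D(1), unfolded D(5)] mk by linarith
  \<comment> \<open>Off the cycle (1 + y)^2 = 1 + 2 y + y^2; on it (2 + y)^2 exceeds this by 3 + 2
    y. The sum of all y is already known to be m - g.\<close>
  have "degree_square_sum H = (\<Sum>v\<in>?V. 1 + (if v \<in> set vs then 3 else 0) + 2 * ?y v + (?y v)\<^sup>2
      + (if v \<in> set vs then 2 * ?y v else 0))"
    unfolding degree_square_sum_def
    by (rule sum.cong) (auto simp: deg power2_eq_square algebra_simps)
  also have "\<dots> = m * (k - 1) + 3 * ?g + 2 * (m - ?g) + (\<Sum>v\<in>?V. (?y v)\<^sup>2) + 2 * sum ?y (set vs)"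
    unfolding sum.distrib ind by (simp add: n cg sum_distrib_left[symmetric] sy)
  finally show "degree_square_sum H = m * (k - 1) + 3 * ?g + 2 * (m - ?g)
      + ((\<Sum>v\<in>?V. (?y v)\<^sup>2) + 2 * sum ?y (set vs))" by simp
qed

section \<open>Identifying the extremal hypergraphs\<close>

lemma is_cycle_rotate:
  assumes "is_cycle H vs es"
  shows "is_cycle H (rotate j vs) (rotate j es)"
proof -
  note c = is_cycleD[OF assms]
  let ?l = "length vs"
  have l: "0 < ?l" using c(2) by linarith
  have nv: "rotate j vs ! i = vs ! ((j + i) mod ?l)" if "i < ?l" for i using that by (rule nth_rotate)
  have ne: "rotate j es ! i = es ! ((j + i) mod ?l)" if "i < ?l" for i
    using that nth_rotate[of i es j] c(1) by simp
  have md: "i mod ?l < ?l" for i using l by simp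
  have "rotate j vs ! i \<in> rotate j es ! i \<and> rotate j vs ! (Suc i mod ?l) \<in> rotate j es ! i"
    if i: "i < ?l" for i
  proof -
    have "rotate j vs ! (Suc i mod ?l) = vs ! (Suc ((j + i) mod ?l) mod ?l)"
      unfolding nv[OF md] by (simp add: mod_Suc_eq mod_add_right_eq)
    then show ?thesis unfolding nv[OF i] ne[OF i] using c(6,7)[OF md] by simp
  qed
  then show ?thesis unfolding is_cycle_def using c by simp
qed

lemma length_3_list: "length xs = 3 \<Longrightarrow> \<exists>x y z. xs = [x, y, z]"
  by (auto simp: numeral_3_eq_3 length_Suc_conv)

text \<open>Together with rotation this brings any two chosen vertices of a triangle to positions 0
  and 1.\<close>

lemma is_cycle_reflect_triangle:
  assumes "is_cycle H [x, y, z] [e, f, h]"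
  shows "is_cycle H [x, z, y] [h, f, e]"
proof -
  note c = is_cycleD[OF assms]
  have mem: "x \<in> e" "y \<in> f" "z \<in> h" "y \<in> e" "z \<in> f" "x \<in> h"
    using c(6)[of 0] c(6)[of 1] c(6)[of 2] c(7)[of 0] c(7)[of 1] c(7)[of 2] by simp_all
  have "[x, z, y] ! i \<in> [h, f, e] ! i \<and> [x, z, y] ! (Suc i mod 3) \<in> [h, f, e] ! i" if "i < 3" for i
  proof -
    consider "i = 0" | "i = 1" | "i = 2" using \<open>i < 3\<close> by linarith
    then show ?thesis by cases (use mem in simp_all)
  qed
  then show ?thesis using c(3-5) by (simp add: is_cycle_def) blast
qed

lemma cycle_star_class:
  assumes "2 \<le> k" "3 \<le> g"
  shows "cycle_star k g p \<in> linear_unicyclic k (g + p)" "girth (cycle_star k g p) = g"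
    "degree_square_sum (cycle_star k g p) = (g + p) * (k - 1) + 3 * g + 2 * p + (p\<^sup>2 + 2 * p)"
proof -
  let ?X = "cycle_star k g p"
  note core = core_cycle_cycle_star[OF assms, where p = p]
  show X: "?X \<in> linear_unicyclic k (g + p)"
    using core_cycle_linear_unicyclic[OF core(1)] core(2) by simp
  show "girth ?X = g" using core_girth[OF core(1)] by simp
  have y: "excess ?X [0..<g] v = (if v = 0 then p else 0)" if "v \<in> verts ?X" for v
    using core(3)[where i = v] core_degree[OF core(1) that] assms(2) by (cases "v < g") (simp_all add: excess_def)
  have sub: "set [0..<g] \<subseteq> verts ?X" by (rule core_subset_verts[OF core(1)])
  then have v0: "0 \<in> verts ?X" "finite (verts ?X)" using assms(2) by (auto simp: verts_def)
  have "(\<Sum>v\<in>verts ?X. (excess ?X [0..<g] v)\<^sup>2) = (\<Sum>v\<in>verts ?X. if v = 0 then p\<^sup>2 else 0)"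
    by (rule sum.cong) (auto simp: y)
  moreover have "sum (excess ?X [0..<g]) (set [0..<g]) = (\<Sum>v\<in>set [0..<g]. if v = 0 then p else 0)"
    by (rule sum.cong) (use y sub in auto)
  ultimately show "degree_square_sum ?X = (g + p) * (k - 1) + 3 * g + 2 * p + (p\<^sup>2 + 2 * p)"
    using degree_excess(4)[OF X assms(1) core_is_cycle[OF core(1)]] v0 assms(2) by simp
qed

lemma triangle_pendants_class:
  assumes "2 \<le> k"
  shows "triangle_pendants k p 1 0 \<in> linear_unicyclic k (p + 4)"
    "degree_square_sum (triangle_pendants k p 1 0)
      = (p + 4) * (k - 1) + 9 + 2 * (p + 1) + (p\<^sup>2 + 1 + 2 * (p + 1))"
proof -
  let ?X = "triangle_pendants k p 1 0"
  note core = core_cycle_triangle_pendants[OF assms, where ?n1.0 = p and ?n2.0 = 1 and ?n3.0 = 0]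
  show X: "?X \<in> linear_unicyclic k (p + 4)"
    using core_cycle_linear_unicyclic[OF core(1)] core(2) by (simp add: add.commute)
  have y: "excess ?X [0..<3] v = (if v = 0 then p else if v = 1 then 1 else 0)" if "v \<in> verts ?X" for v
    using core(3)[where i = v] core_degree[OF core(1) that] by (cases "v < 3") (auto simp: excess_def)
  have core_set: "set [0..<3] = {0, 1, 2::nat}" by auto
  have sub: "{0, 1, 2} \<subseteq> verts ?X"
    using core_subset_verts[OF core(1)] unfolding core_set .
  have fin: "finite (verts ?X)" by (simp add: verts_def)
  have "(\<Sum>v\<in>verts ?X. (excess ?X [0..<3] v)\<^sup>2) = (\<Sum>v\<in>{0, 1}. (excess ?X [0..<3] v)\<^sup>2)"
    by (rule sum.mono_neutral_right[OF fin]) (use sub y in auto)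
  then show "degree_square_sum ?X
      = (p + 4) * (k - 1) + 9 + 2 * (p + 1) + (p\<^sup>2 + 1 + 2 * (p + 1))"
    using degree_excess(4)[OF X assms core_is_cycle[OF core(1)]] core_set sub y by simp
qed

text \<open>With all excess at \<open>v\<close>, every vertex off the cycle is cored, so
  \<open>core_cycleI\<close> applies. Rotating \<open>v\<close> to position 0 makes the degrees
  along the cycle agree with those of the star.\<close>

lemma isomorphic_cycle_star:
  assumes H: "H \<in> linear_unicyclic k m" "2 \<le> k" and cyc: "is_cycle H vs es"
    and v: "v \<in> set vs" "excess H vs v = m - length vs"
  shows "H \<cong>\<^sub>h cycle_star k (length vs) (m - length vs)"
proof -
  let ?g = "length vs" and ?V = "verts H"
  note D = linear_unicyclicD[OF H(1)] and E = degree_excess[OF H cyc]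
  have finV: "finite ?V" by (simp add: verts_def)
  have sub: "set vs \<subseteq> ?V" by (rule cycle_subset_verts[OF D(1) cyc])
  have zero: "excess H vs u = 0" if "u \<in> ?V" "u \<noteq> v" for u
    using nat_sum_all[OF finV, of v "excess H vs" u] v sub E(3) that by auto
  obtain j where j: "j < ?g" "v = vs ! j" using v(1) by (metis in_set_conv_nth)
  let ?vs = "rotate j vs" and ?es = "rotate j es"
  have cyc': "is_cycle H ?vs ?es" by (rule is_cycle_rotate[OF cyc])
  have g3: "3 \<le> ?g" by (rule linear_cycle_length[OF D(1,2) cyc])
  have "hdegree H u = 1" if "u \<in> ?V" "u \<notin> set ?vs" for u
    using E(1)[OF that(1)] zero[OF that(1)] v(1) that(2) by auto
  then have core: "core_cycle k H ?vs ?es" by (rule core_cycleI[OF H cyc'])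
  have nil: "vs \<noteq> []" using g3 by auto
  then have first: "?vs ! 0 = v" using nth_rotate[of 0 vs j] j by simp
  have deg: "hdegree H (?vs ! i) = 2 + (if i = 0 then m - ?g else 0)" if i: "i < ?g" for i
  proof -
    have mem: "?vs ! i \<in> set vs" using i by (metis length_rotate nth_mem set_rotate)
    have "?vs ! i = v \<longleftrightarrow> i = 0"
      using nth_eq_iff_index_eq[OF is_cycleD(3)[OF cyc'], of i 0] i nil first by auto
    then show ?thesis using E(1)[of "?vs ! i"] zero[of "?vs ! i"] v(2) mem sub by auto
  qed
  show ?thesis
    by (rule core_cycle_isomorphic[OF core core_cycle_cycle_star(1)[OF H(2) g3]])
      (use deg core_cycle_cycle_star(3)[OF H(2) g3] in auto)
qed

lemma isomorphic_triangle_pendants: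
  assumes H: "H \<in> linear_unicyclic k m" "2 \<le> k" and cyc: "is_cycle H vs es" and len: "length vs = 3"
    and m: "5 \<le> m"
    and ab: "a \<in> set vs" "b \<in> set vs" "a \<noteq> b" "excess H vs a = m - 4" "excess H vs b = 1"
  shows "H \<cong>\<^sub>h triangle_pendants k (m - 4) 1 0"
proof -
  let ?V = "verts H"
  note D = linear_unicyclicD[OF H(1)] and E = degree_excess[OF H cyc]
  have finV: "finite ?V" by (simp add: verts_def)
  have sub: "set vs \<subseteq> ?V" by (rule cycle_subset_verts[OF D(1) cyc])
  have zero: "excess H vs u = 0" if "u \<in> ?V" "u \<noteq> a" "u \<noteq> b" for u
  proof -
    \<comment> \<open>The excesses m - 4 at \<open>a\<close> and 1 at \<open>b\<close> already
      exhaust the total m - 3.\<close>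
    have "sum (excess H vs) {a, b, u} \<le> sum (excess H vs) ?V"
      using that ab sub finV by (intro sum_mono2) auto
    then show ?thesis using E(3) len m ab that by simp
  qed
  obtain j where j: "j < length vs" "a = vs ! j" using ab(1) by (metis in_set_conv_nth)
  have cyc1: "is_cycle H (rotate j vs) (rotate j es)" by (rule is_cycle_rotate[OF cyc])
  have first: "rotate j vs ! 0 = a" using nth_rotate[of 0 vs j] j len by simp
  obtain x y z where xyz: "rotate j vs = [x, y, z]"
    using length_3_list[of "rotate j vs"] len by auto
  have "length (rotate j es) = 3" using is_cycleD(1)[OF cyc] len by simp
  then obtain e f h where efh: "rotate j es = [e, f, h]"
    using length_3_list by blast
  have x: "x = a" using first xyz by simp
  have set: "set vs = {a, y, z}" using set_rotate[of j vs] unfolding xyz x by simp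
  have c1: "is_cycle H [a, y, z] [e, f, h]" using cyc1 xyz efh x by simp
  have "\<exists>w fs. is_cycle H [a, b, w] fs \<and> set vs = {a, b, w}"
  proof (cases "b = y")
    case True
    then show ?thesis using c1 set by blast
  next
    case False
    then have "b = z" using ab set by auto
    then show ?thesis using is_cycle_reflect_triangle[OF c1] set by blast
  qed
  then obtain w fs where w: "is_cycle H [a, b, w] fs" "set vs = {a, b, w}" by blast
  have wab: "w \<noteq> a" "w \<noteq> b" "w \<in> ?V" using is_cycleD(3)[OF w(1)] w(2) sub by auto
  have "hdegree H u = 1" if "u \<in> ?V" "u \<notin> set [a, b, w]" for u
    using E(1)[OF that(1)] zero[OF that(1)] w(2) that(2) by auto
  then have core: "core_cycle k H [a, b, w] fs" by (rule core_cycleI[OF H w(1)])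
  have dabw: "hdegree H a = 2 + (m - 4)" "hdegree H b = 2 + 1" "hdegree H w = 2 + 0"
    using E(1)[of a] E(1)[of b] E(1)[of w] zero[OF wab(3,1,2)] ab w(2) sub by auto
  have deg: "hdegree H ([a, b, w] ! i) = 2 + (if i = 0 then m - 4 else if i = 1 then 1 else 0)"
    if "i < 3" for i
  proof -
    consider "i = 0" | "i = 1" | "i = 2" using \<open>i < 3\<close> by linarith
    then show ?thesis by cases (use dabw in simp_all)
  qed
  show ?thesis
    by (rule core_cycle_isomorphic[OF core core_cycle_triangle_pendants(1)[OF H(2)]])
      (use deg core_cycle_triangle_pendants(3)[OF H(2)] in auto)
qed

text \<open>Serves to show that the candidate for second place is not isomorphic to the
  star.\<close>

lemma degree_square_sum_isomorphic:
  assumes "uniform k H" "H \<cong>\<^sub>h K"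
  shows "degree_square_sum H = degree_square_sum K"
proof -
  obtain f where f: "bij_betw f (verts H) (verts K)" "(`) f ` hedges H = hedges K"
    using assms(2) by (auto simp: isomorphic_hg_def)
  have deg: "hdegree K (f v) = hdegree H v" if v: "v \<in> verts H" for v
  proof -
    have sub: "{e \<in> hedges H. v \<in> e} \<subseteq> Pow (verts H)" using assms(1) by (auto simp: uniform_def)
    have inj: "inj_on ((`) f) (Pow (verts H))"
      using bij_betw_imp_inj_on[OF f(1)] by (rule inj_on_image_Pow)
    have mem: "f v \<in> f ` e \<longleftrightarrow> v \<in> e" if "e \<in> hedges H" for e
      using inj_on_image_mem_iff[OF bij_betw_imp_inj_on[OF f(1)] v, of e] assms(1) that
      by (auto simp: uniform_def)
    have "{e \<in> hedges K. f v \<in> e} = (`) f ` {e \<in> hedges H. v \<in> e}"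
      unfolding f(2)[symmetric] using mem by auto
    then show ?thesis unfolding hdegree_def using card_image[OF inj_on_subset[OF inj sub]] by simp
  qed
  have "degree_square_sum K = (\<Sum>v\<in>verts H. (hdegree K (f v))\<^sup>2)"
    unfolding degree_square_sum_def by (rule sum.reindex_bij_betw[OF f(1), symmetric])
  then show ?thesis unfolding degree_square_sum_def by (simp add: deg)
qed

section \<open>Comparison of moments\<close>

lemma moment_value_less:
  assumes "0 < \<alpha>" "2 \<le> k" "nverts H = nverts K" "card (hedges H) = card (hedges K)"
    "degree_square_sum H < degree_square_sum K"
  shows "moment_value k \<alpha> H < moment_value k \<alpha> K"
proof -
  have "\<alpha>\<^sup>2 * real (degree_square_sum H) < \<alpha>\<^sup>2 * real (degree_square_sum K)"
    using assms(1,5) by simp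
  moreover have "0 < real (k - 1) ^ (nverts K - 1)" using assms(2) by simp
  ultimately have "real (k - 1) ^ (nverts K - 1) * (\<alpha>\<^sup>2 * real (degree_square_sum H))
      < real (k - 1) ^ (nverts K - 1) * (\<alpha>\<^sup>2 * real (degree_square_sum K))"
    by (rule mult_strict_left_mono)
  then show ?thesis
    unfolding moment_value_def degree_square_sum_def[symmetric] assms(3,4) by (rule add_strict_right_mono)
qed

lemma linear_unicyclic_cycle:
  assumes "H \<in> linear_unicyclic k m" "2 \<le> k"
  obtains vs es where "is_cycle H vs es" "length vs = girth H" "3 \<le> length vs" "length vs \<le> m"
proof -
  note D = linear_unicyclicD[OF assms(1)]
  obtain vs es where "is_cycle H vs es" using D(3) by (auto simp: unicyclic_def)
  then have "\<exists>l us fs. is_cycle H us fs \<and> length us = l" by blast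
  then have "\<exists>us fs. is_cycle H us fs \<and> length us = girth H" unfolding girth_def by (rule LeastI_ex)
  then obtain us fs where c: "is_cycle H us fs" "length us = girth H" by blast
  show thesis
    using that[OF c linear_cycle_length[OF D(1,2) c(1)] degree_excess(2)[OF assms c(1)]] .
qed

lemma linear_unicyclic_two_verts:
  assumes "H \<in> linear_unicyclic k m" "2 \<le> k"
  shows "2 \<le> nverts H"
proof -
  obtain vs es where c: "is_cycle H vs es" "length vs = girth H" "3 \<le> length vs" "length vs \<le> m"
    using linear_unicyclic_cycle[OF assms] .
  have "1 * 2 \<le> (k - 1) * m" using c(3,4) assms(2) by (intro mult_le_mono) linarith+
  then show ?thesis using linear_unicyclic_nverts[OF assms] by (simp add: mult.commute)
qed

lemma spectral_moment_less:
  assumes "0 < \<alpha>" "2 \<le> k" "H \<in> linear_unicyclic k m" "K \<in> linear_unicyclic k m"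
    "degree_square_sum H < degree_square_sum K"
  shows "spectral_moment k \<alpha> 2 H < spectral_moment k \<alpha> 2 K"
proof -
  note D = linear_unicyclicD[OF assms(3)] linear_unicyclicD[OF assms(4)]
  have "moment_value k \<alpha> H < moment_value k \<alpha> K"
    using moment_value_less[OF assms(1,2) _ _ assms(5)]
      linear_unicyclic_nverts[OF assms(3,2)] linear_unicyclic_nverts[OF assms(4,2)] D(5,10) by simp
  then show ?thesis
    using spectral_moment_2[OF D(1) assms(2) linear_unicyclic_two_verts[OF assms(3,2)]]
      spectral_moment_2[OF D(6) assms(2) linear_unicyclic_two_verts[OF assms(4,2)]] by simp
qed

lemma cycle_excess_bound:
  assumes H: "H \<in> linear_unicyclic k m" "2 \<le> k" and cyc: "is_cycle H vs es"
  defines "s \<equiv> m - length vs"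
  shows "degree_square_sum H \<le> m * (k - 1) + 3 * length vs + 2 * s + (s\<^sup>2 + 2 * s)"
    and "\<not> H \<cong>\<^sub>h cycle_star k (length vs) s \<Longrightarrow>
      degree_square_sum H < m * (k - 1) + 3 * length vs + 2 * s + (s\<^sup>2 + 2 * s)"
proof -
  note E = degree_excess[OF H cyc, folded s_def]
  have A: "finite (verts H)" "set vs \<subseteq> verts H" "set vs \<noteq> {}"
    using cycle_subset_verts[OF linear_unicyclicD(1)[OF H(1)] cyc] is_cycleD(2)[OF cyc]
    by (auto simp: verts_def)
  note S = sum_squares_concentrated[OF A E(3)]
  show le: "degree_square_sum H \<le> m * (k - 1) + 3 * length vs + 2 * s + (s\<^sup>2 + 2 * s)"
    unfolding E(4) by (rule add_left_mono) (rule S(1))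
  assume ni: "\<not> H \<cong>\<^sub>h cycle_star k (length vs) s"
  have "\<not> s\<^sup>2 + 2 * s \<le> (\<Sum>v\<in>verts H. (excess H vs v)\<^sup>2) + 2 * sum (excess H vs) (set vs)"
  proof
    assume "s\<^sup>2 + 2 * s \<le> (\<Sum>v\<in>verts H. (excess H vs v)\<^sup>2) + 2 * sum (excess H vs) (set vs)"
    then obtain v where "v \<in> set vs" "excess H vs v = s" using S(2) by blast
    then show False using isomorphic_cycle_star[OF H cyc] ni unfolding s_def by blast
  qed
  then show "degree_square_sum H < m * (k - 1) + 3 * length vs + 2 * s + (s\<^sup>2 + 2 * s)"
    unfolding E(4) by linarith
qed

text \<open>Outside the squares the two sides are 4 m - g and 4 m - 2, and (m - g)^2 \<le> (m -
  4)^2. The right-hand side is the runner-up value for girth 3, so the bound serves for first and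
  second place.\<close>

lemma cycle_bound_decreasing:
  fixes g m :: nat
  assumes "3 < g" "g \<le> m"
  shows "3 * g + 2 * (m - g) + ((m - g)\<^sup>2 + 2 * (m - g))
    < 9 + 2 * (m - 3) + ((m - 4)\<^sup>2 + 1 + 2 * (m - 3))"
proof -
  obtain u where u: "m = g + u" using assms(2) by (metis le_Suc_ex)
  obtain t where t: "g = t + 4" using assms(1) by (metis add.commute le_Suc_ex Suc_leI Suc_numeral semiring_norm(2,8))
  have "3 * (t + 4) + 2 * u + (p + 2 * u) < 9 + 2 * (t + u + 1) + (q + 1 + 2 * (t + u + 1))"
    if "p \<le> q" for p q :: nat using that by simp
  moreover have "u\<^sup>2 \<le> (t + u)\<^sup>2" by (rule power_mono) simp_all
  moreover have d: "m - g = u" "m - 3 = t + u + 1" "m - 4 = t + u" using u t by simp_all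
  ultimately show ?thesis unfolding d unfolding t by blast
qed

lemma triangle_second_bound:
  assumes H: "H \<in> linear_unicyclic k m" "2 \<le> k" and m: "5 \<le> m" and cyc: "is_cycle H vs es" "length vs = 3"
    and ns: "\<not> H \<cong>\<^sub>h cycle_star k 3 (m - 3)" and nt: "\<not> H \<cong>\<^sub>h triangle_pendants k (m - 4) 1 0"
  shows "degree_square_sum H < m * (k - 1) + 9 + 2 * (m - 3) + ((m - 4)\<^sup>2 + 1 + 2 * (m - 3))"
proof -
  note E = degree_excess[OF H cyc(1), unfolded cyc(2)]
  have A: "finite (verts H)" "set vs \<subseteq> verts H" "set vs \<noteq> {}"
    using cycle_subset_verts[OF linear_unicyclicD(1)[OF H(1)] cyc(1)] cyc(2)
    by (auto simp: verts_def)
  have s: "2 \<le> m - 3" "m - 3 - 1 = m - 4" using m by auto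
  have none: "excess H vs v \<noteq> m - 3" if "v \<in> set vs" for v
    using isomorphic_cycle_star[OF H cyc(1) that] ns cyc(2) by auto
  note S = sum_squares_spread[OF A E(3) s(1) none, unfolded s(2)]
  have "\<not> (m - 4)\<^sup>2 + 1 + 2 * (m - 3) \<le> (\<Sum>v\<in>verts H. (excess H vs v)\<^sup>2) + 2 * sum (excess H vs) (set vs)"
  proof
    assume "(m - 4)\<^sup>2 + 1 + 2 * (m - 3) \<le> (\<Sum>v\<in>verts H. (excess H vs v)\<^sup>2) + 2 * sum (excess H vs) (set vs)"
    then obtain a b where "a \<in> set vs" "b \<in> set vs" "a \<noteq> b" "excess H vs a = m - 4" "excess H vs b = 1"
      using S(2) by blast
    then show False using isomorphic_triangle_pendants[OF H cyc m] nt by blast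
  qed
  then show ?thesis unfolding E(4) by linarith
qed

theorem theorem7p1:
  fixes k :: nat and \<alpha> :: real
  assumes "2 \<le> k" and "0 < \<alpha>" and "\<alpha> < 1"
  shows "(\<forall>m g. 3 \<le> g \<and> g \<le> m \<longrightarrow>
            has_largest (spectral_moment k \<alpha> 2)
              {H \<in> linear_unicyclic k m. girth H = g} (cycle_star k g (m - g)))
       \<and> (\<forall>m\<ge>3. has_largest (spectral_moment k \<alpha> 2) (linear_unicyclic k m) (cycle_star k 3 (m - 3)))
       \<and> (\<forall>m\<ge>5. has_largest (spectral_moment k \<alpha> 2)
              {H \<in> linear_unicyclic k m. \<not> H \<cong>\<^sub>h cycle_star k 3 (m - 3)}
              (triangle_pendants k (m - 4) 1 0))
       \<and> (\<forall>m. \<forall>H\<in>linear_unicyclic k m.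
            tensor_moment k (nverts H) 2 (A_alpha k \<alpha> H) =
            complex_of_real (tensor_trace k (nverts H) 2 (A_alpha k \<alpha> H)))"
proof (intro conjI allI impI ballI)
  fix m g :: nat assume g: "3 \<le> g \<and> g \<le> m"
  let ?X = "cycle_star k g (m - g)"
  have X: "?X \<in> linear_unicyclic k m" "girth ?X = g"
    "degree_square_sum ?X = m * (k - 1) + 3 * g + 2 * (m - g) + ((m - g)\<^sup>2 + 2 * (m - g))"
    using cycle_star_class[OF assms(1), of g "m - g"] g by simp_all
  show "has_largest (spectral_moment k \<alpha> 2) {H \<in> linear_unicyclic k m. girth H = g} ?X"
    unfolding has_largest_def
  proof (intro conjI ballI impI)
    fix H assume H: "H \<in> {H \<in> linear_unicyclic k m. girth H = g}" and ni: "\<not> H \<cong>\<^sub>h ?X"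
    then have H': "H \<in> linear_unicyclic k m" "girth H = g" by auto
    obtain vs es where c: "is_cycle H vs es" "length vs = girth H"
      using linear_unicyclic_cycle[OF H'(1) assms(1)] .
    then have "length vs = g" using H'(2) by simp
    then have "degree_square_sum H < degree_square_sum ?X"
      using cycle_excess_bound(2)[OF H'(1) assms(1) c(1)] ni X(3) by simp
    then show "spectral_moment k \<alpha> 2 H < spectral_moment k \<alpha> 2 ?X"
      by (rule spectral_moment_less[OF assms(2,1) H'(1) X(1)])
  qed (use X in simp)
next
  fix m :: nat assume m: "3 \<le> m"
  let ?X = "cycle_star k 3 (m - 3)"
  have X: "?X \<in> linear_unicyclic k m"
    "degree_square_sum ?X = m * (k - 1) + 9 + 2 * (m - 3) + ((m - 3)\<^sup>2 + 2 * (m - 3))"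
    using cycle_star_class[OF assms(1), of 3 "m - 3"] m by simp_all
  show "has_largest (spectral_moment k \<alpha> 2) (linear_unicyclic k m) ?X"
    unfolding has_largest_def
  proof (intro conjI ballI impI)
    fix H assume H: "H \<in> linear_unicyclic k m" and ni: "\<not> H \<cong>\<^sub>h ?X"
    obtain vs es where c: "is_cycle H vs es" "length vs = girth H" "3 \<le> length vs" "length vs \<le> m"
      using linear_unicyclic_cycle[OF H assms(1)] .
    have "degree_square_sum H < degree_square_sum ?X"
    proof (cases "length vs = 3")
      case True
      then show ?thesis using cycle_excess_bound(2)[OF H assms(1) c(1)] ni X(2) by simp
    next
      case False
      then have g: "3 < length vs" using c(3) by simp
      \<comment> \<open>The runner-up value for girth 3 does not exceed the value of the star, so
        falling below the former suffices.\<close>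
      have "(m - 4)\<^sup>2 + 1 \<le> (m - 3)\<^sup>2"
      proof -
        obtain t where "m = t + 4" using g c(4) by (metis add.commute le_Suc_ex Suc_leI Suc_numeral le_trans semiring_norm(2,8))
        then show ?thesis by (simp add: power2_eq_square)
      qed
      then show ?thesis
        using cycle_bound_decreasing[OF g c(4)] cycle_excess_bound(1)[OF H assms(1) c(1)]
        unfolding X(2) by linarith
    qed
    then show "spectral_moment k \<alpha> 2 H < spectral_moment k \<alpha> 2 ?X"
      by (rule spectral_moment_less[OF assms(2,1) H X(1)])
  qed (rule X(1))
next
  fix m :: nat assume m: "5 \<le> m"
  let ?S = "cycle_star k 3 (m - 3)" and ?X = "triangle_pendants k (m - 4) 1 0"
  have m': "m - 4 + 4 = m" "m - 4 + 1 = m - 3" using m by auto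
  note X = triangle_pendants_class[OF assms(1), of "m - 4", unfolded m']
  have S: "degree_square_sum ?S = m * (k - 1) + 9 + 2 * (m - 3) + ((m - 3)\<^sup>2 + 2 * (m - 3))"
    using cycle_star_class(3)[OF assms(1), of 3 "m - 3"] m by simp
  \<comment> \<open>The two degree square sums differ by 2 m - 8, which is positive from m = 5
    on.\<close>
  have "\<not> ?X \<cong>\<^sub>h ?S"
  proof
    assume "?X \<cong>\<^sub>h ?S"
    then have "degree_square_sum ?X = degree_square_sum ?S"
      by (rule degree_square_sum_isomorphic[OF linear_unicyclicD(1)[OF X(1)]])
    moreover obtain t where "m = t + 5" using m by (metis add.commute le_Suc_ex)
    ultimately show False unfolding X(2) S by (simp add: power2_eq_square)
  qed
  then have XG: "?X \<in> {H \<in> linear_unicyclic k m. \<not> H \<cong>\<^sub>h ?S}" using X(1) by blast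
  show "has_largest (spectral_moment k \<alpha> 2) {H \<in> linear_unicyclic k m. \<not> H \<cong>\<^sub>h ?S} ?X"
    unfolding has_largest_def
  proof (intro conjI ballI impI)
    fix H assume "H \<in> {H \<in> linear_unicyclic k m. \<not> H \<cong>\<^sub>h ?S}" and nt: "\<not> H \<cong>\<^sub>h ?X"
    then have H: "H \<in> linear_unicyclic k m" and ns: "\<not> H \<cong>\<^sub>h ?S" by auto
    obtain vs es where c: "is_cycle H vs es" "length vs = girth H" "3 \<le> length vs" "length vs \<le> m"
      using linear_unicyclic_cycle[OF H assms(1)] .
    have "degree_square_sum H < degree_square_sum ?X"
    proof (cases "length vs = 3")
      case True
      show ?thesis unfolding X(2) by (rule triangle_second_bound[OF H assms(1) m c(1) True ns nt])
    next
      case False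
      then have "3 < length vs" using c(3) by simp
      from cycle_bound_decreasing[OF this c(4)] show ?thesis
        using cycle_excess_bound(1)[OF H assms(1) c(1)] unfolding X(2) by linarith
    qed
    then show "spectral_moment k \<alpha> 2 H < spectral_moment k \<alpha> 2 ?X"
      by (rule spectral_moment_less[OF assms(2,1) H X(1)])
  qed (rule XG)
next
  fix m H assume H: "H \<in> linear_unicyclic k m"
  note u = linear_unicyclicD(1)[OF H]
  show "tensor_moment k (nverts H) 2 (A_alpha k \<alpha> H)
      = complex_of_real (tensor_trace k (nverts H) 2 (A_alpha k \<alpha> H))"
    unfolding tensor_moment_2_A_alpha[OF u assms(1) linear_unicyclic_two_verts[OF H assms(1)]]
      tensor_trace_2_A_alpha[OF u assms(1)] ..
qed

end
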